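(* Let $d\ge2$. For the Euclidean Gaussian world $\mathcal M=\mathbb R^d$, $p=\mathcal N(0,I_d)$, one has $\lambda_{\mathrm{nl}}/\lambda=2$. For the uniform spherical world $\mathcal M=\mathbb S^{d-1}(R)\subset\mathbb R^d$ (any radius $R>0$), $p=\operatorname{Unif}(\mathbb S^{d-1}(R))$, one has $\lambda_{\mathrm{nl}}/\lambda=2d/(d-1)>2$. Thus the spherical world has a strictly larger relative linear--nonlinear spectral separation $\lambda_{\mathrm{nl}}/\lambda$ than the Gaussian world.
   Context: For an embedded Riemannian manifold $\mathcal M\subseteq\mathbb R^d$ (with the induced metric) and a smooth strictly positive probability density $p$ with respect to Riemannian volume, the weighted Laplacian is $$D_p\phi=\Delta_{\mathcal M}\phi+\langle\nabla_{\mathcal M}\log p,\nabla_{\mathcal M}\phi\rangle_{\mathcal M}=\frac1p\operatorname{div}_{\mathcal M}(p\nabla_{\mathcal M}\phi),$$ and $-D_p$ is regarded as a self-adjoint operator in $L^2(p)$. In both worlds considered, the ambient coordinate functions $z_1,\dots,z_d$ span the complete first non-constant eigenspace of $-D_p$. $\lambda$ denotes the corresponding eigenvalue (the smallest nonzero eigenvalue of $-D_p$) and $\lambda_{\mathrm{nl}}>\lambda$ denotes the next distinct eigenvalue of $-D_p$. $\mathbb S^{d-1}(R)$ is the sphere of radius $R$ centered at the origin, and $\operatorname{Unif}$ is the normalized Riemannian volume. *)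

theory Defs
  imports "HOL-Probability.Probability"
begin

text \<open>Smoothness on open subsets of Euclidean space, by iterated partial derivatives.\<close>

primrec Ck_on :: "nat \<Rightarrow> 'a::euclidean_space set \<Rightarrow> ('a \<Rightarrow> 'b::real_normed_vector) \<Rightarrow> bool" where
  "Ck_on 0 S f \<longleftrightarrow> continuous_on S f"
| "Ck_on (Suc k) S f \<longleftrightarrow> f differentiable_on S \<and>
     (\<forall>b\<in>Basis. Ck_on k S (\<lambda>x. frechet_derivative f (at x) b))"

definition smooth_on :: "'a::euclidean_space set \<Rightarrow> ('a \<Rightarrow> 'b::real_normed_vector) \<Rightarrow> bool" where
  "smooth_on S f \<longleftrightarrow> (\<forall>k. Ck_on k S f)"

definition smooth_on_manifold :: "'a::euclidean_space set \<Rightarrow> ('a \<Rightarrow> real) \<Rightarrow> bool" where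
  "smooth_on_manifold M \<phi> \<longleftrightarrow>
     (\<forall>x\<in>M. \<exists>U g. open U \<and> x \<in> U \<and> smooth_on U g \<and> (\<forall>y\<in>U \<inter> M. g y = \<phi> y))"

definition test_function :: "'a::euclidean_space set \<Rightarrow> ('a \<Rightarrow> real) \<Rightarrow> bool" where
  "test_function M \<phi> \<longleftrightarrow> smooth_on_manifold M \<phi> \<and>
     (\<exists>K. compact K \<and> K \<subseteq> M \<and> (\<forall>x\<in>M - K. \<phi> x = 0))"


text \<open>
  Calculus on an embedded submanifold \<open>M\<close> with the metric induced from the ambient inner product.
  A function on \<open>M\<close> is a function on the ambient space of which only the values on \<open>M\<close> matter;
  accordingly all derivatives are taken within \<open>M\<close>. When \<open>M\<close> has positive codimension such a
  derivative is unique only in tangent directions.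
\<close>

definition tangent_space :: "'a::euclidean_space set \<Rightarrow> 'a \<Rightarrow> 'a set" where
  "tangent_space M x = {v. \<exists>\<gamma> \<epsilon>. \<epsilon> > 0 \<and> \<gamma> 0 = x \<and> (\<forall>t. \<bar>t\<bar> < \<epsilon> \<longrightarrow> \<gamma> t \<in> M) \<and>
     (\<gamma> has_vector_derivative v) (at (0::real))}"

definition grad :: "'a::euclidean_space set \<Rightarrow> ('a \<Rightarrow> real) \<Rightarrow> 'a \<Rightarrow> 'a" where
  "grad M \<phi> x = (THE v. v \<in> tangent_space M x \<and> (\<phi> has_derivative (\<lambda>h. v \<bullet> h)) (at x within M))"

definition orthonormal_basis :: "'a::euclidean_space set \<Rightarrow> 'a set \<Rightarrow> bool" where
  "orthonormal_basis V B \<longleftrightarrow>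
     B \<subseteq> V \<and> pairwise orthogonal B \<and> (\<forall>e\<in>B. norm e = 1) \<and> span B = V"

text \<open>
  The Levi-Civita connection of the induced metric is the tangential part of the ambient
  derivative. Hence the trace of the covariant derivative of a tangent field \<open>X\<close> is the sum of
  \<open>(D X e) \<bullet> e\<close> over an orthonormal basis of the tangent space. It depends neither on the basis
  nor on the choice of a derivative within \<open>M\<close>.
\<close>

definition divergence :: "'a::euclidean_space set \<Rightarrow> ('a \<Rightarrow> 'a) \<Rightarrow> 'a \<Rightarrow> real" where
  "divergence M X x = (\<Sum>e\<in>(SOME B. orthonormal_basis (tangent_space M x) B).
     frechet_derivative X (at x within M) e \<bullet> e)"

definition laplacian :: "'a::euclidean_space set \<Rightarrow> ('a \<Rightarrow> real) \<Rightarrow> 'a \<Rightarrow> real" where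
  "laplacian M \<phi> = divergence M (grad M \<phi>)"

definition weighted_laplacian ::
  "'a::euclidean_space set \<Rightarrow> ('a \<Rightarrow> real) \<Rightarrow> ('a \<Rightarrow> real) \<Rightarrow> 'a \<Rightarrow> real" where
  "weighted_laplacian M p \<phi> x =
     laplacian M \<phi> x + grad M (\<lambda>y. ln (p y)) x \<bullet> grad M \<phi> x"


text \<open>
  Riemannian volume. Dimensions of Euclidean spaces are types, so the dimension of the manifold
  is passed as a type argument \<open>'m\<close>: local parametrizations are defined on open subsets of
  \<open>real ^ 'm\<close>, and \<open>CARD('m)\<close> has to be the dimension of \<open>M\<close>. The volume is the Borel measure
  on \<open>M\<close> that has density \<open>sqrt (det g)\<close> in every local parametrization, where \<open>g\<close> is the Gram
  matrix of the coordinate vector fields.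
\<close>

definition local_parametrization ::
  "(real ^ 'n) set \<Rightarrow> (real ^ 'm) set \<Rightarrow> (real ^ 'm \<Rightarrow> real ^ 'n) \<Rightarrow> bool" where
  "local_parametrization M U \<psi> \<longleftrightarrow>
     open U \<and> openin (top_of_set M) (\<psi> ` U) \<and> (\<exists>h. homeomorphism U (\<psi> ` U) \<psi> h) \<and>
     smooth_on U \<psi> \<and> (\<forall>u\<in>U. inj (frechet_derivative \<psi> (at u)))"

definition metric_matrix :: "(real ^ 'm \<Rightarrow> real ^ 'n) \<Rightarrow> real ^ 'm \<Rightarrow> real ^ 'm ^ 'm" where
  "metric_matrix \<psi> u =
     transpose (matrix (frechet_derivative \<psi> (at u))) ** matrix (frechet_derivative \<psi> (at u))"

definition riemannian_volume ::
  "'m::finite itself \<Rightarrow> (real ^ 'n) set \<Rightarrow> (real ^ 'n) measure" where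
  "riemannian_volume T M = (THE \<nu>.
     space \<nu> = M \<and> sets \<nu> = sets (restrict_space borel M) \<and>
     (\<forall>U (\<psi> :: real ^ 'm \<Rightarrow> real ^ 'n) B.
        local_parametrization M U \<psi> \<longrightarrow> B \<in> sets borel \<longrightarrow> B \<subseteq> U \<longrightarrow>
        emeasure \<nu> (\<psi> ` B) = (\<integral>\<^sup>+u\<in>B. ennreal (sqrt (det (metric_matrix \<psi> u))) \<partial>lborel)))"

definition weighted_measure ::
  "'m::finite itself \<Rightarrow> (real ^ 'n) set \<Rightarrow> (real ^ 'n \<Rightarrow> real) \<Rightarrow> (real ^ 'n) measure" where
  "weighted_measure T M p = density (riemannian_volume T M) (\<lambda>x. ennreal (p x))"


definition square_integrable :: "'a measure \<Rightarrow> ('a \<Rightarrow> real) \<Rightarrow> bool" where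
  "square_integrable \<mu> u \<longleftrightarrow> u \<in> borel_measurable \<mu> \<and> integrable \<mu> (\<lambda>x. (u x)\<^sup>2)"

definition L2_tendsto :: "'a measure \<Rightarrow> (nat \<Rightarrow> 'a \<Rightarrow> real) \<Rightarrow> ('a \<Rightarrow> real) \<Rightarrow> bool" where
  "L2_tendsto \<mu> f u \<longleftrightarrow> (\<lambda>k. \<integral>\<^sup>+x. ennreal ((f k x - u x)\<^sup>2) \<partial>\<mu>) \<longlonglongrightarrow> 0"

text \<open>
  The graph of \<open>- D\<^sub>p\<close> as a self-adjoint operator in (real) \<open>L\<^sup>2(p)\<close>: the closure of
  \<open>- D\<^sub>p\<close> on the compactly supported smooth functions. On a complete manifold with a smooth
  positive density this operator is essentially self-adjoint, so its closure is its only
  self-adjoint extension. Elements of \<open>L\<^sup>2(p)\<close> are represented by functions; equality in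
  \<open>L\<^sup>2(p)\<close> is equality almost everywhere.
\<close>

definition neg_weighted_laplacian_graph ::
  "'m::finite itself \<Rightarrow> (real ^ 'n) set \<Rightarrow> (real ^ 'n \<Rightarrow> real) \<Rightarrow>
     ((real ^ 'n \<Rightarrow> real) \<times> (real ^ 'n \<Rightarrow> real)) set" where
  "neg_weighted_laplacian_graph T M p = {(u, w).
     square_integrable (weighted_measure T M p) u \<and>
     square_integrable (weighted_measure T M p) w \<and>
     (\<exists>\<phi>. (\<forall>k. test_function M (\<phi> k)) \<and>
        L2_tendsto (weighted_measure T M p) \<phi> u \<and>
        L2_tendsto (weighted_measure T M p) (\<lambda>k x. - weighted_laplacian M p (\<phi> k) x) w)}"

definition eigenspace ::
  "'m::finite itself \<Rightarrow> (real ^ 'n) set \<Rightarrow> (real ^ 'n \<Rightarrow> real) \<Rightarrow> real \<Rightarrow> (real ^ 'n \<Rightarrow> real) set" where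
  "eigenspace T M p l = {u. (u, \<lambda>x. l * u x) \<in> neg_weighted_laplacian_graph T M p}"

definition eigenvalues ::
  "'m::finite itself \<Rightarrow> (real ^ 'n) set \<Rightarrow> (real ^ 'n \<Rightarrow> real) \<Rightarrow> real set" where
  "eigenvalues T M p =
     {l. \<exists>u\<in>eigenspace T M p l. \<not> (AE x in weighted_measure T M p. u x = 0)}"

definition is_least :: "real set \<Rightarrow> real \<Rightarrow> bool" where
  "is_least A l \<longleftrightarrow> l \<in> A \<and> (\<forall>k\<in>A. l \<le> k)"

text \<open>
  The smallest nonzero eigenvalue, together with the requirement that its eigenspace is
  spanned by the ambient coordinate functions, i.e. consists of the linear forms \<open>x \<mapsto> a \<bullet> x\<close>
  (modulo equality almost everywhere).
\<close>

definition linear_eigenvalue ::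
  "'m::finite itself \<Rightarrow> (real ^ 'n) set \<Rightarrow> (real ^ 'n \<Rightarrow> real) \<Rightarrow> real \<Rightarrow> bool" where
  "linear_eigenvalue T M p l \<longleftrightarrow>
     is_least {k \<in> eigenvalues T M p. k \<noteq> 0} l \<and>
     eigenspace T M p l = {u \<in> borel_measurable (weighted_measure T M p).
       \<exists>a. AE x in weighted_measure T M p. u x = a \<bullet> x}"

definition nonlinear_eigenvalue ::
  "'m::finite itself \<Rightarrow> (real ^ 'n) set \<Rightarrow> (real ^ 'n \<Rightarrow> real) \<Rightarrow> real \<Rightarrow> bool" where
  "nonlinear_eigenvalue T M p l \<longleftrightarrow>
     (\<exists>l\<^sub>1. linear_eigenvalue T M p l\<^sub>1 \<and> is_least {k \<in> eigenvalues T M p. k > l\<^sub>1} l)"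


definition std_gaussian :: "real ^ 'n \<Rightarrow> real" where
  "std_gaussian x = (\<Prod>i\<in>UNIV. std_normal_density (x $ i))"

definition unif_density :: "'m::finite itself \<Rightarrow> (real ^ 'n) set \<Rightarrow> real ^ 'n \<Rightarrow> real" where
  "unif_density T M x = 1 / measure (riemannian_volume T M) M"

end

(* In both worlds -D_p maps the k-th power of a linear form (a . x)^k to
   lam_k (a . x)^k - k (k - 1) |a|^2 (a . x)^(k - 2), where lam_k = k in the Gaussian world and
   lam_k = k (k + d - 2) / R^2 in the spherical one. Since -D_p is symmetric, testing the eigenvalue
   equation -D_p u = l u against (a . x)^k gives
   (lam_k - l) <u, (a . x)^k> = k (k - 1) |a|^2 <u, (a . x)^(k - 2)>.
   If l is none of the lam_k, then all moments of u vanish, hence so does the Fourier transform of u dp,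
   and u = 0. If l = lam_1, subtract from u its projection to the linear forms; the same argument
   shows that the difference vanishes. So the nonzero eigenvalues are among lam_1 < lam_2 < ..., and
   x_i and x_i x_j (i different from j) are eigenfunctions for lam_1 and lam_2.

   Symmetry comes from the invariance of the measures: Lebesgue measure under translations, and the
   surface measure under rotations, the spherical Laplacian being R^(-2) times the sum of the squares of the
   generators x_i d_j - x_j d_i of rotations. The surface measure is d / R times the Lebesgue measure of the cone
   over a set. *)

theory Submission
  imports Defs
begin

section \<open>Smooth functions\<close>

text \<open>An element of an eigenspace is only an L2 limit of test functions whose images under the
  operator converge; it has no derivatives of its own. The operator is therefore moved onto a
  polynomial at the level of test functions, and the limit is taken afterwards. Powers of linear
  forms serve as partners because one formula covers all degrees in both worlds and because their
  integrals against \<open>u\<close> are, up to constants, the Taylor coefficients of the Fourier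
  transform. Conversely, an eigenfunction of the Gaussian world has no compact support and must be
  cut off, with error terms under a common exponential bound. The volume is a definite description
  that quantifies over all charts: it can be used only after a concrete measure has been shown to
  satisfy every chart formula and to be the only one that does. A derivative within the sphere is
  arbitrary off the tangent space, so intrinsic quantities are computed from ambient smooth
  extensions and evaluated on tangent vectors.\<close>

lemma frechet_derivative_eq_has_derivative:
  "(f has_derivative f') (at x) \<Longrightarrow> frechet_derivative f (at x) = f'"
  using frechet_derivative_at by metis

lemma has_derivative_cong_open:
  assumes "open S" "x \<in> S" "\<And>y. y \<in> S \<Longrightarrow> f y = g y"
  shows "(f has_derivative D) (at x) \<longleftrightarrow> (g has_derivative D) (at x)"
  using assms has_derivative_transform_within_open[of f D x UNIV S g]
    has_derivative_transform_within_open[of g D x UNIV S f] by auto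

text \<open>On an open set \<open>Ck_on\<close> depends only on the values there, so the choice
  hidden in \<open>frechet_derivative\<close> can be replaced by any derivative given explicitly.
  Most closure rules below are inductions through this rule.\<close>

lemma Ck_on_SucI:
  assumes "\<And>x. x \<in> S \<Longrightarrow> (f has_derivative f' x) (at x)"
    and "\<And>b. b \<in> Basis \<Longrightarrow> Ck_on k S (\<lambda>x. f' x b)" and "open S"
  shows "Ck_on (Suc k) S f"
proof -
  have cong: "Ck_on k S f \<Longrightarrow> (\<And>x. x \<in> S \<Longrightarrow> f x = g x) \<Longrightarrow> Ck_on k S g" for k and f g :: "'a \<Rightarrow> 'b"
  proof (induction k arbitrary: f g)
    case 0 then show ?case by (simp cong: continuous_on_cong)
  next
    case (Suc k)
    have "frechet_derivative f (at x) = frechet_derivative g (at x)" if "x \<in> S" for x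
      unfolding frechet_derivative_def
      using has_derivative_cong_open[OF \<open>open S\<close> that, of f g] Suc.prems(2) by simp
    then have "Ck_on k S (\<lambda>x. frechet_derivative g (at x) b)" if "b \<in> Basis" for b
      using Suc.prems Suc.IH[of "\<lambda>x. frechet_derivative f (at x) b" "\<lambda>x. frechet_derivative g (at x) b"] that by simp
    moreover have "g differentiable_on S"
      using Suc.prems unfolding differentiable_on_def
      by (metis Ck_on.simps(2) differentiable_on_def differentiable_transform_within zero_less_one)
    ultimately show ?case by simp
  qed
  have "f differentiable_on S"
    using assms(1) by (meson differentiable_def differentiable_at_imp_differentiable_on)
  moreover have "Ck_on k S (\<lambda>x. frechet_derivative f (at x) b)" if "b \<in> Basis" for b
    by (rule cong[OF assms(2)[OF that]]) (simp add: frechet_derivative_eq_has_derivative[OF assms(1)])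
  ultimately show ?thesis by simp
qed

lemma Ck_on_cong:
  assumes "open S" "\<And>x. x \<in> S \<Longrightarrow> f x = g x" "Ck_on k S f"
  shows "Ck_on k S g"
proof (cases k)
  case 0 with assms show ?thesis by (simp cong: continuous_on_cong)
next
  case (Suc k')
  have "(f has_derivative frechet_derivative f (at x)) (at x)" if "x \<in> S" for x
    using assms(1,3) Suc that by (simp add: differentiable_on_eq_differentiable_at frechet_derivative_works)
  then have "(g has_derivative frechet_derivative f (at x)) (at x)" if "x \<in> S" for x
    using has_derivative_cong_open[OF assms(1) that, of f g] assms(2) that by blast
  then show ?thesis
    using assms Suc unfolding Suc by (intro Ck_on_SucI) auto
qed

lemma Ck_on_has_derivative:
  assumes "Ck_on (Suc k) S f" "open S" "x \<in> S"
  shows "(f has_derivative frechet_derivative f (at x)) (at x)"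
  using assms by (simp add: differentiable_on_eq_differentiable_at frechet_derivative_works)

lemma Ck_on_SucD: "Ck_on (Suc k) S f \<Longrightarrow> Ck_on k S f"
  by (induction k arbitrary: f) (auto simp: differentiable_imp_continuous_on)

lemma Ck_on_imp_continuous_on: "Ck_on k S f \<Longrightarrow> continuous_on S f"
  by (cases k) (auto simp: differentiable_imp_continuous_on)

lemma Ck_on_const: "open S \<Longrightarrow> Ck_on k S (\<lambda>x. c)"
proof (induction k arbitrary: c)
  case (Suc k) then show ?case by (intro Ck_on_SucI[where f'="\<lambda>_ _. 0"]) auto
qed simp

lemma Ck_on_bounded_linear_compose:
  assumes "bounded_linear L" "open S"
  shows "Ck_on k S f \<Longrightarrow> Ck_on k S (\<lambda>x. L (f x))"
proof (induction k arbitrary: f)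
  case 0 then show ?case using assms(1) by (simp add: linear_continuous_on_compose bounded_linear.continuous_on)
next
  case (Suc k)
  show ?case
    by (rule Ck_on_SucI[OF bounded_linear.has_derivative[OF assms(1) Ck_on_has_derivative[OF Suc.prems assms(2)]]])
      (use Suc assms in auto)
qed

lemma Ck_on_bounded_linear:
  assumes "bounded_linear L" "open S" shows "Ck_on k S L"
proof (cases k)
  case 0 then show ?thesis using assms by (simp add: linear_continuous_on)
next
  case (Suc k')
  show ?thesis unfolding Suc
    by (rule Ck_on_SucI[where f'="\<lambda>_. L"]) (use assms Ck_on_const in \<open>auto intro: bounded_linear_imp_has_derivative\<close>)
qed

lemma Ck_on_add:
  assumes "open S"
  shows "Ck_on k S f \<Longrightarrow> Ck_on k S g \<Longrightarrow> Ck_on k S (\<lambda>x. f x + g x)"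
proof (induction k arbitrary: f g)
  case 0 then show ?case by (simp add: continuous_on_add)
next
  case (Suc k)
  show ?case
    by (rule Ck_on_SucI[OF has_derivative_add[OF Ck_on_has_derivative[OF Suc.prems(1) assms] Ck_on_has_derivative[OF Suc.prems(2) assms]]])
      (use Suc assms in auto)
qed

lemma Ck_on_sum:
  assumes "open S" "\<And>i. i \<in> I \<Longrightarrow> Ck_on k S (f i)"
  shows "Ck_on k S (\<lambda>x. \<Sum>i\<in>I. f i x)"
  using assms(2)
proof (induction I rule: infinite_finite_induct)
  case (insert i I) then show ?case using Ck_on_add[OF assms(1), of k "f i" "\<lambda>x. \<Sum>i\<in>I. f i x"] by simp
qed (simp_all add: Ck_on_const assms(1))

text \<open>The product rule keeps an undifferentiated factor, which has one order more than the
  induction hypothesis asks for; \<open>Ck_on_SucD\<close> lowers it.\<close>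

lemma Ck_on_mult:
  fixes f g :: "'a::euclidean_space \<Rightarrow> real"
  assumes "open S"
  shows "Ck_on k S f \<Longrightarrow> Ck_on k S g \<Longrightarrow> Ck_on k S (\<lambda>x. f x * g x)"
proof (induction k arbitrary: f g)
  case 0 then show ?case by (simp add: continuous_on_mult)
next
  case (Suc k)
  show ?case
    by (rule Ck_on_SucI[OF has_derivative_mult[OF Ck_on_has_derivative[OF Suc.prems(1) assms] Ck_on_has_derivative[OF Suc.prems(2) assms]]])
      (use Suc assms Ck_on_SucD[OF Suc.prems(1)] Ck_on_SucD[OF Suc.prems(2)] in \<open>auto intro!: Ck_on_add\<close>)
qed

text \<open>\<open>G i\<close> plays the role of the \<open>i\<close>-th derivative of \<open>G 0\<close>.\<close>

lemma Ck_on_compose_real: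
  fixes f :: "'a::euclidean_space \<Rightarrow> real"
  assumes "open S" "\<And>i x. x \<in> S \<Longrightarrow> (G i has_real_derivative G (Suc i) (f x)) (at (f x))"
  shows "Ck_on k S f \<Longrightarrow> Ck_on k S (\<lambda>x. G i (f x))"
proof (induction k arbitrary: i)
  case 0
  have "isCont (G i) (f x)" if "x \<in> S" for x using assms(2)[OF that] DERIV_isCont by blast
  with 0 assms(1) show ?case
    by (auto simp: continuous_on_eq_continuous_at intro: isCont_o2)
next
  case (Suc k)
  have d: "((\<lambda>x. G i (f x)) has_derivative (\<lambda>h. frechet_derivative f (at x) h * G (Suc i) (f x))) (at x)"
    if "x \<in> S" for x
    using has_derivative_compose[OF Ck_on_has_derivative[OF Suc.prems assms(1) that]
       assms(2)[OF that, of i, unfolded has_field_derivative_def]]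
    by (simp add: mult.commute)
  show ?case
    by (rule Ck_on_SucI[OF d]) (use Suc assms(1) Ck_on_SucD[OF Suc.prems] in \<open>auto intro!: Ck_on_mult\<close>)
qed

text \<open>Continuity and differentiability at a point see only a neighbourhood, and partial
  derivatives inherit the local hypothesis. This glues the local extensions of
  \<open>smooth_on_manifold\<close> together.\<close>

lemma Ck_on_local:
  assumes "\<And>x. x \<in> S \<Longrightarrow> \<exists>U. open U \<and> x \<in> U \<and> Ck_on k U f"
  shows "Ck_on k S f"
  using assms
proof (induction k arbitrary: f)
  case 0
  then have "isCont f x" if "x \<in> S" for x
    using that by (metis Ck_on.simps(1) continuous_on_eq_continuous_at)
  then show ?case by (simp add: continuous_at_imp_continuous_on)
next
  case (Suc k)
  have "f differentiable_on S"
    by (metis Ck_on.simps(2) Suc.prems differentiable_at_imp_differentiable_on differentiable_on_eq_differentiable_at)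
  moreover have "Ck_on k S (\<lambda>x. frechet_derivative f (at x) b)" if "b \<in> Basis" for b
    by (rule Suc.IH) (use Suc.prems that in \<open>fastforce\<close>)
  ultimately show ?case by simp
qed

lemma smooth_on_const: "open S \<Longrightarrow> smooth_on S (\<lambda>x. c)"
  by (simp add: smooth_on_def Ck_on_const)

lemma smooth_on_bounded_linear: "bounded_linear L \<Longrightarrow> open S \<Longrightarrow> smooth_on S L"
  by (simp add: smooth_on_def Ck_on_bounded_linear)

lemma smooth_on_bounded_linear_compose:
  "bounded_linear L \<Longrightarrow> open S \<Longrightarrow> smooth_on S f \<Longrightarrow> smooth_on S (\<lambda>x. L (f x))"
  by (simp add: smooth_on_def Ck_on_bounded_linear_compose)

lemma smooth_on_add: "open S \<Longrightarrow> smooth_on S f \<Longrightarrow> smooth_on S g \<Longrightarrow> smooth_on S (\<lambda>x. f x + g x)"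
  by (simp add: smooth_on_def Ck_on_add)

lemma smooth_on_sum:
  "open S \<Longrightarrow> (\<And>i. i \<in> I \<Longrightarrow> smooth_on S (f i)) \<Longrightarrow> smooth_on S (\<lambda>x. \<Sum>i\<in>I. f i x)"
  by (simp add: smooth_on_def Ck_on_sum)

lemma smooth_on_mult:
  fixes f g :: "'a::euclidean_space \<Rightarrow> real"
  shows "open S \<Longrightarrow> smooth_on S f \<Longrightarrow> smooth_on S g \<Longrightarrow> smooth_on S (\<lambda>x. f x * g x)"
  by (simp add: smooth_on_def Ck_on_mult)

lemma smooth_on_power:
  fixes f :: "'a::euclidean_space \<Rightarrow> real"
  shows "open S \<Longrightarrow> smooth_on S f \<Longrightarrow> smooth_on S (\<lambda>x. f x ^ k)"
  by (induction k) (auto intro: smooth_on_const smooth_on_mult)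

lemma smooth_on_inner_self: "open S \<Longrightarrow> smooth_on S (\<lambda>x::'a::euclidean_space. x \<bullet> x)"
proof -
  assume S: "open S"
  have "smooth_on S (\<lambda>x::'a. \<Sum>b\<in>Basis. (x \<bullet> b) * (x \<bullet> b))"
    by (intro smooth_on_sum smooth_on_mult smooth_on_bounded_linear S bounded_linear_inner_left)
  then show ?thesis by (simp add: euclidean_inner[symmetric])
qed

lemma smooth_on_inverse:
  fixes f :: "'a::euclidean_space \<Rightarrow> real"
  assumes "open S" "smooth_on S f" "\<And>x. x \<in> S \<Longrightarrow> f x \<noteq> 0"
  shows "smooth_on S (\<lambda>x. inverse (f x))"
proof -
  \<comment> \<open>\<open>G i\<close> is the i-th derivative of \<open>inverse\<close>.\<close>
  define G where "G = (\<lambda>i (t::real). (- 1) ^ i * fact i * inverse t ^ Suc i)"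
  have D: "(G i has_real_derivative G (Suc i) t) (at t)" if "t \<noteq> 0" for i t
    unfolding G_def using that
    by (auto intro!: derivative_eq_intros simp: divide_simps) (cases i; simp add: algebra_simps)
  have "Ck_on k S (\<lambda>x. G 0 (f x))" for k
    by (rule Ck_on_compose_real[OF assms(1)]) (use assms D in \<open>auto simp: smooth_on_def\<close>)
  then show ?thesis by (simp add: smooth_on_def G_def)
qed

lemma smooth_on_imp_continuous_on: "smooth_on S f \<Longrightarrow> continuous_on S f"
  using Ck_on_imp_continuous_on smooth_on_def by blast

lemma smooth_on_has_derivative:
  "smooth_on S f \<Longrightarrow> open S \<Longrightarrow> x \<in> S \<Longrightarrow> (f has_derivative frechet_derivative f (at x)) (at x)"
  using Ck_on_has_derivative smooth_on_def by blast

lemma smooth_on_partial: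
  "smooth_on S f \<Longrightarrow> b \<in> Basis \<Longrightarrow> smooth_on S (\<lambda>x. frechet_derivative f (at x) b)"
  unfolding smooth_on_def by (metis Ck_on.simps(2))

lemma smooth_on_manifold_UNIV:
  assumes "smooth_on_manifold UNIV \<phi>" shows "smooth_on UNIV \<phi>"
  unfolding smooth_on_def
proof
  fix k
  show "Ck_on k UNIV \<phi>"
  proof (rule Ck_on_local)
    fix x :: 'a
    obtain U g where "open U" "x \<in> U" "smooth_on U g" "\<forall>y\<in>U. g y = \<phi> y"
      using assms unfolding smooth_on_manifold_def by (metis IntI UNIV_I)
    then show "\<exists>U. open U \<and> x \<in> U \<and> Ck_on k U \<phi>"
      using Ck_on_cong[of U g \<phi> k] unfolding smooth_on_def by blast
  qed
qed

lemma smooth_on_imp_smooth_on_manifold: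
  "open U \<Longrightarrow> M \<subseteq> U \<Longrightarrow> smooth_on U g \<Longrightarrow> smooth_on_manifold M g"
  unfolding smooth_on_manifold_def by blast

section \<open>Gradient, Laplacian and weighted Laplacian\<close>

text \<open>The ambient Euclidean gradient, as opposed to the intrinsic \<open>grad\<close>. The sum
  over \<open>Basis\<close> shows its smoothness directly from that of the partial
  derivatives.\<close>

definition gradient :: "('a::euclidean_space \<Rightarrow> real) \<Rightarrow> 'a \<Rightarrow> 'a" where
  "gradient g x = (\<Sum>b\<in>Basis. frechet_derivative g (at x) b *\<^sub>R b)"

text \<open>The Hessian as an endomorphism, the derivative of the gradient field; its quadratic form
  and its trace arise by inner products.\<close>

abbreviation hess :: "('a::euclidean_space \<Rightarrow> real) \<Rightarrow> 'a \<Rightarrow> 'a \<Rightarrow> 'a" where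
  "hess g x \<equiv> frechet_derivative (gradient g) (at x)"

lemma gradient_unique:
  assumes "(g has_derivative (\<lambda>h. v \<bullet> h)) (at x)" shows "gradient g x = v"
  unfolding gradient_def frechet_derivative_eq_has_derivative[OF assms]
  by (simp add: euclidean_representation)

lemma has_derivative_gradient:
  assumes "smooth_on U g" "open U" "x \<in> U"
  shows "(g has_derivative (\<lambda>h. gradient g x \<bullet> h)) (at x)"
proof -
  define D where "D = frechet_derivative g (at x)"
  have d: "(g has_derivative D) (at x)"
    unfolding D_def by (rule smooth_on_has_derivative[OF assms])
  have "D h = gradient g x \<bullet> h" for h
  proof -
    have "D h = D (\<Sum>b\<in>Basis. (h \<bullet> b) *\<^sub>R b)" by (simp add: euclidean_representation)
    also have "\<dots> = (\<Sum>b\<in>Basis. (h \<bullet> b) * D b)"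
      using has_derivative_linear[OF d] by (simp add: linear_sum linear_cmul)
    finally show ?thesis
      by (simp add: gradient_def D_def inner_sum_left inner_commute[of h] mult.commute)
  qed
  then have "D = (\<lambda>h. gradient g x \<bullet> h)" by blast
  with d show ?thesis by simp
qed

lemma smooth_on_gradient:
  assumes "smooth_on U g" "open U" shows "smooth_on U (gradient g)"
proof -
  have "smooth_on U (\<lambda>x. \<Sum>b\<in>Basis. frechet_derivative g (at x) b *\<^sub>R b)"
    by (intro smooth_on_sum smooth_on_bounded_linear_compose[where L="\<lambda>t. t *\<^sub>R _"] smooth_on_partial assms
        bounded_linear_scaleR_left)
  then show ?thesis by (simp add: gradient_def[abs_def])
qed

lemma has_derivative_hess:
  "smooth_on U g \<Longrightarrow> open U \<Longrightarrow> x \<in> U \<Longrightarrow> (gradient g has_derivative hess g x) (at x)"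
  using smooth_on_has_derivative smooth_on_gradient by blast

text \<open>Smoothness gives continuity in the fixed directions of \<open>Basis\<close>; linearity
  of \<open>hess g x\<close> transfers it to a continuously varying direction.\<close>

lemma continuous_on_hess:
  assumes "smooth_on U g" "open U" "continuous_on U v"
  shows "continuous_on U (\<lambda>x. hess g x (v x))"
proof -
  have eq: "hess g x (v x) = (\<Sum>b\<in>Basis. (v x \<bullet> b) *\<^sub>R hess g x b)" if "x \<in> U" for x
  proof -
    have "linear (hess g x)"
      using has_derivative_hess[OF assms(1,2) that] has_derivative_linear by blast
    then have "hess g x (\<Sum>b\<in>Basis. (v x \<bullet> b) *\<^sub>R b) = (\<Sum>b\<in>Basis. (v x \<bullet> b) *\<^sub>R hess g x b)"
      by (simp add: linear_sum linear_cmul)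
    then show ?thesis by (simp add: euclidean_representation)
  qed
  have "continuous_on U (\<lambda>x. hess g x b)" if "b \<in> Basis" for b
    using smooth_on_imp_continuous_on[OF smooth_on_partial[OF smooth_on_gradient[OF assms(1,2)] that]] .
  then have "continuous_on U (\<lambda>x. \<Sum>b\<in>Basis. (v x \<bullet> b) *\<^sub>R hess g x b)"
    by (intro continuous_intros assms(3)) auto
  then show ?thesis using eq by (simp cong: continuous_on_cong)
qed

text \<open>Expanding \<open>b\<close> in \<open>B\<close> on one side and \<open>e\<close> in
  \<open>Basis\<close> on the other leads to the same double sum of
  \<open>(H b \<bullet> e) * (e \<bullet> b)\<close>.\<close>

lemma trace_orthonormal_basis:
  fixes H :: "'a::euclidean_space \<Rightarrow> 'a"
  assumes "linear H" and B: "orthonormal_basis UNIV B"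
  shows "(\<Sum>e\<in>B. H e \<bullet> e) = (\<Sum>b\<in>Basis. H b \<bullet> b)"
proof -
  have po: "pairwise orthogonal B" and n1: "\<And>e. e \<in> B \<Longrightarrow> norm e = 1" and sp: "span B = UNIV"
    using B by (auto simp: orthonormal_basis_def)
  have "independent B" using po n1 pairwise_orthogonal_independent by force
  then have fB: "finite B" by (simp add: independent_imp_finite)
  have ex: "(\<Sum>e\<in>B. (e \<bullet> y) *\<^sub>R e) = y" for y
    using orthonormal_basis_expand[OF po n1 _ fB, of y] sp by (simp add: inner_commute)
  have "(\<Sum>b\<in>Basis. H b \<bullet> b) = (\<Sum>b\<in>Basis. \<Sum>e\<in>B. (H b \<bullet> e) * (e \<bullet> b))"
  proof (rule sum.cong[OF refl])
    fix b
    have "H b \<bullet> b = H b \<bullet> (\<Sum>e\<in>B. (e \<bullet> b) *\<^sub>R e)" by (simp add: ex)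
    then show "H b \<bullet> b = (\<Sum>e\<in>B. (H b \<bullet> e) * (e \<bullet> b))" by (simp add: inner_sum_right mult.commute)
  qed
  also have "\<dots> = (\<Sum>e\<in>B. \<Sum>b\<in>Basis. (H b \<bullet> e) * (e \<bullet> b))" by (rule sum.swap)
  also have "\<dots> = (\<Sum>e\<in>B. H e \<bullet> e)"
  proof (rule sum.cong[OF refl])
    fix e :: 'a
    have "H e \<bullet> e = H (\<Sum>b\<in>Basis. (e \<bullet> b) *\<^sub>R b) \<bullet> e" by (simp add: euclidean_representation)
    also have "\<dots> = (\<Sum>b\<in>Basis. (H b \<bullet> e) * (e \<bullet> b))"
      using assms(1) by (simp add: linear_sum linear_cmul inner_sum_left mult.commute)
    finally show "(\<Sum>b\<in>Basis. (H b \<bullet> e) * (e \<bullet> b)) = H e \<bullet> e" by simp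
  qed
  finally show ?thesis by simp
qed

lemma orthonormal_basis_exists:
  fixes V :: "'a::euclidean_space set"
  assumes "subspace V" shows "\<exists>B. orthonormal_basis V B"
  using orthonormal_basis_subspace[OF assms] unfolding orthonormal_basis_def by metis

lemma orthonormal_basis_SOME:
  "subspace V \<Longrightarrow> orthonormal_basis V (SOME B. orthonormal_basis V B)"
  using orthonormal_basis_exists someI_ex by metis

lemma tangent_space_UNIV: "tangent_space UNIV x = (UNIV :: 'a::euclidean_space set)"
proof -
  have "v \<in> tangent_space UNIV x" for v :: 'a
    unfolding tangent_space_def mem_Collect_eq
    by (rule exI[of _ "\<lambda>t. x + t *\<^sub>R v"], rule exI[of _ 1]) (auto intro!: derivative_eq_intros)
  then show ?thesis by blast
qed

lemma grad_UNIV: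
  assumes "(\<phi> has_derivative (\<lambda>h. v \<bullet> h)) (at x)" shows "grad UNIV \<phi> x = v"
  unfolding grad_def tangent_space_UNIV
proof (rule the_equality)
  fix w assume "w \<in> UNIV \<and> (\<phi> has_derivative (\<bullet>) w) (at x)"
  then show "w = v" using gradient_unique assms by metis
qed (use assms in auto)

lemma laplacian_UNIV:
  fixes \<phi> :: "'a::euclidean_space \<Rightarrow> real"
  assumes "smooth_on UNIV \<phi>"
  shows "laplacian UNIV \<phi> x = (\<Sum>b\<in>Basis. hess \<phi> x b \<bullet> b)"
proof -
  have "grad UNIV \<phi> = gradient \<phi>"
    using grad_UNIV has_derivative_gradient[OF assms] by blast
  moreover have "linear (hess \<phi> x)"
    using has_derivative_hess[OF assms] has_derivative_linear by blast
  ultimately show ?thesis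
    unfolding laplacian_def divergence_def tangent_space_UNIV
    by (simp add: trace_orthonormal_basis[OF _ orthonormal_basis_SOME])
qed

section \<open>Tangent vectors, gradient and Laplacian of a sphere\<close>

text \<open>By the chain rule along a curve in \<open>M\<close> with velocity \<open>v\<close>, the
  value \<open>D v\<close> is the derivative of \<open>f\<close> along the curve, whichever
  derivative \<open>D\<close> within \<open>M\<close> is taken. This removes the ambiguity of
  derivatives within \<open>M\<close> in tangent directions.\<close>

lemma derivative_within_tangent_unique:
  fixes f :: "'a::euclidean_space \<Rightarrow> 'b::real_normed_vector"
  assumes v: "v \<in> tangent_space M x"
    and "(f has_derivative D1) (at x within M)" "(f has_derivative D2) (at x within M)"
  shows "D1 v = D2 v"
proof -
  obtain \<gamma> \<epsilon> where \<gamma>: "\<epsilon> > 0" "\<gamma> 0 = x" "\<And>t. \<bar>t\<bar> < \<epsilon> \<Longrightarrow> \<gamma> t \<in> M"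
      "(\<gamma> has_vector_derivative v) (at (0::real))"
    using v unfolding tangent_space_def by blast
  let ?I = "{-\<epsilon><..<\<epsilon>}"
  have sub: "\<gamma> ` ?I \<subseteq> M"
  proof clarify
    fix t assume "t \<in> ?I"
    then show "\<gamma> t \<in> M" by (intro \<gamma>(3)) auto
  qed
  have *: "((\<lambda>t. f (\<gamma> t)) has_vector_derivative D v) (at 0)" if "(f has_derivative D) (at x within M)" for D
  proof -
    have "(\<gamma> has_derivative (\<lambda>t. t *\<^sub>R v)) (at 0 within ?I)"
      using \<gamma>(4) unfolding has_vector_derivative_def by (rule has_derivative_at_withinI)
    moreover have "(f has_derivative D) (at (\<gamma> 0) within \<gamma> ` ?I)"
      using that sub unfolding \<gamma>(2) by (rule has_derivative_subset)
    ultimately have "((\<lambda>t. f (\<gamma> t)) has_derivative (\<lambda>t. D (t *\<^sub>R v))) (at 0 within ?I)"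
      by (rule has_derivative_in_compose)
    moreover have "at 0 within ?I = at 0" using \<gamma>(1) by (intro at_within_open) auto
    moreover have "(\<lambda>t. D (t *\<^sub>R v)) = (\<lambda>t. t *\<^sub>R D v)"
      using linear_cmul[OF has_derivative_linear[OF that]] by blast
    ultimately show ?thesis by (simp only: has_vector_derivative_def)
  qed
  show ?thesis
    using vector_derivative_unique_at[OF *[OF assms(2)] *[OF assms(3)]] .
qed

text \<open>Along the sphere \<open>y \<bullet> y\<close> is constant, so velocities are orthogonal
  to \<open>x\<close>; conversely an orthogonal \<open>v\<close> is the velocity of a great
  circle.\<close>

lemma tangent_space_sphere:
  fixes x :: "'a::euclidean_space"
  assumes R: "R > 0" and x: "x \<in> sphere 0 R"
  shows "tangent_space (sphere 0 R) x = {v. v \<bullet> x = 0}"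
proof (intro equalityI subsetI)
  fix v assume "v \<in> tangent_space (sphere 0 R) x"
  then have "2 *\<^sub>R (x \<bullet> v) = 0"
  proof (rule derivative_within_tangent_unique[where f="\<lambda>y. y \<bullet> y" and ?D1.0="\<lambda>v. 2 *\<^sub>R (x \<bullet> v)" and ?D2.0="\<lambda>_. 0"])
    show "((\<lambda>y. y \<bullet> y) has_derivative (\<lambda>v. 2 *\<^sub>R (x \<bullet> v))) (at x within sphere 0 R)"
      by (auto intro!: derivative_eq_intros simp: inner_commute)
    have "((\<lambda>y. R\<^sup>2) has_derivative (\<lambda>_. 0)) (at x within sphere 0 R)" by simp
    then show "((\<lambda>y. y \<bullet> y) has_derivative (\<lambda>_. 0)) (at x within sphere 0 R)"
      by (rule has_derivative_transform[rotated 2]) (use x in \<open>auto simp: dot_square_norm\<close>)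
  qed
  then show "v \<in> {v. v \<bullet> x = 0}" by (simp add: inner_commute)
next
  fix v assume "v \<in> {v. v \<bullet> x = 0}"
  then have vx: "v \<bullet> x = 0" "x \<bullet> v = 0" by (auto simp: inner_commute)
  show "v \<in> tangent_space (sphere 0 R) x"
  proof (cases "v = 0")
    case True
    then show ?thesis using x unfolding tangent_space_def
      by (auto intro!: exI[of _ "\<lambda>_. x"] exI[of _ "1::real"])
  next
    case False
    \<comment> \<open>\<open>\<gamma>\<close> is the great circle through \<open>x\<close> with
      velocity \<open>v\<close>; its angular speed \<open>w\<close> is the speed divided by the
      radius.\<close>
    define w where "w = norm v / R"
    define \<gamma> where "\<gamma> = (\<lambda>t. cos (w * t) *\<^sub>R x + (sin (w * t) / w) *\<^sub>R v)"
    have w: "w > 0" using False R by (simp add: w_def)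
    have n: "norm (\<gamma> t) = R" for t
    proof -
      have "\<gamma> t \<bullet> \<gamma> t = (cos (w*t))\<^sup>2 * (x \<bullet> x) + (sin (w * t))\<^sup>2 * ((v \<bullet> v) / w\<^sup>2)"
        unfolding \<gamma>_def by (simp add: inner_add_left inner_add_right vx power2_eq_square)
      also have "(v \<bullet> v) / w\<^sup>2 = R\<^sup>2"
        using False R by (simp add: w_def dot_square_norm power_divide)
      also have "x \<bullet> x = R\<^sup>2" using x by (simp add: dot_square_norm)
      finally have "(norm (\<gamma> t))\<^sup>2 = R\<^sup>2"
        by (simp add: dot_square_norm distrib_right[symmetric])
      then show ?thesis using R by simp
    qed
    have "(\<gamma> has_vector_derivative v) (at 0)"
      unfolding \<gamma>_def using w by (auto intro!: derivative_eq_intros)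
    then show ?thesis
      unfolding tangent_space_def using n by (auto intro!: exI[of _ \<gamma>] exI[of _ "1::real"] simp: \<gamma>_def)
  qed
qed

text \<open>The description in \<open>grad\<close> asks for a vector that is tangent and represents
  a derivative in all directions. Projecting the ambient gradient achieves the first; the second
  needs an extension whose normal derivative vanishes.\<close>

lemma grad_sphere:
  fixes x :: "'a::euclidean_space"
  assumes R: "R > 0" and x: "x \<in> sphere 0 R" "x \<in> U" and U: "open U" "smooth_on U g"
    and g: "\<And>y. y \<in> U \<Longrightarrow> y \<in> sphere 0 R \<Longrightarrow> g y = \<phi> y"
  shows "grad (sphere 0 R) \<phi> x = gradient g x - ((gradient g x \<bullet> x) / R\<^sup>2) *\<^sub>R x"
proof -
  define c where "c = (gradient g x \<bullet> x) / R\<^sup>2"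
  define v where "v = gradient g x - c *\<^sub>R x"
  have xx: "x \<bullet> x = R\<^sup>2" using x by (simp add: dot_square_norm)
  have t: "v \<in> tangent_space (sphere 0 R) x"
    using R by (simp add: tangent_space_sphere[OF R x(1)] v_def inner_diff_left xx c_def)
  \<comment> \<open>Subtracting a multiple of \<open>y \<bullet> y - R\<^sup>2\<close> leaves the
    values on the sphere unchanged and removes the normal component of the gradient at
    \<open>x\<close>.\<close>
  have "((\<lambda>y. g y - c * (y \<bullet> y - R\<^sup>2) / 2) has_derivative (\<lambda>h. gradient g x \<bullet> h - c * (x \<bullet> h))) (at x)"
    by (auto intro!: derivative_eq_intros has_derivative_gradient[OF U(2,1) x(2)] simp: inner_commute)
  then have "((\<lambda>y. g y - c * (y \<bullet> y - R\<^sup>2) / 2) has_derivative (\<lambda>h. v \<bullet> h)) (at x)"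
    by (simp add: v_def inner_diff_left)
  then have "((\<lambda>y. g y - c * (y \<bullet> y - R\<^sup>2) / 2) has_derivative (\<lambda>h. v \<bullet> h)) (at x within sphere 0 R)"
    by (rule has_derivative_at_withinI)
  note within = this
  obtain d where "d > 0" "ball x d \<subseteq> U" using U x openE by blast
  have d: "(\<phi> has_derivative (\<lambda>h. v \<bullet> h)) (at x within sphere 0 R)"
    by (rule has_derivative_transform_within[OF within \<open>d > 0\<close> x(1)]) (use x \<open>ball x d \<subseteq> U\<close> g in \<open>auto simp: dot_square_norm dist_commute subset_iff\<close>)
  show ?thesis
    unfolding grad_def v_def[symmetric, unfolded c_def]
  proof (rule the_equality)
    show "v \<in> tangent_space (sphere 0 R) x \<and> (\<phi> has_derivative (\<bullet>) v) (at x within sphere 0 R)"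
      using t d by simp
    fix w assume w: "w \<in> tangent_space (sphere 0 R) x \<and> (\<phi> has_derivative (\<bullet>) w) (at x within sphere 0 R)"
    \<comment> \<open>The difference of two candidates is tangent and both represent the derivative
      on it, so it is orthogonal to itself.\<close>
    have "w - v \<in> tangent_space (sphere 0 R) x"
      using w t by (simp add: tangent_space_sphere[OF R x(1)] inner_diff_left)
    then have "w \<bullet> (w - v) = v \<bullet> (w - v)"
      using derivative_within_tangent_unique w d by blast
    then have "(w - v) \<bullet> (w - v) = 0" by (simp add: inner_diff_left)
    then show "w = v" by simp
  qed
qed

text \<open>Near \<open>x\<close> the field \<open>V\<close> extends the intrinsic gradient to the
  ambient space, so its derivative may replace the chosen one on tangent vectors. The trace over the
  tangent space is the full trace minus the entry of the unit normal; differentiating the normal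
  correction gives the term with the factor dimension minus one.\<close>

lemma laplacian_sphere:
  fixes x :: "'a::euclidean_space"
  assumes R: "R > 0" and x: "x \<in> sphere 0 R" "x \<in> U" and U: "open U" "smooth_on U g"
    and g: "\<And>y. y \<in> U \<Longrightarrow> y \<in> sphere 0 R \<Longrightarrow> g y = \<phi> y"
  shows "laplacian (sphere 0 R) \<phi> x =
    (\<Sum>b\<in>Basis. hess g x b \<bullet> b) - (hess g x x \<bullet> x) / R\<^sup>2 - (real DIM('a) - 1) * (gradient g x \<bullet> x) / R\<^sup>2"
proof -
  let ?S = "sphere (0::'a) R" and ?H = "hess g x" and ?G = "gradient g"
  define k where "k = 1 / R\<^sup>2"
  define V where "V = (\<lambda>y. ?G y - (k * (?G y \<bullet> y)) *\<^sub>R y)"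
  define DV where "DV = (\<lambda>e. ?H e - (k * (?G x \<bullet> x)) *\<^sub>R e - (k * (?H e \<bullet> x + ?G x \<bullet> e)) *\<^sub>R x)"
  have xx: "x \<bullet> x = R\<^sup>2" using x by (simp add: dot_square_norm)
  have H: "(?G has_derivative ?H) (at x)" by (rule has_derivative_hess[OF U(2,1) x(2)])
  then have lH: "linear ?H" by (rule has_derivative_linear)
  have dV: "(V has_derivative DV) (at x within ?S)"
    unfolding V_def DV_def
    by (rule has_derivative_at_withinI) (auto intro!: derivative_eq_intros H simp: algebra_simps)
  obtain d where d: "d > 0" "ball x d \<subseteq> U" using U x openE by blast
  have dX: "(grad ?S \<phi> has_derivative DV) (at x within ?S)"
  proof (rule has_derivative_transform_within[OF dV d(1) x(1)])
    fix y assume y: "y \<in> ?S" "dist y x < d"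
    then have "y \<in> U" using d(2) by (auto simp: dist_commute)
    from grad_sphere[OF R y(1) this U g] show "V y = grad ?S \<phi> y"
      by (simp add: V_def k_def)
  qed
  then have "(grad ?S \<phi> has_derivative frechet_derivative (grad ?S \<phi>) (at x within ?S)) (at x within ?S)"
    using frechet_derivative_works differentiableI by blast
  then have eq: "frechet_derivative (grad ?S \<phi>) (at x within ?S) e = DV e" if "e \<bullet> x = 0" for e
    using derivative_within_tangent_unique[OF _ _ dX, of e] that
    by (simp add: tangent_space_sphere[OF R x(1)])
  define B where "B = (SOME B. orthonormal_basis (tangent_space ?S x) B)"
  have "subspace (tangent_space ?S x)"
    unfolding tangent_space_sphere[OF R x(1)] by (auto simp: subspace_def inner_add_left)
  then have "orthonormal_basis (tangent_space ?S x) B"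
    unfolding B_def by (rule orthonormal_basis_SOME)
  then have Bx: "\<And>e. e \<in> B \<Longrightarrow> e \<bullet> x = 0" and po: "pairwise orthogonal B"
    and n1: "\<And>e. e \<in> B \<Longrightarrow> norm e = 1" and sp: "span B = {v. v \<bullet> x = 0}"
    by (auto simp: orthonormal_basis_def tangent_space_sphere[OF R x(1)])
  \<comment> \<open>The unit normal, which completes \<open>B\<close> to an orthonormal basis of the
    ambient space.\<close>
  define r where "r = (1 / R) *\<^sub>R x"
  have rx: "r \<bullet> x = R" and r1: "r \<bullet> r = 1"
    using R xx by (simp_all add: r_def power2_eq_square)
  then have r: "r \<bullet> r = 1" "norm r = 1" "r \<notin> B"
    using R Bx by (auto simp: norm_eq_1)
  have "independent B" using po n1 pairwise_orthogonal_independent by force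
  then have fB: "finite B" by (simp add: independent_imp_finite)
  have "orthonormal_basis UNIV (insert r B)"
    unfolding orthonormal_basis_def
  proof (intro conjI)
    show "pairwise orthogonal (insert r B)"
      using po Bx by (simp add: pairwise_insert r_def orthogonal_def inner_commute[of x])
    have "y \<in> span (insert r B)" for y
    proof -
      have "(y - (y \<bullet> r) *\<^sub>R r) \<bullet> x = R * ((y - (y \<bullet> r) *\<^sub>R r) \<bullet> r)"
        using R by (simp add: r_def)
      also have "\<dots> = 0" using r by (simp add: inner_diff_left)
      finally have "y - (y \<bullet> r) *\<^sub>R r \<in> span (insert r B)"
        using sp span_mono[of B "insert r B"] by blast
      moreover have "(y \<bullet> r) *\<^sub>R r \<in> span (insert r B)" by (simp add: span_base span_scale)
      ultimately show ?thesis using span_add by fastforce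
    qed
    then show "span (insert r B) = UNIV" by blast
  qed (use n1 r in auto)
  note tr = trace_orthonormal_basis[OF _ this]
  have "laplacian ?S \<phi> x = (\<Sum>e\<in>B. DV e \<bullet> e)"
    unfolding laplacian_def divergence_def B_def[symmetric] using Bx eq by simp
  also have "\<dots> = (\<Sum>e\<in>B. ?H e \<bullet> e - (k * (?G x \<bullet> x)) * (e \<bullet> e))"
  proof (rule sum.cong[OF refl])
    fix e assume "e \<in> B"
    then have "x \<bullet> e = 0" using Bx by (simp add: inner_commute)
    then show "DV e \<bullet> e = ?H e \<bullet> e - (k * (?G x \<bullet> x)) * (e \<bullet> e)"
      by (simp add: DV_def inner_diff_left)
  qed
  also have "\<dots> = (\<Sum>e\<in>B. ?H e \<bullet> e) - (k * (?G x \<bullet> x)) * (\<Sum>e\<in>B. e \<bullet> e)"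
    unfolding sum_subtractf sum_distrib_left ..
  also have "(\<Sum>e\<in>B. ?H e \<bullet> e) = (\<Sum>b\<in>Basis. ?H b \<bullet> b) - ?H r \<bullet> r"
    using tr[OF lH] fB r(3) by simp
  \<comment> \<open>Comparing traces of the identity counts the elements of
    \<open>B\<close>.\<close>
  also have "(\<Sum>e\<in>B. e \<bullet> e) = real DIM('a) - 1"
    using tr[of id] fB r by (simp add: linear_id)
  also have "?H r \<bullet> r = (?H x \<bullet> x) / R\<^sup>2"
    using lH by (simp add: r_def linear_cmul power2_eq_square)
  finally show ?thesis by (simp add: k_def mult.commute)
qed

section \<open>Weighted Laplacians of the two densities\<close>

lemma std_gaussian_eq_exp:
  "std_gaussian x = (1 / sqrt (2 * pi)) ^ CARD('n) * exp (- (x \<bullet> x) / 2)" for x :: "real^'n"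
proof -
  have "std_gaussian x = (\<Prod>i\<in>UNIV. 1 / sqrt (2 * pi) * exp (- (x $ i * x $ i) / 2))"
    by (simp add: std_gaussian_def std_normal_density_def power2_eq_square)
  also have "\<dots> = (1 / sqrt (2 * pi)) ^ CARD('n) * exp (\<Sum>i\<in>UNIV. - (x $ i * x $ i) / 2)"
    by (simp only: prod.distrib prod_constant exp_sum finite[of UNIV])
  also have "(\<Sum>i\<in>UNIV. - (x $ i * x $ i) / 2) = - (x \<bullet> x) / 2"
    by (simp add: inner_vec_def sum_negf sum_divide_distrib)
  finally show ?thesis .
qed

lemma std_gaussian_pos: "std_gaussian x > 0"
  unfolding std_gaussian_eq_exp by simp

lemma ln_std_gaussian:
  "ln (std_gaussian x) = real CARD('n) * ln (1 / sqrt (2 * pi)) - (x \<bullet> x) / 2"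
  for x :: "real ^ 'n"
  unfolding std_gaussian_eq_exp by (subst ln_mult) (auto simp: ln_realpow)

lemma weighted_laplacian_gaussian:
  fixes \<phi> :: "real ^ 'n \<Rightarrow> real"
  assumes "smooth_on UNIV \<phi>"
  shows "weighted_laplacian UNIV std_gaussian \<phi> x = (\<Sum>b\<in>Basis. hess \<phi> x b \<bullet> b) - x \<bullet> gradient \<phi> x"
proof -
  have "((\<lambda>y::real^'n. real CARD('n) * ln (1 / sqrt (2 * pi)) - (y \<bullet> y) / 2) has_derivative (\<lambda>h. (- x) \<bullet> h)) (at x)"
    by (auto intro!: derivative_eq_intros simp: inner_commute)
  then have "grad UNIV (\<lambda>y. ln (std_gaussian y)) x = - x"
    unfolding ln_std_gaussian by (rule grad_UNIV)
  moreover have "grad UNIV \<phi> x = gradient \<phi> x"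
    using grad_UNIV has_derivative_gradient[OF assms] by blast
  ultimately show ?thesis
    unfolding weighted_laplacian_def laplacian_UNIV[OF assms] by simp
qed

text \<open>The log-density is constant on the whole ambient space, so a constant function serves as
  the extension in \<open>grad_sphere\<close> and the drift term vanishes.\<close>

lemma weighted_laplacian_sphere:
  fixes x :: "real ^ 'n"
  assumes R: "R > 0" and x: "x \<in> sphere 0 R"
  shows "weighted_laplacian (sphere 0 R) (unif_density T (sphere 0 R)) \<phi> x = laplacian (sphere 0 R) \<phi> x"
proof -
  have "grad (sphere 0 R) (\<lambda>y. ln (unif_density T (sphere (0::real^'n) R) y)) x = 0"
    by (subst grad_sphere[OF R x _ _ smooth_on_const[of UNIV "ln (unif_density T (sphere (0::real^'n) R) 0)"]])
      (auto simp: unif_density_def gradient_unique[where v=0])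
  then show ?thesis by (simp add: weighted_laplacian_def)
qed

section \<open>Change of variables\<close>

text \<open>Conjugation by the bijection \<open>f\<close> identifies the permutations of
  \<open>B\<close> with those of the index type and preserves signs. With \<open>B\<close> the
  complement of one index this also treats principal minors.\<close>

lemma sum_permutes_transfer:
  fixes A :: "'b \<Rightarrow> 'b \<Rightarrow> real" and f :: "'a::finite \<Rightarrow> 'b"
  assumes f: "bij_betw f UNIV B"
  shows "(\<Sum>p | p permutes B. of_int (sign p) * (\<Prod>i\<in>B. A i (p i))) =
    (\<Sum>q | q permutes UNIV. of_int (sign q) * (\<Prod>i\<in>UNIV. A (f i) (f (q i))))"
proof -
  let ?g = "inv_into UNIV f"
  have inj: "inj f" and B: "range f = B" using f by (auto simp: bij_betw_def)
  have finB: "finite B" using B by auto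
  have g: "bij_betw ?g B UNIV" using f by (rule bij_betw_inv_into)
  have gf: "?g (f i) = i" for i by (simp add: inj)
  have fg: "f (?g b) = b" if "b \<in> B" for b using that B by (simp add: f_inv_into_f)
  have map_f: "map_permutation UNIV f q (f i) = f (q i)" for q i
    by (simp add: map_permutation_def gf)
  show ?thesis
  proof (rule sum.reindex_bij_witness[where i="map_permutation UNIV f" and j="map_permutation B ?g"])
    fix p assume "p \<in> {p. p permutes B}"
    then have p: "p permutes B" by simp
    show "map_permutation UNIV f (map_permutation B ?g p) = p"
      by (subst map_permutation_compose[OF g bij_betw_imp_inj_on[OF f]])
        (use p map_permutation_cong[of "f \<circ> ?g" B p B id p] fg in \<open>auto simp: inj_on_def\<close>)
    show q: "map_permutation B ?g p \<in> {q. q permutes UNIV}"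
      using map_permutation_permutes[OF g p] by simp
    have *: "map_permutation B ?g p i = ?g (p (f i))" for i
      using B permutes_in_image[OF p, of "f i"] inv_into_f_f[OF bij_betw_imp_inj_on[OF g], of "f i"] gf
      by (auto simp: map_permutation_def restrict_id_def bij_betw_imp_surj_on[OF g])
    have "sign (map_permutation B ?g p) = sign p"
      by (rule sign_map_permutation[OF bij_betw_imp_inj_on[OF g] p finB])
    moreover have "(\<Prod>i\<in>UNIV. A (f i) (f (map_permutation B ?g p i))) = (\<Prod>i\<in>UNIV. A (f i) (p (f i)))"
      unfolding * using B permutes_in_image[OF p] by (intro prod.cong refl) (metis fg rangeI)
    moreover have "\<dots> = (\<Prod>i\<in>B. A i (p i))"
      by (rule prod.reindex_bij_betw[OF f])
    ultimately show "of_int (sign (map_permutation B ?g p)) * (\<Prod>i\<in>UNIV. A (f i) (f (map_permutation B ?g p i))) =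
        of_int (sign p) * (\<Prod>i\<in>B. A i (p i))" by simp
  next
    fix q :: "'a \<Rightarrow> 'a" assume "q \<in> {q. q permutes UNIV}"
    then have q: "q permutes UNIV" by simp
    show "map_permutation UNIV f q \<in> {p. p permutes B}"
      using map_permutation_permutes[OF f q] by simp
    show "map_permutation B ?g (map_permutation UNIV f q) = q"
      by (subst map_permutation_compose[OF f bij_betw_imp_inj_on[OF g]])
        (use q map_permutation_cong[of "?g \<circ> f" UNIV q UNIV id q] gf in \<open>auto simp: inj_on_def\<close>)
  qed
qed

lemma det_reindex:
  fixes A :: "real^'b^'b" and f :: "'a::finite \<Rightarrow> 'b::finite"
  assumes "bij f"
  shows "det (\<chi> i j. A $ f i $ f j) = det A"
  using sum_permutes_transfer[of f UNIV "\<lambda>i j. A $ i $ j"] assms by (simp add: det_def)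

text \<open>In the Leibniz formula a permutation moving \<open>k\<close> picks an off-diagonal entry
  of row \<open>k\<close>, which is zero.\<close>

lemma det_block:
  fixes A :: "real^'n^'n" and f :: "'m::finite \<Rightarrow> 'n::finite"
  assumes f: "bij_betw f UNIV (- {k})" and A: "\<And>j. j \<noteq> k \<Longrightarrow> A $ k $ j = 0"
  shows "det A = A $ k $ k * det (\<chi> i j. A $ f i $ f j)"
proof -
  have "det A = (\<Sum>p | p permutes (- {k}). of_int (sign p) * (\<Prod>i\<in>UNIV. A $ i $ p i))"
    unfolding det_def
  proof (rule sum.mono_neutral_right)
    show "\<forall>p\<in>{p. p permutes UNIV} - {p. p permutes - {k}}. of_int (sign p) * (\<Prod>i\<in>UNIV. A $ i $ p i) = 0"
    proof
      fix p assume p: "p \<in> {p. p permutes UNIV} - {p. p permutes - {k}}"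
      then have "p k \<noteq> k"
        using permutes_superset[of p UNIV "- {k}"] by auto
      then have "A $ k $ p k = 0" by (rule A)
      then have "(\<Prod>i\<in>UNIV. A $ i $ p i) = 0" by (auto intro!: prod_zero)
      then show "of_int (sign p) * (\<Prod>i\<in>UNIV. A $ i $ p i) = 0" by simp
    qed
  qed (auto intro: permutes_subset)
  also have "\<dots> = (\<Sum>p | p permutes (- {k}). A $ k $ k * (of_int (sign p) * (\<Prod>i\<in>-{k}. A $ i $ p i)))"
  proof (rule sum.cong[OF refl])
    fix p assume "p \<in> {p. p permutes (- {k})}"
    then have "p k = k" by (auto simp: permutes_not_in)
    then have "(\<Prod>i\<in>insert k (-{k}). A $ i $ p i) = A $ k $ k * (\<Prod>i\<in>-{k}. A $ i $ p i)"
      by (subst prod.insert) auto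
    moreover have "insert k (-{k}) = UNIV" by auto
    ultimately show "of_int (sign p) * (\<Prod>i\<in>UNIV. A $ i $ p i) = A $ k $ k * (of_int (sign p) * (\<Prod>i\<in>-{k}. A $ i $ p i))"
      by simp
  qed
  also have "\<dots> = A $ k $ k * det (\<chi> i j. A $ f i $ f j)"
    unfolding sum_distrib_left[symmetric] using sum_permutes_transfer[OF f, of "\<lambda>i j. A $ i $ j"]
    by (simp add: det_def)
  finally show ?thesis .
qed

text \<open>A well-ordered index type of the same cardinality, because the change-of-variables theorem
  of the library is only available for such index types.\<close>

typedef (overloaded) ('a::finite) widx = "{..<CARD('a)}"
  by (auto intro!: exI[of _ 0])

instance widx :: (finite) finite
proof
  show "finite (UNIV :: 'a widx set)"
    using type_definition.univ[OF type_definition_widx] by (metis finite_imageI finite_lessThan)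
qed

instantiation widx :: (finite) wellorder
begin
definition less_eq_widx :: "'a widx \<Rightarrow> 'a widx \<Rightarrow> bool" where "x \<le> y \<longleftrightarrow> Rep_widx x \<le> Rep_widx y"
definition less_widx :: "'a widx \<Rightarrow> 'a widx \<Rightarrow> bool" where "x < y \<longleftrightarrow> Rep_widx x < Rep_widx y"
instance
proof
  fix P :: "'a widx \<Rightarrow> bool" and a
  assume *: "\<And>x. (\<And>y. y < x \<Longrightarrow> P y) \<Longrightarrow> P x"
  show "P a"
    by (induction a rule: measure_induct_rule[of Rep_widx]) (auto intro: * simp: less_widx_def)
qed (auto simp: less_eq_widx_def less_widx_def Rep_widx_inject)
end

lemma card_widx: "CARD('a::finite widx) = CARD('a)"
  using type_definition.card[OF type_definition_widx] by simp

lemma ex_bij_widx: "\<exists>f :: 'a::finite widx \<Rightarrow> 'a. bij f"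
  using finite_same_card_bij[of "UNIV :: 'a widx set" "UNIV :: 'a set"] card_widx by auto

section \<open>Lebesgue measure in coordinates and the Jacobian formula\<close>

lemma bij_betw_axis_Basis: "bij_betw (\<lambda>i. axis i 1) UNIV (Basis :: (real^'n) set)"
  by (auto simp: bij_betw_def inj_on_def axis_eq_axis Basis_vec_def)

lemma prod_Basis_vec: "(\<Prod>b\<in>Basis. h b) = (\<Prod>i\<in>UNIV. h (axis i (1::real)))"
  for h :: "real^'n \<Rightarrow> 'b::comm_monoid_mult"
  by (rule prod.reindex_bij_betw[OF bij_betw_axis_Basis, symmetric])

lemma emeasure_box_vec:
  fixes l u :: "real^'n"
  assumes "\<And>i. l $ i \<le> u $ i"
  shows "emeasure lborel (box l u) = (\<Prod>i\<in>UNIV. ennreal (u $ i - l $ i))"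
proof -
  have "emeasure lborel (box l u) = (\<Prod>b\<in>Basis. (u - l) \<bullet> b)"
    by (rule emeasure_lborel_box) (use assms in \<open>auto simp: Basis_vec_def inner_axis\<close>)
  then show ?thesis
    using assms by (simp add: prod_Basis_vec inner_axis prod_ennreal)
qed

lemma lborel_eqI_vec:
  fixes M :: "(real^'n) measure"
  assumes "\<And>l u. (\<And>i. l $ i \<le> u $ i) \<Longrightarrow> emeasure M (box l u) = (\<Prod>i\<in>UNIV. ennreal (u $ i - l $ i))"
    and "sets M = sets borel"
  shows "lborel = M"
proof (rule lborel_eqI)
  fix l u :: "real^'n" assume le: "\<And>b. b \<in> Basis \<Longrightarrow> l \<bullet> b \<le> u \<bullet> b"
  have "l $ i \<le> u $ i" for i using le[of "axis i 1"] by (simp add: inner_axis axis_in_Basis_iff)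
  then show "emeasure M (box l u) = (\<Prod>b\<in>Basis. (u - l) \<bullet> b)"
    using assms(1)[of l u] by (simp add: prod_Basis_vec inner_axis prod_ennreal)
qed (rule assms(2))

text \<open>Relabelling coordinates maps boxes to boxes with the same side lengths, and boxes
  determine Lebesgue measure.\<close>

lemma lborel_distr_reindex:
  fixes f :: "'w::finite \<Rightarrow> 'n::finite"
  assumes "bij f"
  shows "distr lborel borel (\<lambda>x::real^'n. \<chi> i. x $ f i) = (lborel :: (real^'w) measure)"
proof (rule lborel_eqI_vec[symmetric])
  fix l u :: "real^'w" assume le: "\<And>i. l $ i \<le> u $ i"
  let ?g = "inv f"
  have fg: "f (?g i) = i" "?g (f j) = j" for i j
    using assms by (simp_all add: bij_is_surj surj_f_inv_f bij_is_inj)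
  have "(\<lambda>x::real^'n. \<chi> i. x $ f i) -` box l u = box (\<chi> i. l $ ?g i) (\<chi> i. u $ ?g i)"
    by (auto simp: mem_box_cart) (metis fg)+
  moreover have "(\<lambda>x::real^'n. \<chi> i. x $ f i) \<in> borel_measurable borel"
    by (intro borel_measurable_continuous_onI continuous_intros)
  moreover have "(\<Prod>i\<in>UNIV. ennreal (u $ ?g i - l $ ?g i)) = (\<Prod>i\<in>UNIV. ennreal (u $ i - l $ i))"
    by (rule prod.reindex_bij_betw[OF bij_imp_bij_inv[OF assms]])
  ultimately show "emeasure (distr lborel borel (\<lambda>x::real^'n. \<chi> i. x $ f i)) (box l u) = (\<Prod>i\<in>UNIV. ennreal (u $ i - l $ i))"
    using le by (simp add: emeasure_distr emeasure_box_vec)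
qed simp

text \<open>On a bounded set with bounded Jacobian the formula is an equality of finite integrals.
  The sets \<open>C k\<close> exhaust \<open>B\<close> by such pieces, and monotone continuity of
  both sides admits infinite values.\<close>

lemma emeasure_differentiable_image_wellorder:
  fixes f :: "real^'w::{finite,wellorder} \<Rightarrow> real^'w::_"
  assumes B: "B \<in> sets borel"
    and der: "\<And>x. x \<in> B \<Longrightarrow> (f has_derivative f' x) (at x)"
    and inj: "inj_on f B"
    and meas: "(\<lambda>x. indicator B x * \<bar>det (matrix (f' x))\<bar>) \<in> borel_measurable borel"
    and fB: "f ` B \<in> sets borel"
  shows "emeasure lborel (f ` B) = (\<integral>\<^sup>+x\<in>B. ennreal \<bar>det (matrix (f' x))\<bar> \<partial>lborel)"
proof -
  define g where "g = (\<lambda>x. indicator B x * \<bar>det (matrix (f' x))\<bar>)"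
  have g[measurable]: "g \<in> borel_measurable borel" using meas by (simp add: g_def)
  define C where "C = (\<lambda>k::nat. B \<inter> cball 0 (real k) \<inter> {x. g x \<le> real k})"
  have C[measurable]: "C k \<in> sets borel" for k unfolding C_def using B by measurable
  have CB: "C k \<subseteq> B" for k by (auto simp: C_def)
  have gC: "g x = \<bar>det (matrix (f' x))\<bar>" if "x \<in> C k" for x k using subsetD[OF CB that] by (simp add: g_def)
  have C_un: "(\<Union>k. C k) = B"
  proof -
    have "x \<in> (\<Union>k. C k)" if "x \<in> B" for x
    proof -
      obtain k :: nat where "max (norm x) (g x) \<le> real k" using real_arch_simple by blast
      then show ?thesis using that by (auto simp: C_def)
    qed
    then show ?thesis using CB by blast
  qed
  have C_inc: "incseq C" by (auto simp: incseq_def C_def)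
  have C_img: "f ` C k \<in> sets lebesgue \<and>
      emeasure lebesgue (f ` C k) = (\<integral>\<^sup>+x. ennreal (g x) * indicator (C k) x \<partial>lborel)" for k
  proof -
    have fin: "emeasure lborel (C k) < \<infinity>"
      by (rule emeasure_bounded_finite, rule bounded_subset[of "cball 0 (real k)"]) (auto simp: C_def)
    have int: "integrable lborel (\<lambda>x. indicator (C k) x *\<^sub>R g x)"
    proof (rule integrableI_bounded_set[where A="C k" and B="real k"])
      show "AE x\<in>C k in lborel. norm (indicator (C k) x *\<^sub>R g x) \<le> real k"
        by (rule AE_I2) (auto simp: C_def g_def)
    qed (use fin in \<open>auto simp: indicator_def\<close>)
    then have set_int: "set_integrable lborel (C k) g" by (simp add: set_integrable_def)
    have on: "g integrable_on C k" and eq: "(LINT x:C k|lborel. g x) = integral (C k) g"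
      using set_borel_integral_eq_integral[OF set_int] by auto
    have d: "(f has_derivative f' x) (at x within C k)" if "x \<in> C k" for x
      using der that CB has_derivative_at_withinI by blast
    have inj': "inj_on f (C k)" using inj CB inj_on_subset by blast
    have Cl: "C k \<in> sets lebesgue" by simp
    have on': "(\<lambda>x. \<bar>det (matrix (f' x))\<bar>) integrable_on C k"
      using on by (rule integrable_eq) (use gC in auto)
    have lm: "f ` C k \<in> lmeasurable"
      using measurable_differentiable_image_eq[OF Cl d inj'] on' by blast
    have "measure lebesgue (f ` C k) = integral (C k) (\<lambda>x. \<bar>det (matrix (f' x))\<bar>)"
      by (rule measure_differentiable_image_eq[OF Cl d inj' on'])
    also have "\<dots> = integral (C k) g" by (rule integral_cong) (use gC in auto)
    also have "\<dots> = (LINT x|lborel. indicator (C k) x *\<^sub>R g x)" using eq by (simp add: set_lebesgue_integral_def)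
    finally have "emeasure lebesgue (f ` C k) = ennreal (LINT x|lborel. indicator (C k) x *\<^sub>R g x)"
      unfolding emeasure_eq_measure2[OF lm] by simp
    also have "\<dots> = (\<integral>\<^sup>+x. ennreal (indicator (C k) x *\<^sub>R g x) \<partial>lborel)"
      by (rule nn_integral_eq_integral[symmetric, OF int]) (auto simp: g_def)
    also have "\<dots> = (\<integral>\<^sup>+x. ennreal (g x) * indicator (C k) x \<partial>lborel)"
      by (intro nn_integral_cong) (auto simp: indicator_def)
    finally show ?thesis using fmeasurableD[OF lm] by blast
  qed
  have "emeasure lborel (f ` B) = emeasure lebesgue (\<Union>k. f ` C k)"
    using fB C_un by (simp add: image_UN[symmetric])
  also have "\<dots> = (SUP k. emeasure lebesgue (f ` C k))"
  proof (rule SUP_emeasure_incseq[symmetric])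
    show "range (\<lambda>k. f ` C k) \<subseteq> sets lebesgue" using C_img by blast
    show "incseq (\<lambda>k. f ` C k)" using C_inc by (simp add: incseq_def image_mono)
  qed
  also have "\<dots> = (SUP k. emeasure (density lborel (\<lambda>x. ennreal (g x))) (C k))"
    using C_img by (simp add: emeasure_density)
  also have "\<dots> = emeasure (density lborel (\<lambda>x. ennreal (g x))) (\<Union>k. C k)"
    by (rule SUP_emeasure_incseq) (use C_inc in auto)
  also have "\<dots> = (\<integral>\<^sup>+x. ennreal (g x) * indicator B x \<partial>lborel)"
    using B by (simp add: C_un emeasure_density)
  also have "\<dots> = (\<integral>\<^sup>+x\<in>B. ennreal \<bar>det (matrix (f' x))\<bar> \<partial>lborel)"
    by (intro nn_integral_cong) (auto simp: g_def indicator_def)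
  finally show ?thesis .
qed

text \<open>\<open>P\<close> and \<open>Q\<close> are mutually inverse relabellings of the
  coordinates by a well-ordered index type. Both preserve Lebesgue measure, and conjugation by them
  leaves the Jacobian determinant unchanged.\<close>

lemma emeasure_differentiable_image:
  fixes f :: "real^'n \<Rightarrow> real^'n"
  assumes B: "B \<in> sets borel"
    and der: "\<And>x. x \<in> B \<Longrightarrow> (f has_derivative f' x) (at x)"
    and inj: "inj_on f B"
    and meas: "(\<lambda>x. indicator B x * \<bar>det (matrix (f' x))\<bar>) \<in> borel_measurable borel"
    and fB: "f ` B \<in> sets borel"
  shows "emeasure lborel (f ` B) = (\<integral>\<^sup>+x\<in>B. ennreal \<bar>det (matrix (f' x))\<bar> \<partial>lborel)"
proof -
  obtain s :: "'n widx \<Rightarrow> 'n" where s: "bij s" using ex_bij_widx by blast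
  define P where "P = (\<lambda>x::real^'n. (\<chi> i. x $ s i) :: real^'n widx)"
  define Q where "Q = (\<lambda>y::real^'n widx. (\<chi> i. y $ inv s i) :: real^'n)"
  have PQ: "P (Q y) = y" and QP: "Q (P x) = x" for x y
    using s by (simp_all add: P_def Q_def vec_eq_iff bij_is_inj bij_is_surj surj_f_inv_f)
  have P: "distr lborel borel P = lborel" unfolding P_def by (rule lborel_distr_reindex[OF s])
  have Q: "distr lborel borel Q = lborel" unfolding Q_def by (rule lborel_distr_reindex[OF bij_imp_bij_inv[OF s]])
  have blP: "bounded_linear P" unfolding P_def
    by (intro linear_conv_bounded_linear[THEN iffD1] linearI) (auto simp: vec_eq_iff)
  have blQ: "bounded_linear Q" unfolding Q_def
    by (intro linear_conv_bounded_linear[THEN iffD1] linearI) (auto simp: vec_eq_iff)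
  have [measurable]: "P \<in> borel_measurable borel" "Q \<in> borel_measurable borel"
    using blP blQ by (auto intro!: borel_measurable_continuous_onI linear_continuous_on)
  have imP: "P ` A = Q -` A" for A using PQ QP by (metis (mono_tags, lifting) image_eqI subsetI subset_antisym vimageE vimageI image_iff)
  have PA: "P ` A \<in> sets borel" if "A \<in> sets borel" for A
    unfolding imP using measurable_sets[of Q borel borel A] that by simp
  have emP: "emeasure lborel (P ` A) = emeasure lborel A" if "A \<in> sets borel" for A
    using emeasure_distr[of Q lborel borel A] that unfolding Q imP by simp
  have det: "det (matrix (\<lambda>y. P (L (Q y)))) = det (matrix L)" for L
  proof -
    have Qa: "Q (axis j 1) = axis (s j) 1" for j
      using s by (auto simp: Q_def vec_eq_iff axis_def bij_is_inj bij_is_surj surj_f_inv_f bij_inv_eq_iff)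
    then have "matrix (\<lambda>y. P (L (Q y))) = (\<chi> i j. matrix L $ s i $ s j)"
      unfolding matrix_def P_def Qa by simp
    then show ?thesis using det_reindex[OF s] by simp
  qed
  have img: "(\<lambda>y. P (f (Q y))) ` P ` B = P ` f ` B" by (simp add: image_image QP)
  have ind: "indicator (P ` B) y = indicator B (Q y)" for y
    unfolding imP by (simp add: indicator_def)
  have "emeasure lborel (f ` B) = emeasure lborel ((\<lambda>y. P (f (Q y))) ` P ` B)"
    unfolding img by (rule emP[OF fB, symmetric])
  also have "\<dots> = (\<integral>\<^sup>+y\<in>P ` B. ennreal \<bar>det (matrix (\<lambda>h. P (f' (Q y) (Q h))))\<bar> \<partial>lborel)"
  proof (rule emeasure_differentiable_image_wellorder[OF PA[OF B]])
    fix y assume "y \<in> P ` B"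
    then have "Q y \<in> B" by (auto simp: QP)
    from bounded_linear.has_derivative[OF blP has_derivative_compose[OF bounded_linear_imp_has_derivative[OF blQ] der[OF this]]]
    show "((\<lambda>y. P (f (Q y))) has_derivative (\<lambda>h. P (f' (Q y) (Q h)))) (at y)" .
  next
    show "inj_on (\<lambda>y. P (f (Q y))) (P ` B)"
      using inj by (auto simp: inj_on_def QP) (metis QP)
    show "(\<lambda>y. indicator (P ` B) y * \<bar>det (matrix (\<lambda>h. P (f' (Q y) (Q h))))\<bar>) \<in> borel_measurable borel"
      unfolding det ind using meas by measurable
    show "(\<lambda>y. P (f (Q y))) ` P ` B \<in> sets borel" unfolding img by (rule PA[OF fB])
  qed
  also have "\<dots> = (\<integral>\<^sup>+y. ennreal (indicator B (Q y) * \<bar>det (matrix (f' (Q y)))\<bar>) \<partial>lborel)"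
    unfolding det ind by (intro nn_integral_cong) (auto simp: indicator_def)
  also have "\<dots> = (\<integral>\<^sup>+x. ennreal (indicator B x * \<bar>det (matrix (f' x))\<bar>) \<partial>distr lborel borel Q)"
    by (subst nn_integral_distr) (use meas in auto)
  also have "\<dots> = (\<integral>\<^sup>+x\<in>B. ennreal \<bar>det (matrix (f' x))\<bar> \<partial>lborel)"
    unfolding Q by (intro nn_integral_cong) (auto simp: indicator_def)
  finally show ?thesis .
qed

lemma insert_coordinate_measurable:
  "(\<lambda>(t, u::real^'m). (\<chi> j. if j = k then t else u $ \<tau> j) :: real^'n) \<in> borel_measurable (lborel \<Otimes>\<^sub>M lborel)"
proof -
  have "continuous_on UNIV (\<lambda>z::real \<times> (real^'m). (\<chi> j. if j = k then fst z else snd z $ \<tau> j) :: real^'n)"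
  proof (rule continuous_on_vec_lambda)
    fix j show "continuous_on UNIV (\<lambda>z::real \<times> (real^'m). if j = k then fst z else snd z $ \<tau> j)"
      by (cases "j = k") (auto intro!: continuous_intros)
  qed
  then show ?thesis by (simp add: borel_measurable_continuous_onI lborel_prod split_beta')
qed

text \<open>A box is the product of its \<open>k\<close>-th side and the box of the remaining sides.
  This is Fubini with one distinguished coordinate, which becomes the radial variable of the
  cone.\<close>

lemma lborel_split_coordinate:
  fixes \<sigma> :: "'m::finite \<Rightarrow> 'n::finite" and \<tau> :: "'n \<Rightarrow> 'm"
  assumes \<sigma>: "bij_betw \<sigma> UNIV (- {k})" and \<tau>: "\<And>i. \<tau> (\<sigma> i) = i"
  shows "distr (lborel \<Otimes>\<^sub>M lborel) borel (\<lambda>(t, u). \<chi> j. if j = k then t else u $ \<tau> j) = (lborel :: (real^'n) measure)"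
proof (rule lborel_eqI_vec[symmetric])
  let ?F = "\<lambda>(t, u::real^'m). (\<chi> j. if j = k then t else u $ \<tau> j) :: real^'n"
  have F: "?F \<in> borel_measurable (lborel \<Otimes>\<^sub>M lborel)" by (rule insert_coordinate_measurable)
  fix l u :: "real^'n" assume le: "\<And>i. l $ i \<le> u $ i"
  have surj: "\<exists>i. j = \<sigma> i" if "j \<noteq> k" for j using \<sigma> that by (auto simp: bij_betw_def)
  have nk: "\<sigma> i \<noteq> k" for i using \<sigma> by (auto simp: bij_betw_def)
  have "?F -` box l u = box (l $ k) (u $ k) \<times> box (\<chi> i. l $ \<sigma> i) (\<chi> i. u $ \<sigma> i)"
  proof (intro set_eqI iffI)
    fix z assume "z \<in> ?F -` box l u"
    then have *: "l $ j < (if j = k then fst z else snd z $ \<tau> j) \<and> (if j = k then fst z else snd z $ \<tau> j) < u $ j" for j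
      by (auto simp: mem_box_cart split_beta)
    show "z \<in> box (l $ k) (u $ k) \<times> box (\<chi> i. l $ \<sigma> i) (\<chi> i. u $ \<sigma> i)"
      using *[of k] *[of "\<sigma> _"] nk by (auto simp: mem_box_cart mem_Times_iff \<tau>)
  next
    fix z assume "z \<in> box (l $ k) (u $ k) \<times> box (\<chi> i. l $ \<sigma> i) (\<chi> i. u $ \<sigma> i)"
    then show "z \<in> ?F -` box l u"
      using surj by (auto simp: mem_box_cart split_beta) (metis \<tau>)+
  qed
  then have "emeasure (distr (lborel \<Otimes>\<^sub>M lborel) borel ?F) (box l u) =
      emeasure lborel (box (l $ k) (u $ k)) * emeasure lborel (box (\<chi> i. l $ \<sigma> i) (\<chi> i. u $ \<sigma> i))"
    using F by (subst emeasure_distr) (auto simp: space_pair_measure lborel.emeasure_pair_measure_Times)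
  also have "\<dots> = ennreal (u $ k - l $ k) * (\<Prod>i\<in>UNIV. ennreal (u $ \<sigma> i - l $ \<sigma> i))"
    using le by (simp add: emeasure_box_vec)
  also have "(\<Prod>i\<in>UNIV. ennreal (u $ \<sigma> i - l $ \<sigma> i)) = (\<Prod>j\<in>-{k}. ennreal (u $ j - l $ j))"
    by (rule prod.reindex_bij_betw[OF \<sigma>])
  also have "ennreal (u $ k - l $ k) * \<dots> = (\<Prod>i\<in>insert k (-{k}). ennreal (u $ i - l $ i))"
    by (subst prod.insert) auto
  also have "insert k (-{k}) = UNIV" by auto
  finally show "emeasure (distr (lborel \<Otimes>\<^sub>M lborel) borel ?F) (box l u) = (\<Prod>i\<in>UNIV. ennreal (u $ i - l $ i))" .
qed simp

section \<open>Riemannian volume of Euclidean space and of the sphere\<close>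

lemma continuous_on_det:
  assumes "\<And>i j. continuous_on S (\<lambda>x. A x $ i $ j)"
  shows "continuous_on S (\<lambda>x. det (A x :: real^'n^'n))"
  unfolding det_def by (intro continuous_intros assms)

text \<open>Images of Borel sets are Borel because they are preimages under the continuous inverse,
  inside the relatively open image of \<open>U\<close>. The volume density is continuous on
  \<open>U\<close>, being the root of a polynomial in the partial derivatives.\<close>

lemma local_parametrizationD:
  fixes \<psi> :: "real^'m \<Rightarrow> real^'n"
  assumes \<psi>: "local_parametrization M U \<psi>" and M: "M \<in> sets borel"
  shows local_parametrization_open: "open U"
    and local_parametrization_inj: "inj_on \<psi> U"
    and local_parametrization_mem: "u \<in> U \<Longrightarrow> \<psi> u \<in> M"
    and local_parametrization_has_derivative:
      "u \<in> U \<Longrightarrow> (\<psi> has_derivative frechet_derivative \<psi> (at u)) (at u)"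
    and local_parametrization_image: "B \<in> sets borel \<Longrightarrow> B \<subseteq> U \<Longrightarrow> \<psi> ` B \<in> sets borel"
    and local_parametrization_measurable:
      "B \<in> sets borel \<Longrightarrow> B \<subseteq> U \<Longrightarrow>
        (\<lambda>u. indicator B u * sqrt (det (metric_matrix \<psi> u))) \<in> borel_measurable borel"
proof -
  have U: "open U" "openin (top_of_set M) (\<psi> ` U)" "smooth_on U \<psi>"
    using \<psi> by (auto simp: local_parametrization_def)
  obtain h where h: "homeomorphism U (\<psi> ` U) \<psi> h" using \<psi> by (auto simp: local_parametrization_def)
  show "open U" by fact
  show "inj_on \<psi> U" using h by (metis homeomorphism_def inj_on_inverseI)
  show "\<psi> u \<in> M" if "u \<in> U" using U(2) that openin_subset by fastforce
  show der: "(\<psi> has_derivative frechet_derivative \<psi> (at u)) (at u)" if "u \<in> U" for u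
    using smooth_on_has_derivative U that by blast
  obtain T where T: "open T" "\<psi> ` U = M \<inter> T" using U(2) by (auto simp: openin_open)
  have V: "\<psi> ` U \<in> sets borel" using M T by auto
  show "\<psi> ` B \<in> sets borel" if B: "B \<in> sets borel" "B \<subseteq> U"
  proof -
    have "h \<in> borel_measurable (restrict_space borel (\<psi> ` U))"
      using h by (intro borel_measurable_continuous_on_restrict) (auto simp: homeomorphism_def)
    from measurable_sets[OF this B(1)] have "h -` B \<inter> \<psi> ` U \<in> sets borel"
      using V by (simp add: sets_restrict_space_iff space_restrict_space)
    moreover have "h -` B \<inter> \<psi> ` U = \<psi> ` B"
      using h B(2) by (fastforce simp: homeomorphism_def)
    ultimately show ?thesis by simp
  qed
  have "continuous_on U (\<lambda>u. frechet_derivative \<psi> (at u) (axis j 1) $ i)" for i j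
    by (intro continuous_intros smooth_on_imp_continuous_on smooth_on_partial U(3)) (simp add: axis_in_Basis_iff)
  then have "continuous_on U (\<lambda>u. sqrt (det (metric_matrix \<psi> u)))"
    unfolding metric_matrix_def
    by (intro continuous_on_real_sqrt continuous_on_det)
      (simp add: matrix_matrix_mult_def transpose_def matrix_def continuous_on_sum continuous_on_mult)
  then have "(\<lambda>u. indicator U u *\<^sub>R sqrt (det (metric_matrix \<psi> u))) \<in> borel_measurable borel"
    using U(1) by (intro borel_measurable_continuous_on_indicator) auto
  then show "(\<lambda>u. indicator B u * sqrt (det (metric_matrix \<psi> u))) \<in> borel_measurable borel"
    if B: "B \<in> sets borel" "B \<subseteq> U"
  proof -
    assume m: "(\<lambda>u. indicator U u *\<^sub>R sqrt (det (metric_matrix \<psi> u))) \<in> borel_measurable borel"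
    have "(\<lambda>u. indicator B u * (indicator U u *\<^sub>R sqrt (det (metric_matrix \<psi> u)))) \<in> borel_measurable borel"
      using m B(1) by measurable
    moreover have "(\<lambda>u. indicator B u * (indicator U u *\<^sub>R sqrt (det (metric_matrix \<psi> u)))) =
        (\<lambda>u. indicator B u * sqrt (det (metric_matrix \<psi> u)))"
      by (intro ext) (use B(2) in \<open>auto simp: indicator_def\<close>)
    ultimately show ?thesis by (simp only:)
  qed
qed

text \<open>For a square matrix the root of the Gram determinant is the absolute value of the
  determinant, so every chart formula is the change of variables. The identity chart alone
  determines the measure.\<close>

lemma riemannian_volume_UNIV:
  "riemannian_volume TYPE('n::finite) (UNIV :: (real^'n) set) = lborel"
  unfolding riemannian_volume_def
proof (rule the_equality)
  have "emeasure lborel (\<psi> ` B) = (\<integral>\<^sup>+u\<in>B. ennreal (sqrt (det (metric_matrix \<psi> u))) \<partial>lborel)"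
    if \<psi>: "local_parametrization UNIV U \<psi>" and B: "B \<in> sets borel" "B \<subseteq> U"
    for U B and \<psi> :: "real^'n \<Rightarrow> real^'n"
  proof -
    have "(UNIV :: (real^'n) set) \<in> sets borel" by simp
    note D = local_parametrizationD[OF \<psi> this]
    have eq: "sqrt (det (metric_matrix \<psi> u)) = \<bar>det (matrix (frechet_derivative \<psi> (at u)))\<bar>" for u
      by (simp add: metric_matrix_def det_mul det_transpose)
    show ?thesis
      unfolding eq
      by (rule emeasure_differentiable_image[OF B(1)])
        (use B D inj_on_subset in \<open>auto simp: eq[symmetric]\<close>)
  qed
  then show "space lborel = (UNIV :: (real^'n) set) \<and> sets lborel = sets (restrict_space borel (UNIV :: (real^'n) set)) \<and>
     (\<forall>U (\<psi> :: real ^ 'n \<Rightarrow> real ^ 'n) B.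
        local_parametrization UNIV U \<psi> \<longrightarrow> B \<in> sets borel \<longrightarrow> B \<subseteq> U \<longrightarrow>
        emeasure lborel (\<psi> ` B) = (\<integral>\<^sup>+u\<in>B. ennreal (sqrt (det (metric_matrix \<psi> u))) \<partial>lborel))"
    by (simp add: sets_restrict_space)
next
  fix \<nu> :: "(real^'n) measure"
  assume \<nu>: "space \<nu> = UNIV \<and> sets \<nu> = sets (restrict_space borel UNIV) \<and>
     (\<forall>U (\<psi> :: real ^ 'n \<Rightarrow> real ^ 'n) B.
        local_parametrization UNIV U \<psi> \<longrightarrow> B \<in> sets borel \<longrightarrow> B \<subseteq> U \<longrightarrow>
        emeasure \<nu> (\<psi> ` B) = (\<integral>\<^sup>+u\<in>B. ennreal (sqrt (det (metric_matrix \<psi> u))) \<partial>lborel))"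
  have fd: "frechet_derivative (\<lambda>x. x) (at u) = (\<lambda>x. x)" for u :: "real^'n"
    by (rule frechet_derivative_eq_has_derivative) simp
  have "local_parametrization UNIV UNIV (\<lambda>x::real^'n. x)"
    unfolding local_parametrization_def fd
    by (auto intro!: exI[of _ "\<lambda>x. x"] smooth_on_bounded_linear bounded_linear_ident simp: homeomorphism_def)
  then have "emeasure \<nu> ((\<lambda>x. x) ` B) = (\<integral>\<^sup>+u\<in>B. ennreal (sqrt (det (metric_matrix (\<lambda>x. x) u))) \<partial>lborel)"
    if "B \<in> sets borel" for B
    using \<nu> that by blast
  moreover have "det (metric_matrix (\<lambda>x::real^'n. x) u) = 1" for u
    unfolding metric_matrix_def fd by (simp add: matrix_id_mat_1[unfolded id_def] transpose_mat)
  ultimately have "emeasure \<nu> B = emeasure lborel B" if "B \<in> sets borel" for B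
    using that by simp
  then show "\<nu> = lborel"
    using \<nu> by (intro measure_eqI) (auto simp: sets_restrict_space)
qed

section \<open>Surface measure of the sphere by cones\<close>

text \<open>Under radial projection of the punctured ball the preimage of \<open>A\<close> is the
  cone over \<open>A\<close>, so a push-forward encodes the cone volume and is a measure by
  construction. A cone of height \<open>R\<close> over a piece of the sphere has
  \<open>R / d\<close> times its area as volume, where \<open>d\<close> is the ambient dimension;
  the scaling inverts this.\<close>

definition sphere_measure :: "real \<Rightarrow> (real^'n) measure" where
  "sphere_measure R = scale_measure (ennreal (real CARD('n) / R))
     (distr (restrict_space lborel (cball 0 R - {0})) (restrict_space borel (sphere 0 R))
       (\<lambda>x. (R / norm x) *\<^sub>R x))"

lemma space_sphere_measure [simp]: "space (sphere_measure R) = sphere 0 R"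
  by (simp add: sphere_measure_def space_restrict_space space_scale_measure)

lemma sets_sphere_measure [measurable_cong]: "sets (sphere_measure R) = sets (restrict_space borel (sphere 0 R))"
  by (simp add: sphere_measure_def)

lemma sphere_projection_measurable:
  assumes "R > 0"
  shows "(\<lambda>x. (R / norm x) *\<^sub>R x) \<in>
    restrict_space lborel (cball 0 R - {0}) \<rightarrow>\<^sub>M restrict_space borel (sphere (0::real^'n) R)"
  by (rule measurable_restrict_space2)
    (use assms in \<open>auto simp: space_restrict_space intro!: measurable_restrict_space1\<close>)

lemma emeasure_sphere_measure:
  assumes R: "R > 0" and A: "A \<in> sets (restrict_space borel (sphere (0::real^'n) R))"
  shows "emeasure (sphere_measure R) A =
    ennreal (real CARD('n) / R) * emeasure lborel {x \<in> cball 0 R - {0}. (R / norm x) *\<^sub>R x \<in> A}"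
proof -
  let ?p = "\<lambda>x::real^'n. (R / norm x) *\<^sub>R x"
  have *: "?p -` A \<inter> (cball 0 R - {0}) = {x \<in> cball 0 R - {0}. ?p x \<in> A}" by auto
  have "emeasure (sphere_measure R) A = ennreal (real CARD('n) / R) *
     emeasure (restrict_space lborel (cball 0 R - {0})) (?p -` A \<inter> (cball 0 R - {0}))"
    unfolding sphere_measure_def using A
    by (simp add: emeasure_distr[OF sphere_projection_measurable[OF R]] space_restrict_space)
  also have "emeasure (restrict_space lborel (cball 0 R - {0})) (?p -` A \<inter> (cball 0 R - {0})) =
      emeasure lborel (?p -` A \<inter> (cball 0 R - {0}))"
    by (rule emeasure_restrict_space) auto
  finally show ?thesis unfolding * .
qed

lemma sphere_cone_measurable:
  assumes "A \<in> sets borel"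
  shows "{x \<in> cball (0::real^'n) R - {0}. (R / norm x) *\<^sub>R x \<in> A} \<in> sets borel"
proof -
  have "(\<lambda>x::real^'n. (R / norm x) *\<^sub>R x) \<in> borel_measurable borel" by measurable
  from measurable_sets[OF this assms]
  have "(cball 0 R - {0}) \<inter> ((\<lambda>x. (R / norm x) *\<^sub>R x) -` A) \<in> sets borel" by auto
  moreover have "{x \<in> cball (0::real^'n) R - {0}. (R / norm x) *\<^sub>R x \<in> A} = (cball 0 R - {0}) \<inter> ((\<lambda>x. (R / norm x) *\<^sub>R x) -` A)" by blast
  ultimately show ?thesis by (simp only:)
qed

lemma det_scale_entries:
  "det (\<chi> i j. c * A $ i $ j) = c ^ CARD('n) * det A" for A :: "real^'n^'n"
proof -
  have "(\<chi> i j. c * A $ i $ j) = (\<chi> i. c *s A $ i)" by (simp add: vec_eq_iff)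
  then show ?thesis using det_rows_mul[of "\<lambda>_. c" "\<lambda>i. A $ i"] by simp
qed

text \<open>The index types are related only by their cardinalities. This selects the coordinate
  that becomes radial and matches the remaining ones with the parameter space of the charts.\<close>

lemma ex_coordinate_split:
  assumes "CARD('m::finite) = CARD('n::finite) - 1"
  obtains k :: "'n::finite" and \<sigma> :: "'m::finite \<Rightarrow> 'n" and \<tau> where "bij_betw \<sigma> UNIV (- {k})" "\<And>i. \<tau> (\<sigma> i) = i"
proof -
  fix k :: 'n
  have "card (- {k}) = CARD('m)" using assms by (simp add: Compl_eq_Diff_UNIV card_Diff_singleton)
  then obtain \<sigma> :: "'m \<Rightarrow> 'n" where \<sigma>: "bij_betw \<sigma> UNIV (- {k})"
    by (metis finite finite_same_card_bij)
  then have "inv \<sigma> (\<sigma> i) = i" for i by (simp add: bij_betw_imp_inj_on)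
  with \<sigma> show thesis using that by blast
qed

text \<open>\<open>x \<mapsto> (x $ k) *\<^sub>R \<psi> (E x)\<close> parametrizes the cone, \<open>E\<close> dropping the coordinate \<open>k\<close>. Its Gram matrix is block
  diagonal because \<open>\<psi> u\<close> is orthogonal to the range of the derivative of \<open>\<psi>\<close>.\<close>

lemma emeasure_sphere_measure_parametrization:
  fixes \<psi> :: "real^'m \<Rightarrow> real^'n"
  assumes R: "R > 0" and card: "CARD('m) = CARD('n) - 1"
    and \<psi>: "local_parametrization (sphere 0 R) U \<psi>" and B: "B \<in> sets borel" "B \<subseteq> U"
  shows "emeasure (sphere_measure R) (\<psi> ` B) = (\<integral>\<^sup>+u\<in>B. ennreal (sqrt (det (metric_matrix \<psi> u))) \<partial>lborel)"
proof -
  obtain k :: 'n and \<sigma> :: "'m \<Rightarrow> 'n" and \<tau> where \<sigma>: "bij_betw \<sigma> UNIV (- {k})" and \<tau>: "\<And>i. \<tau> (\<sigma> i) = i"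
    using ex_coordinate_split[OF card] by metis
  have surj: "\<exists>i. j = \<sigma> i" if "j \<noteq> k" for j using \<sigma> that by (auto simp: bij_betw_def)
  have nk: "\<sigma> i \<noteq> k" for i using \<sigma> by (auto simp: bij_betw_def)
  have S: "sphere (0::real^'n) R \<in> sets borel" by simp
  note D = local_parametrizationD[OF \<psi> S]
  define d where "d = (\<lambda>u. frechet_derivative \<psi> (at u))"
  define g where "g = (\<lambda>u. sqrt (det (metric_matrix \<psi> u)))"
  define E where "E = (\<lambda>x::real^'n. (\<chi> i. x $ \<sigma> i) :: real^'m)"
  have blE: "bounded_linear E" unfolding E_def
    by (intro linear_conv_bounded_linear[THEN iffD1] linearI) (auto simp: vec_eq_iff)
  have [measurable]: "E \<in> borel_measurable borel"
    using blE by (auto intro!: borel_measurable_continuous_onI linear_continuous_on)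
  define \<Psi> where "\<Psi> = (\<lambda>x. (x $ k) *\<^sub>R \<psi> (E x))"
  define \<Psi>' where "\<Psi>' = (\<lambda>x h. (h $ k) *\<^sub>R \<psi> (E x) + (x $ k) *\<^sub>R d (E x) (E h))"
  define Q where "Q = {x. 0 < x $ k \<and> x $ k \<le> 1 \<and> E x \<in> B}"
  have Q: "Q \<in> sets borel" unfolding Q_def using B(1) by measurable
  have EB: "E x \<in> U" if "x \<in> Q" for x using that B by (auto simp: Q_def)
  have n\<psi>: "norm (\<psi> u) = R" if "u \<in> U" for u using D(3)[OF that] by simp
  have img: "\<Psi> ` Q = {x \<in> cball 0 R - {0}. (R / norm x) *\<^sub>R x \<in> \<psi> ` B}"
  proof (intro set_eqI iffI)
    fix y assume "y \<in> \<Psi> ` Q"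
    then obtain x where x: "x \<in> Q" "y = \<Psi> x" by blast
    have n: "norm y = x $ k * R" using x n\<psi>[OF EB[OF x(1)]] by (simp add: \<Psi>_def Q_def)
    have pos: "0 < x $ k" "x $ k \<le> 1" using x by (auto simp: Q_def)
    have "(R / norm y) *\<^sub>R y = \<psi> (E x)" using n pos R by (simp add: x(2) \<Psi>_def)
    moreover have "norm y \<le> R" "norm y > 0" using n pos R by (simp_all add: mult_left_le_one_le)
    ultimately show "y \<in> {x \<in> cball 0 R - {0}. (R / norm x) *\<^sub>R x \<in> \<psi> ` B}"
      using x by (auto simp: Q_def)
  next
    fix y assume y: "y \<in> {x \<in> cball 0 R - {0}. (R / norm x) *\<^sub>R x \<in> \<psi> ` B}"
    then obtain b where b: "b \<in> B" "(R / norm y) *\<^sub>R y = \<psi> b" by auto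
    \<comment> \<open>The preimage of \<open>y\<close>: the radial coordinate is the fraction of the
      radius, the others are the chart parameter of the projected point.\<close>
    define x :: "real^'n" where "x = (\<chi> j. if j = k then norm y / R else b $ \<tau> j)"
    have Ex: "E x = b" by (simp add: E_def x_def nk \<tau>)
    have "x \<in> Q" using y R b by (auto simp: Q_def Ex x_def[THEN arg_cong[where f="\<lambda>x. x $ k"]])
    moreover have "\<Psi> x = (norm y / R) *\<^sub>R \<psi> b" by (simp add: \<Psi>_def Ex) (simp add: x_def)
    then have "\<Psi> x = y" using y R by (simp add: b(2)[symmetric])
    ultimately show "y \<in> \<Psi> ` Q" by blast
  qed
  have \<psi>B: "\<psi> ` B \<in> sets (restrict_space borel (sphere 0 R))"
    using D(5)[OF B] D(3) B by (auto simp: sets_restrict_space_iff)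
  have ext: "x = y" if "x $ k = y $ k" "E x = E y" for x y
  proof -
    have "x $ \<sigma> i = y $ \<sigma> i" for i using that(2) by (simp add: E_def vec_eq_iff)
    then show ?thesis using that(1) surj by (metis vec_eq_iff)
  qed
  have inj: "inj_on \<Psi> Q"
  proof (rule inj_onI)
    fix x y assume xy: "x \<in> Q" "y \<in> Q" "\<Psi> x = \<Psi> y"
    then have "norm (\<Psi> x) = norm (\<Psi> y)" by simp
    \<comment> \<open>All points of the chart have norm \<open>R\<close>, so the norm recovers the
      radial coordinate.\<close>
    then have k: "x $ k = y $ k"
      using xy(1,2) n\<psi>[OF EB] R by (simp add: \<Psi>_def Q_def)
    then have "\<psi> (E x) = \<psi> (E y)" using xy by (simp add: \<Psi>_def Q_def)
    then have "E x = E y" using D(2) EB xy by (auto dest: inj_onD)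
    with k show "x = y" by (rule ext)
  qed
  have der: "(\<Psi> has_derivative \<Psi>' x) (at x)" if "x \<in> Q" for x
  proof -
    have "((\<lambda>x. \<psi> (E x)) has_derivative (\<lambda>h. d (E x) (E h))) (at x)"
      using has_derivative_compose[OF bounded_linear_imp_has_derivative[OF blE] D(4)[OF EB[OF that]]]
      by (simp add: d_def)
    then show ?thesis
      unfolding \<Psi>_def \<Psi>'_def
      by (auto intro!: derivative_eq_intros bounded_linear_imp_has_derivative bounded_linear_vec_nth)
  qed
  have det: "\<bar>det (matrix (\<Psi>' x))\<bar> = R * (x $ k) ^ CARD('m) * g (E x)" if x: "x \<in> Q" for x
  proof -
    define N where "N = transpose (matrix (\<Psi>' x)) ** matrix (\<Psi>' x)"
    have N: "N $ i $ j = \<Psi>' x (axis i 1) \<bullet> \<Psi>' x (axis j 1)" for i j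
      by (simp add: N_def matrix_matrix_mult_def transpose_def matrix_def inner_vec_def)
    have D4: "(\<psi> has_derivative d (E x)) (at (E x))" using D(4)[OF EB[OF x]] by (simp add: d_def)
    have lin: "linear (d (E x))" using D4 by (rule has_derivative_linear)
    have "E (axis k 1) = 0" by (simp add: E_def vec_eq_iff axis_def nk)
    then have ck: "\<Psi>' x (axis k 1) = \<psi> (E x)" using linear_0[OF lin] by (simp add: \<Psi>'_def)
    have "E (axis (\<sigma> i) 1) = axis i 1" for i by (auto simp: E_def vec_eq_iff axis_def) (metis \<tau>)+
    then have c\<sigma>: "\<Psi>' x (axis (\<sigma> i) 1) = (x $ k) *\<^sub>R d (E x) (axis i 1)" for i
      using nk[of i] by (simp add: \<Psi>'_def axis_def)
    \<comment> \<open>\<open>\<psi> u \<bullet> \<psi> u\<close> is constant on \<open>U\<close>,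
      hence its derivative vanishes.\<close>
    have perp: "\<psi> (E x) \<bullet> d (E x) h = 0" for h
    proof -
      have "((\<lambda>u. \<psi> u \<bullet> \<psi> u) has_derivative (\<lambda>h. 2 * (\<psi> (E x) \<bullet> d (E x) h))) (at (E x))"
        by (auto intro!: derivative_eq_intros D4 simp: inner_commute)
      moreover have "((\<lambda>u. \<psi> u \<bullet> \<psi> u) has_derivative (\<lambda>h. 0)) (at (E x))"
        by (rule has_derivative_transform_within_open[OF has_derivative_const D(1) EB[OF x]])
          (simp add: n\<psi> dot_square_norm)
      ultimately show ?thesis using has_derivative_unique by (metis (no_types, lifting) mult_eq_0_iff zero_neq_numeral)
    qed
    have "N $ k $ j = 0" if "j \<noteq> k" for j
      using surj[OF that] perp by (auto simp: N ck c\<sigma>)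
    from det_block[OF \<sigma> this] have "det N = N $ k $ k * det (\<chi> i j. N $ \<sigma> i $ \<sigma> j)" .
    also have "N $ k $ k = R\<^sup>2" by (simp add: N ck dot_square_norm n\<psi>[OF EB[OF x]])
    also have "(\<chi> i j. N $ \<sigma> i $ \<sigma> j) = (\<chi> i j. (x $ k)\<^sup>2 * metric_matrix \<psi> (E x) $ i $ j)"
      by (simp add: N c\<sigma> vec_eq_iff metric_matrix_def matrix_matrix_mult_def transpose_def matrix_def
          inner_vec_def d_def power2_eq_square sum_distrib_left mult_ac)
    also have "det \<dots> = ((x $ k) ^ CARD('m))\<^sup>2 * det (metric_matrix \<psi> (E x))"
      by (simp add: det_scale_entries power_mult[symmetric] mult.commute)
    finally have "sqrt (det N) = R * (x $ k) ^ CARD('m) * g (E x)"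
      using R x by (simp add: real_sqrt_mult g_def Q_def)
    moreover have "sqrt (det N) = \<bar>det (matrix (\<Psi>' x))\<bar>"
      by (simp add: N_def det_mul det_transpose)
    ultimately show ?thesis by simp
  qed
  \<comment> \<open>The Jacobian is the product of a radial part \<open>a\<close> and the chart
    density \<open>b\<close>, so the integral splits.\<close>
  define a where "a = (\<lambda>t::real. indicator {0..1} t * (R * t ^ CARD('m)))"
  define b where "b = (\<lambda>u. indicator B u * g u)"
  have [measurable]: "b \<in> borel_measurable borel" unfolding b_def g_def by (rule D(6)[OF B])
  have [measurable]: "a \<in> borel_measurable borel" unfolding a_def by measurable
  have ab: "indicator Q x * \<bar>det (matrix (\<Psi>' x))\<bar> = a (x $ k) * b (E x)" for x
    using det[of x] by (auto simp: a_def b_def Q_def indicator_def)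
  have a0: "a t \<ge> 0" for t using R by (auto simp: a_def indicator_def)
  have "\<Psi> ` Q \<in> sets borel" unfolding img by (rule sphere_cone_measurable[OF D(5)[OF B]])
  then have "emeasure lborel (\<Psi> ` Q) = (\<integral>\<^sup>+x\<in>Q. ennreal \<bar>det (matrix (\<Psi>' x))\<bar> \<partial>lborel)"
    by (intro emeasure_differentiable_image[OF Q der inj]) (auto simp: ab)
  also have "\<dots> = (\<integral>\<^sup>+x. ennreal (a (x $ k)) * ennreal (b (E x)) \<partial>lborel)"
  proof (rule nn_integral_cong)
    fix x
    have "ennreal \<bar>det (matrix (\<Psi>' x))\<bar> * indicator Q x = ennreal (indicator Q x * \<bar>det (matrix (\<Psi>' x))\<bar>)"
      by (simp add: indicator_def)
    then show "ennreal \<bar>det (matrix (\<Psi>' x))\<bar> * indicator Q x = ennreal (a (x $ k)) * ennreal (b (E x))"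
      unfolding ab using a0 by (simp add: ennreal_mult')
  qed
  also have "\<dots> = (\<integral>\<^sup>+z. ennreal (a (fst z)) * ennreal (b (snd z)) \<partial>(lborel \<Otimes>\<^sub>M lborel))"
  proof -
    let ?F = "\<lambda>(t, u::real^'m). (\<chi> j. if j = k then t else u $ \<tau> j) :: real^'n"
    have F: "?F \<in> borel_measurable (lborel \<Otimes>\<^sub>M lborel)" by (rule insert_coordinate_measurable)
    have FE: "?F z $ k = fst z" "E (?F z) = snd z" for z
      by (auto simp: E_def split_beta nk \<tau>)
    have "(\<integral>\<^sup>+x. ennreal (a (x $ k)) * ennreal (b (E x)) \<partial>distr (lborel \<Otimes>\<^sub>M lborel) borel ?F) =
      (\<integral>\<^sup>+z. ennreal (a (?F z $ k)) * ennreal (b (E (?F z))) \<partial>(lborel \<Otimes>\<^sub>M lborel))"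
      by (rule nn_integral_distr[OF F]) measurable
    then show ?thesis unfolding lborel_split_coordinate[OF \<sigma> \<tau>] FE .
  qed
  also have "\<dots> = (\<integral>\<^sup>+t. ennreal (a t) * (\<integral>\<^sup>+u. ennreal (b u) \<partial>lborel) \<partial>lborel)"
    by (subst lborel.nn_integral_fst[symmetric]) (simp_all add: nn_integral_cmult)
  also have "\<dots> = (\<integral>\<^sup>+t. ennreal (a t) \<partial>lborel) * (\<integral>\<^sup>+u. ennreal (b u) \<partial>lborel)"
    by (rule nn_integral_multc) measurable
  \<comment> \<open>With \<open>m\<close> the dimension of the sphere, the integral of
    \<open>R * t ^ m\<close> over the unit interval is \<open>R / (m + 1)\<close>, which cancels the
    factor in \<open>sphere_measure\<close>.\<close>
  also have "(\<integral>\<^sup>+t. ennreal (a t) \<partial>lborel) = ennreal (R / real CARD('n))"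
  proof -
    have n: "real CARD('n) = real CARD('m) + 1" using card zero_less_card_finite[where 'a='n] by linarith
    have "(\<integral>\<^sup>+t. ennreal (R * t ^ CARD('m)) * indicator {0..1} t \<partial>lborel) =
        ennreal (R * 1 ^ (CARD('m) + 1) / real CARD('n) - R * 0 ^ (CARD('m) + 1) / real CARD('n))"
    proof (rule nn_integral_FTC_Icc)
      fix t :: real
      show "((\<lambda>t. R * t ^ (CARD('m) + 1) / real CARD('n)) has_real_derivative R * t ^ CARD('m)) (at t)"
        by (rule DERIV_cong[OF DERIV_cdivide[OF DERIV_cmult[OF DERIV_pow]]]) (use n in \<open>simp add: field_simps\<close>)
    qed (use R in auto)
    moreover have "ennreal (R * t ^ CARD('m)) * indicator {0..1} t = ennreal (a t)" for t
      by (auto simp: a_def indicator_def)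
    ultimately show ?thesis by simp
  qed
  finally have e: "emeasure lborel (\<Psi> ` Q) = ennreal (R / real CARD('n)) * (\<integral>\<^sup>+u. ennreal (b u) \<partial>lborel)" .
  have "ennreal (real CARD('n) / R) * ennreal (R / real CARD('n)) = 1"
    using R by (simp add: ennreal_mult'[symmetric])
  then have "emeasure (sphere_measure R) (\<psi> ` B) = (\<integral>\<^sup>+u. ennreal (b u) \<partial>lborel)"
    unfolding emeasure_sphere_measure[OF R \<psi>B] img[symmetric] e by (simp add: mult.assoc[symmetric])
  also have "\<dots> = (\<integral>\<^sup>+u\<in>B. ennreal (g u) \<partial>lborel)"
    by (intro nn_integral_cong) (auto simp: b_def indicator_def)
  finally show ?thesis by (simp add: g_def)
qed


section \<open>Stereographic charts and uniqueness of the surface measure\<close>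

lemma smooth_on_vecI:
  fixes f :: "'a::euclidean_space \<Rightarrow> real^'n"
  assumes "open S" "\<And>j. smooth_on S (\<lambda>u. f u $ j)"
  shows "smooth_on S f"
proof -
  have "smooth_on S (\<lambda>u. \<Sum>j\<in>UNIV. (f u $ j) *\<^sub>R (axis j 1 :: real^'n))"
    by (intro smooth_on_sum smooth_on_bounded_linear_compose[where L="\<lambda>t. t *\<^sub>R _"] assms
        bounded_linear_scaleR_left)
  moreover have "(\<lambda>u. \<Sum>j\<in>UNIV. (f u $ j) *\<^sub>R axis j 1) = f"
    by (simp add: fun_eq_iff vec_eq_iff axis_def if_distrib cong: if_cong)
  ultimately show ?thesis by simp
qed

text \<open>\<open>\<psi>\<close> is inverse stereographic projection from the pole
  \<open>axis k (\<epsilon> * R)\<close>, with \<open>w u\<close> equal to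
  \<open>1 / (1 + u \<bullet> u)\<close>, and \<open>h\<close> is the projection itself. The two
  signs of \<open>\<epsilon>\<close> together cover the sphere.\<close>

lemma stereographic_parametrization:
  fixes \<sigma> :: "'m::finite \<Rightarrow> 'n::finite" and \<epsilon> :: real
  assumes R: "R > 0" and \<sigma>: "bij_betw \<sigma> UNIV (- {k})" and \<epsilon>: "\<epsilon> \<in> {1, -1}"
  shows "\<exists>\<psi> :: real^'m \<Rightarrow> real^'n. local_parametrization (sphere 0 R) UNIV \<psi> \<and>
    \<psi> ` UNIV = sphere 0 R - {axis k (\<epsilon> * R)}"
proof -
  define \<tau> where "\<tau> = inv \<sigma>"
  have \<tau>: "\<tau> (\<sigma> i) = i" for i using \<sigma> by (simp add: \<tau>_def bij_betw_imp_inj_on)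
  have surj: "\<exists>i. j = \<sigma> i" if "j \<noteq> k" for j using \<sigma> that by (auto simp: bij_betw_def)
  have nk: "\<sigma> i \<noteq> k" for i using \<sigma> by (auto simp: bij_betw_def)
  have e2: "\<epsilon> * \<epsilon> = 1" "\<epsilon> * (\<epsilon> * t) = t" for t using \<epsilon> by auto
  have sum: "(\<Sum>j\<in>UNIV. f j) = f k + (\<Sum>i\<in>UNIV. f (\<sigma> i))" for f :: "'n \<Rightarrow> real"
  proof -
    have "UNIV = insert k (- {k})" by auto
    then have "(\<Sum>j\<in>UNIV. f j) = f k + (\<Sum>j\<in>-{k}. f j)" by (metis ComplD finite insertI1 sum.insert)
    then show ?thesis using sum.reindex_bij_betw[OF \<sigma>, of f] by simp
  qed
  define w where "w = (\<lambda>u::real^'m. inverse (1 + u \<bullet> u))"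
  have pos: "1 + u \<bullet> u > 0" for u :: "real^'m" by (simp add: add_pos_nonneg)
  have w: "w u > 0" "w u * (1 + u \<bullet> u) = 1" for u
    using pos[of u] by (simp_all add: w_def)
  define \<psi> :: "real^'m \<Rightarrow> real^'n" where
    "\<psi> = (\<lambda>u. \<chi> j. if j = k then \<epsilon> * R * (1 - 2 * w u) else 2 * R * w u * u $ \<tau> j)"
  define E where "E = (\<lambda>x::real^'n. (\<chi> i. x $ \<sigma> i) :: real^'m)"
  have blE: "bounded_linear E" unfolding E_def
    by (intro linear_conv_bounded_linear[THEN iffD1] linearI) (auto simp: vec_eq_iff)
  define h where "h = (\<lambda>x. inverse (R - \<epsilon> * x $ k) *\<^sub>R E x)"
  have \<psi>k: "\<psi> u $ k = \<epsilon> * R * (1 - 2 * w u)" and \<psi>\<sigma>: "\<psi> u $ \<sigma> i = 2 * R * w u * u $ i" for u i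
    by (simp_all add: \<psi>_def nk \<tau>)
  have \<psi>_sphere: "norm (\<psi> u) = R" for u
  proof -
    have "\<psi> u \<bullet> \<psi> u = (\<epsilon> * R * (1 - 2 * w u))\<^sup>2 + (\<Sum>i\<in>UNIV. (2 * R * w u)\<^sup>2 * (u $ i * u $ i))"
      by (simp add: inner_vec_def sum \<psi>k \<psi>\<sigma> power2_eq_square mult_ac)
    also have "\<dots> = (\<epsilon> * \<epsilon>) * R\<^sup>2 * (1 - 2 * w u)\<^sup>2 + 4 * R\<^sup>2 * (w u)\<^sup>2 * (u \<bullet> u)"
      by (simp add: inner_vec_def sum_distrib_left power2_eq_square mult_ac)
    also have "\<dots> = R\<^sup>2 * (1 - 4 * w u + 4 * w u * (w u * (1 + u \<bullet> u)))"
      unfolding e2 by (simp add: power2_eq_square algebra_simps)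
    also have "\<dots> = R\<^sup>2" unfolding w by simp
    finally show ?thesis using R by (simp add: dot_square_norm)
  qed
  have h\<psi>: "h (\<psi> u) = u" and \<psi>_ne: "R - \<epsilon> * \<psi> u $ k \<noteq> 0" for u
  proof -
    have "R - \<epsilon> * \<psi> u $ k = R - (\<epsilon> * \<epsilon>) * R * (1 - 2 * w u)" by (simp add: \<psi>k mult.assoc)
    then have *: "R - \<epsilon> * \<psi> u $ k = 2 * R * w u" unfolding e2 by (simp add: algebra_simps)
    then show "R - \<epsilon> * \<psi> u $ k \<noteq> 0" using R w(1)[of u] by simp
    show "h (\<psi> u) = u"
      using R w(1)[of u] unfolding h_def * by (simp add: E_def vec_eq_iff \<psi>\<sigma> field_simps)
  qed
  \<comment> \<open>Equality in \<open>\<epsilon> * x $ k \<le> R\<close> forces all other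
    coordinates to vanish, so it occurs only at the removed pole.\<close>
  have sphere_ne: "R - \<epsilon> * x $ k > 0" if x: "x \<in> sphere 0 R - {axis k (\<epsilon> * R)}" for x
  proof (rule ccontr)
    assume "\<not> ?thesis"
    then have "R \<le> \<epsilon> * x $ k" by simp
    then have "R\<^sup>2 \<le> (\<epsilon> * x $ k)\<^sup>2" using R by (simp add: power_mono)
    then have "R\<^sup>2 \<le> (x $ k)\<^sup>2" using \<epsilon> by auto
    moreover have xx: "(x $ k)\<^sup>2 + (\<Sum>i\<in>UNIV. (x $ \<sigma> i)\<^sup>2) = R\<^sup>2"
    proof -
      have "x \<bullet> x = R\<^sup>2" using x by (simp add: dot_square_norm)
      then show ?thesis by (simp add: inner_vec_def sum power2_eq_square)
    qed
    ultimately have "(\<Sum>i\<in>UNIV. (x $ \<sigma> i)\<^sup>2) \<le> 0" by linarith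
    then have "(\<Sum>i\<in>UNIV. (x $ \<sigma> i)\<^sup>2) = 0" by (meson sum_nonneg zero_le_power2 antisym)
    then have z: "x $ \<sigma> i = 0" for i by (simp add: sum_nonneg_eq_0_iff)
    then have "(x $ k)\<^sup>2 = R\<^sup>2" using xx by simp
    then have "x $ k = R \<or> x $ k = - R" by (simp add: power2_eq_iff)
    then have "x $ k = \<epsilon> * R" using \<open>R \<le> \<epsilon> * x $ k\<close> \<epsilon> R by auto
    then have "x = axis k (\<epsilon> * R)" using z surj by (auto simp: vec_eq_iff axis_def)
    then show False using x by simp
  qed
  have \<psi>h: "\<psi> (h x) = x" if x: "x \<in> sphere 0 R - {axis k (\<epsilon> * R)}" for x
  proof -
    define q where "q = R - \<epsilon> * x $ k"
    have q: "q > 0" unfolding q_def by (rule sphere_ne[OF x])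
    have xx: "x $ k * x $ k + (\<Sum>i\<in>UNIV. x $ \<sigma> i * x $ \<sigma> i) = R * R"
    proof -
      have "x \<bullet> x = R\<^sup>2" using x by (simp add: dot_square_norm)
      then show ?thesis by (simp add: inner_vec_def sum power2_eq_square)
    qed
    have "E x \<bullet> E x = R * R - x $ k * x $ k"
      using xx by (simp add: E_def inner_vec_def)
    also have "\<dots> = q * (R + \<epsilon> * x $ k)"
      using e2 by (simp add: q_def algebra_simps)
    finally have "h x \<bullet> h x = (R + \<epsilon> * x $ k) / q"
      using q by (simp add: h_def q_def[symmetric] field_simps)
    then have "1 + h x \<bullet> h x = 2 * R / q"
      using q by (simp add: field_simps) (simp add: q_def)
    then have wh: "w (h x) = q / (2 * R)" by (simp add: w_def)
    have "\<psi> (h x) $ j = x $ j" for j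
    proof (cases "j = k")
      case True
      have "\<psi> (h x) $ k = \<epsilon> * (R - q)" using R by (simp add: \<psi>k wh field_simps)
      then show ?thesis using True by (simp add: q_def e2)
    next
      case False
      then obtain i where "j = \<sigma> i" using surj by blast
      moreover have "h x $ i = x $ \<sigma> i / q" by (simp add: h_def q_def E_def divide_inverse mult.commute)
      ultimately show ?thesis using R q by (simp add: \<psi>\<sigma> wh)
    qed
    then show ?thesis by (simp add: vec_eq_iff)
  qed
  have img: "\<psi> ` UNIV = sphere 0 R - {axis k (\<epsilon> * R)}"
  proof
    have "\<psi> u \<noteq> axis k (\<epsilon> * R)" for u
      using \<psi>_ne[of u] e2 by auto
    then show "\<psi> ` UNIV \<subseteq> sphere 0 R - {axis k (\<epsilon> * R)}" using \<psi>_sphere by auto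
    show "sphere 0 R - {axis k (\<epsilon> * R)} \<subseteq> \<psi> ` UNIV" using \<psi>h by (metis rangeI subsetI)
  qed
  have sw: "smooth_on UNIV w"
    unfolding w_def using pos by (intro smooth_on_inverse smooth_on_add smooth_on_const smooth_on_inner_self) (auto simp: less_le)
  have smooth: "smooth_on UNIV \<psi>"
  proof (rule smooth_on_vecI)
    fix j
    have 1: "smooth_on UNIV (\<lambda>u. \<epsilon> * R + (- 2 * \<epsilon> * R) * w u)"
      by (intro smooth_on_add smooth_on_mult smooth_on_const sw open_UNIV)
    have 2: "smooth_on UNIV (\<lambda>u. 2 * R * w u * u $ \<tau> j)"
      by (intro smooth_on_mult smooth_on_const sw open_UNIV smooth_on_bounded_linear bounded_linear_vec_nth)
    have "\<epsilon> * R * (1 - 2 * w u) = \<epsilon> * R + (- 2 * \<epsilon> * R) * w u" for u by (simp add: algebra_simps)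
    with 1 2 show "smooth_on UNIV (\<lambda>u. \<psi> u $ j)"
      by (cases "j = k") (simp_all add: \<psi>_def)
  qed simp
  have cont_h: "continuous_on (sphere 0 R - {axis k (\<epsilon> * R)}) h"
    unfolding h_def using sphere_ne
    by (intro continuous_intros linear_continuous_on blE) (auto simp: less_le)
  have "homeomorphism UNIV (\<psi> ` UNIV) \<psi> h"
  proof -
    have "h ` (\<psi> ` UNIV) = UNIV" by (simp add: image_image h\<psi>)
    then show ?thesis
      unfolding homeomorphism_def
      using \<psi>h h\<psi> smooth_on_imp_continuous_on[OF smooth] cont_h by (simp add: img)
  qed
  \<comment> \<open>Differentiating \<open>h (\<psi> u) = u\<close> yields a left inverse of the
    derivative of \<open>\<psi>\<close>.\<close>
  moreover have "inj (frechet_derivative \<psi> (at u))" for u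
  proof -
    have "(h has_derivative frechet_derivative h (at (\<psi> u))) (at (\<psi> u))"
      unfolding frechet_derivative_works[symmetric] h_def
      using \<psi>_ne[of u] blE by (intro derivative_intros bounded_linear_imp_differentiable) auto
    from has_derivative_compose[OF smooth_on_has_derivative[OF smooth open_UNIV UNIV_I] this]
    have "((\<lambda>u. u) has_derivative (\<lambda>v. frechet_derivative h (at (\<psi> u)) (frechet_derivative \<psi> (at u) v))) (at u)"
      by (simp add: h\<psi>)
    then have "(\<lambda>v. frechet_derivative h (at (\<psi> u)) (frechet_derivative \<psi> (at u) v)) = (\<lambda>v. v)"
      using has_derivative_unique has_derivative_ident by blast
    then show ?thesis by (metis injI)
  qed
  moreover have "openin (top_of_set (sphere 0 R)) (\<psi> ` UNIV)"
    unfolding img by (rule openin_delete) simp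
  ultimately have "local_parametrization (sphere 0 R) UNIV \<psi>"
    unfolding local_parametrization_def using smooth by blast
  with img show ?thesis by blast
qed

text \<open>Existence is the cone computation in every chart. For uniqueness, a stereographic chart
  determines the measure of Borel sets that avoid its pole; a general set splits into its part off
  one pole and its part in that pole, and the latter avoids the opposite pole.\<close>

lemma riemannian_volume_sphere:
  assumes R: "R > 0" and card: "CARD('m::finite) = CARD('n::finite) - 1"
  shows "riemannian_volume TYPE('m) (sphere (0::real^'n) R) = sphere_measure R"
  unfolding riemannian_volume_def
proof (rule the_equality)
  show "space (sphere_measure R) = sphere (0::real^'n) R \<and>
      sets (sphere_measure R) = sets (restrict_space borel (sphere (0::real^'n) R)) \<and>
     (\<forall>U (\<psi> :: real ^ 'm \<Rightarrow> real ^ 'n) B.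
        local_parametrization (sphere 0 R) U \<psi> \<longrightarrow> B \<in> sets borel \<longrightarrow> B \<subseteq> U \<longrightarrow>
        emeasure (sphere_measure R) (\<psi> ` B) = (\<integral>\<^sup>+u\<in>B. ennreal (sqrt (det (metric_matrix \<psi> u))) \<partial>lborel))"
    using emeasure_sphere_measure_parametrization[OF R card] by (simp add: sets_sphere_measure)
next
  fix \<nu> :: "(real^'n) measure"
  assume \<nu>: "space \<nu> = sphere 0 R \<and> sets \<nu> = sets (restrict_space borel (sphere 0 R)) \<and>
     (\<forall>U (\<psi> :: real ^ 'm \<Rightarrow> real ^ 'n) B.
        local_parametrization (sphere 0 R) U \<psi> \<longrightarrow> B \<in> sets borel \<longrightarrow> B \<subseteq> U \<longrightarrow>
        emeasure \<nu> (\<psi> ` B) = (\<integral>\<^sup>+u\<in>B. ennreal (sqrt (det (metric_matrix \<psi> u))) \<partial>lborel))"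
  obtain \<sigma> :: "'m \<Rightarrow> 'n" and k where \<sigma>: "bij_betw \<sigma> UNIV (- {k})"
    using ex_coordinate_split[OF card] by metis
  have chart: "emeasure \<nu> A = emeasure (sphere_measure R) A"
    if A: "A \<in> sets borel" "A \<subseteq> sphere 0 R - {axis k (\<epsilon> * R)}" and \<epsilon>: "\<epsilon> \<in> {1, -1}" for A \<epsilon>
  proof -
    obtain \<psi> :: "real^'m \<Rightarrow> real^'n" where \<psi>: "local_parametrization (sphere 0 R) UNIV \<psi>"
      "\<psi> ` UNIV = sphere 0 R - {axis k (\<epsilon> * R)}"
      using stereographic_parametrization[OF R \<sigma> \<epsilon>] by blast
    have "continuous_on UNIV \<psi>"
      using \<psi>(1) by (simp add: local_parametrization_def smooth_on_imp_continuous_on)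
    then have "\<psi> \<in> borel_measurable borel" by (rule borel_measurable_continuous_onI)
    then have "\<psi> -` A \<in> sets borel" using measurable_sets[of \<psi> borel borel A] A(1) by simp
    moreover have "\<psi> ` (\<psi> -` A) = A" using A(2) \<psi>(2) by auto
    ultimately show ?thesis
      using \<nu> \<psi>(1) emeasure_sphere_measure_parametrization[OF R card \<psi>(1), of "\<psi> -` A"] by fastforce
  qed
  show "\<nu> = sphere_measure R"
  proof (rule measure_eqI)
    fix A assume A: "A \<in> sets \<nu>"
    then have Ab: "A \<in> sets borel" "A \<subseteq> sphere 0 R"
      using \<nu> by (auto simp: sets_restrict_space_iff)
    let ?p = "axis k R :: real^'n"
    have neg: "?p \<noteq> axis k (- R)" using R by (simp add: axis_eq_axis)
    have s: "A - {?p} \<in> sets (restrict_space borel (sphere 0 R))" "A \<inter> {?p} \<in> sets (restrict_space borel (sphere 0 R))"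
      using Ab by (auto simp: sets_restrict_space_iff)
    have un: "(A - {?p}) \<union> (A \<inter> {?p}) = A" "(A - {?p}) \<inter> (A \<inter> {?p}) = {}" by auto
    have "emeasure \<nu> A = emeasure \<nu> (A - {?p}) + emeasure \<nu> (A \<inter> {?p})"
      using plus_emeasure[of "A - {?p}" \<nu> "A \<inter> {?p}"] un s \<nu> by simp
    also have "emeasure \<nu> (A - {?p}) = emeasure (sphere_measure R) (A - {?p})"
      by (rule chart[of _ 1]) (use Ab in auto)
    also have "emeasure \<nu> (A \<inter> {?p}) = emeasure (sphere_measure R) (A \<inter> {?p})"
      by (rule chart[of _ "-1"]) (use Ab neg in auto)
    also have "emeasure (sphere_measure R) (A - {?p}) + emeasure (sphere_measure R) (A \<inter> {?p}) = emeasure (sphere_measure R) A"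
      using plus_emeasure[of "A - {?p}" "sphere_measure R" "A \<inter> {?p}"] un s by (simp add: sets_sphere_measure)
    finally show "emeasure \<nu> A = emeasure (sphere_measure R) A" .
  qed (use \<nu> in \<open>simp add: sets_sphere_measure\<close>)
qed

section \<open>Fourier uniqueness\<close>

lemma
  fixes f :: "'a::euclidean_space \<Rightarrow> real \<Rightarrow> 'b::{real_normed_field,banach,second_countable_topology}"
  assumes f: "\<And>b. b \<in> Basis \<Longrightarrow> integrable lborel (f b)"
  shows integrable_lborel_prod: "integrable lborel (\<lambda>x. \<Prod>b\<in>Basis. f b (x \<bullet> b))"
    and integral_lborel_prod: "(LINT x|lborel. (\<Prod>b\<in>Basis. f b (x \<bullet> b))) = (\<Prod>b\<in>Basis. LINT t|lborel. f b t)"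
proof -
  interpret product_sigma_finite "\<lambda>_::'a. lborel :: real measure" ..
  have [measurable]: "f b \<in> borel_measurable borel" if "b \<in> Basis" for b
    using f[OF that] by (auto dest: borel_measurable_integrable)
  have m: "(\<lambda>p::'a \<Rightarrow> real. \<Sum>b\<in>Basis. p b *\<^sub>R b) \<in> borel_measurable (\<Pi>\<^sub>M b\<in>Basis. lborel)"
    by measurable
  have F: "(\<lambda>x. \<Prod>b\<in>Basis. f b (x \<bullet> b)) \<in> borel_measurable borel" by measurable
  have eq: "(\<Prod>b\<in>Basis. f b ((\<Sum>c\<in>Basis. p c *\<^sub>R c) \<bullet> b)) = (\<Prod>b\<in>Basis. f b (p b))" for p :: "'a \<Rightarrow> real"
    by (intro prod.cong refl) simp
  show "integrable lborel (\<lambda>x. \<Prod>b\<in>Basis. f b (x \<bullet> b))"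
    by (subst lborel_eq, subst integrable_distr_eq[OF m F])
      (unfold eq, rule product_integrable_prod, use f in auto)
  show "(LINT x|lborel. (\<Prod>b\<in>Basis. f b (x \<bullet> b))) = (\<Prod>b\<in>Basis. LINT t|lborel. f b t)"
    by (subst lborel_eq, subst integral_distr[OF m F])
      (unfold eq, rule product_integral_prod, use f in auto)
qed

lemma std_gaussian_prod_Basis: "std_gaussian x = (\<Prod>b\<in>Basis. std_normal_density (x \<bullet> b))"
  by (simp add: std_gaussian_def prod_Basis_vec inner_axis)

lemma continuous_on_std_gaussian: "continuous_on S std_gaussian"
  unfolding std_gaussian_eq_exp[abs_def] by (intro continuous_intros) auto

lemma borel_measurable_std_gaussian [measurable]: "std_gaussian \<in> borel_measurable borel"
  by (intro borel_measurable_continuous_onI continuous_on_std_gaussian)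

lemma integrable_std_normal_exp: "integrable lborel (\<lambda>t. std_normal_density t * exp (c * t))"
proof -
  have "std_normal_density t * exp (c * t) = exp (c\<^sup>2 / 2) * normal_density c 1 t" for t
    unfolding normal_density_def
    by (simp add: exp_add[symmetric] field_simps power2_eq_square)
  then show ?thesis using integrable_normal_density[of 1 c] by simp
qed

text \<open>The norm does not factor over coordinates, but it is at most the sum of their absolute
  values. Hence \<open>exp (c * norm x)\<close> is bounded by the product of
  \<open>exp (c * (x \<bullet> b)) + exp (- c * (x \<bullet> b))\<close>, and the integral of the
  bound factors.\<close>

lemma integrable_std_gaussian_exp: "integrable lborel (\<lambda>x::real^'n. std_gaussian x * exp (c * norm x))"
proof (rule Bochner_Integration.integrable_bound)
  let ?f = "\<lambda>t. std_normal_density t * exp (c * t) + std_normal_density t * exp (- c * t)"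
  show "integrable lborel (\<lambda>x::real^'n. \<Prod>b\<in>Basis. ?f (x \<bullet> b))"
    using integrable_std_normal_exp[of c] integrable_std_normal_exp[of "- c"]
    by (intro integrable_lborel_prod) simp
  have bound: "std_gaussian x * exp (c * norm x) \<le> (\<Prod>b\<in>Basis. ?f (x \<bullet> b))" for x :: "real^'n"
  proof -
    have "c * norm x \<le> \<bar>c\<bar> * (\<Sum>b\<in>Basis. \<bar>x \<bullet> b\<bar>)"
      by (intro mult_mono norm_le_l1) (auto simp: sum_nonneg)
    then have "exp (c * norm x) \<le> (\<Prod>b\<in>Basis. exp (\<bar>c\<bar> * \<bar>x \<bullet> b\<bar>))"
      by (simp add: exp_sum[symmetric] sum_distrib_left)
    also have "\<dots> \<le> (\<Prod>b\<in>Basis. exp (c * (x \<bullet> b)) + exp (- c * (x \<bullet> b)))"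
      by (intro prod_mono) (auto simp: abs_if)
    finally have "std_gaussian x * exp (c * norm x) \<le> std_gaussian x * (\<Prod>b\<in>Basis. exp (c * (x \<bullet> b)) + exp (- c * (x \<bullet> b)))"
      using std_gaussian_pos[of x] by simp
    also have "\<dots> = (\<Prod>b\<in>Basis. ?f (x \<bullet> b))"
      unfolding std_gaussian_prod_Basis by (simp add: prod.distrib[symmetric] algebra_simps)
    finally show ?thesis .
  qed
  show "AE x in lborel. norm (std_gaussian x * exp (c * norm x)) \<le> norm (\<Prod>b\<in>Basis. ?f ((x::real^'n) \<bullet> b))"
  proof (rule AE_I2)
    fix x :: "real^'n"
    have "norm (std_gaussian x * exp (c * norm x)) = std_gaussian x * exp (c * norm x)"
      using std_gaussian_pos[of x] by (simp add: abs_mult)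
    also note bound[of x]
    also have "(\<Prod>b\<in>Basis. ?f (x \<bullet> b)) \<le> norm (\<Prod>b\<in>Basis. ?f (x \<bullet> b))" by simp
    finally show "norm (std_gaussian x * exp (c * norm x)) \<le> norm (\<Prod>b\<in>Basis. ?f (x \<bullet> b))" .
  qed
qed measurable

lemma integrable_std_gaussian: "integrable lborel std_gaussian"
  using integrable_std_gaussian_exp[of 0] by simp

text \<open>The cosine integral is the real part of a product over coordinates whose factors are
  characteristic functions of the standard normal law.\<close>

lemma integral_cos_std_gaussian:
  "(LINT x|lborel. cos (a \<bullet> x) * std_gaussian x) = exp (- (a \<bullet> a) / 2)" for a :: "real^'n"
proof -
  define f where "f = (\<lambda>b::real^'n. \<lambda>t. std_normal_density t *\<^sub>R iexp ((a \<bullet> b) * t))"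
  have m: "(\<lambda>t. iexp (s * t)) \<in> borel_measurable borel" for s :: real
    by (intro borel_measurable_continuous_onI continuous_intros)
  have f_int: "integrable lborel (f b)" for b
  proof (rule Bochner_Integration.integrable_bound)
    show "integrable lborel std_normal_density" by (rule integrable_normal_density) simp
    show "f b \<in> borel_measurable lborel" unfolding f_def using m by measurable
    show "AE t in lborel. norm (f b t) \<le> norm (std_normal_density t)"
      by (rule AE_I2) (simp add: f_def)
  qed
  have f_val: "(LINT t|lborel. f b t) = exp (- (a \<bullet> b)\<^sup>2 / 2)" for b
  proof -
    have "char std_normal_distribution (a \<bullet> b) = (LINT t|lborel. f b t)"
      unfolding char_def f_def by (subst integral_density) (use m in auto)
    then show ?thesis by (simp add: char_std_normal_distribution)
  qed
  have prod: "(\<Prod>b\<in>Basis. f b (x \<bullet> b)) = std_gaussian x *\<^sub>R iexp (a \<bullet> x)" for x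
  proof -
    have "(\<Prod>b\<in>Basis. f b (x \<bullet> b)) = of_real (std_gaussian x) * exp (\<Sum>b\<in>Basis. \<i> * complex_of_real ((a \<bullet> b) * (x \<bullet> b)))"
      unfolding f_def std_gaussian_prod_Basis by (simp add: scaleR_conv_of_real prod.distrib exp_sum)
    also have "(\<Sum>b\<in>Basis. \<i> * complex_of_real ((a \<bullet> b) * (x \<bullet> b))) = \<i> * complex_of_real (a \<bullet> x)"
      unfolding euclidean_inner[of a x] by (simp add: sum_distrib_left)
    finally show ?thesis by (simp add: scaleR_conv_of_real)
  qed
  have int: "integrable lborel (\<lambda>x. std_gaussian x *\<^sub>R iexp (a \<bullet> x))"
    using integrable_lborel_prod[of f] f_int prod by simp
  have "(LINT x|lborel. std_gaussian x *\<^sub>R iexp (a \<bullet> x)) = (\<Prod>b\<in>Basis. exp (- (a \<bullet> b)\<^sup>2 / 2))"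
    using integral_lborel_prod[of f] f_int f_val prod by simp
  also have "\<dots> = of_real (exp (\<Sum>b\<in>Basis. - (a \<bullet> b)\<^sup>2 / 2))" by (simp add: exp_sum)
  also have "(\<Sum>b\<in>Basis. - (a \<bullet> b)\<^sup>2 / 2) = - (a \<bullet> a) / 2"
    unfolding euclidean_inner[of a a] by (simp add: power2_eq_square sum_negf sum_divide_distrib)
  finally have "Re (LINT x|lborel. std_gaussian x *\<^sub>R iexp (a \<bullet> x)) = exp (- (a \<bullet> a) / 2)" by simp
  moreover have "Re (LINT x|lborel. std_gaussian x *\<^sub>R iexp (a \<bullet> x)) = (LINT x|lborel. Re (std_gaussian x *\<^sub>R iexp (a \<bullet> x)))"
    using int by (rule integral_Re[symmetric])
  ultimately show ?thesis by (simp add: mult.commute cis_conv_exp[symmetric])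
qed

text \<open>This justifies the exchanges of integration below, where \<open>k\<close> is a cosine or
  a Gaussian scaled to height 1.\<close>

lemma (in pair_sigma_finite) integrable_mult_bounded:
  fixes f :: "'a \<Rightarrow> real" and g :: "'b \<Rightarrow> real"
  assumes f: "integrable M1 f" and g: "integrable M2 g"
    and k: "k \<in> borel_measurable (M1 \<Otimes>\<^sub>M M2)" "\<And>z. \<bar>k z\<bar> \<le> 1"
  shows "integrable (M1 \<Otimes>\<^sub>M M2) (\<lambda>z. f (fst z) * g (snd z) * k z)"
proof (rule Bochner_Integration.integrable_bound)
  have [measurable]: "f \<in> borel_measurable M1" "g \<in> borel_measurable M2" using f g by auto
  show "integrable (M1 \<Otimes>\<^sub>M M2) (\<lambda>z. f (fst z) * g (snd z))"
  proof (rule Fubini_integrable)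
    show "integrable M1 (\<lambda>x. LINT y|M2. norm (f (fst (x, y)) * g (snd (x, y))))"
      using f by (simp add: abs_mult)
    show "AE x in M1. integrable M2 (\<lambda>y. f (fst (x, y)) * g (snd (x, y)))"
      using g by simp
  qed measurable
  show "(\<lambda>z. f (fst z) * g (snd z) * k z) \<in> borel_measurable (M1 \<Otimes>\<^sub>M M2)" using k(1) by measurable
  show "AE z in M1 \<Otimes>\<^sub>M M2. norm (f (fst z) * g (snd z) * k z) \<le> norm (f (fst z) * g (snd z))"
    using k(2) by (intro AE_I2) (simp add: abs_mult mult_left_le)
qed

text \<open>The Gaussian is the Fourier transform of a Gaussian, so by Fubini the integrals of \<open>u\<close> against all
  Gaussian bumps vanish; as their width tends to 0 the bumps form an approximate identity.\<close>

lemma fourier_zero_imp_gaussian_zero: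
  fixes N :: "(real^'n) measure"
  assumes "finite_measure N" and u: "integrable N u"
    and id: "(\<lambda>x. x) \<in> borel_measurable N"
    and c: "\<And>a. (LINT x|N. u x * cos (a \<bullet> x)) = 0" and s: "\<And>a. (LINT x|N. u x * sin (a \<bullet> x)) = 0"
  shows "(LINT x|N. u x * std_gaussian (r *\<^sub>R (y - x))) = 0"
proof -
  interpret N: finite_measure N by fact
  interpret P: pair_sigma_finite N "lborel :: (real^'n) measure" ..
  note [measurable] = id
  have [measurable]: "u \<in> borel_measurable N" using u by simp
  define F where "F = (\<lambda>x \<xi>. u x * std_gaussian \<xi> * cos ((r *\<^sub>R (y - x)) \<bullet> \<xi>))"
  have "integrable (N \<Otimes>\<^sub>M lborel) (\<lambda>z. u (fst z) * std_gaussian (snd z) * cos ((r *\<^sub>R (y - fst z)) \<bullet> snd z))"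
  proof (rule P.integrable_mult_bounded[OF u integrable_std_gaussian])
    have "(\<lambda>z::(real^'n) \<times> (real^'n). cos ((r *\<^sub>R (y - fst z)) \<bullet> snd z)) \<in> borel_measurable (borel \<Otimes>\<^sub>M borel)"
      unfolding borel_prod by (intro borel_measurable_continuous_onI continuous_intros)
    moreover have "(\<lambda>z. (fst z, snd z)) \<in> N \<Otimes>\<^sub>M lborel \<rightarrow>\<^sub>M (borel \<Otimes>\<^sub>M borel)"
      by (intro measurable_Pair) (use measurable_compose[OF measurable_fst id] in auto)
    ultimately show "(\<lambda>z. cos ((r *\<^sub>R (y - fst z)) \<bullet> snd z)) \<in> borel_measurable (N \<Otimes>\<^sub>M lborel)"
      using measurable_compose by fastforce
  qed auto
  then have F: "integrable (N \<Otimes>\<^sub>M lborel) (case_prod F)" by (simp add: F_def split_beta')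
  have F_zero: "(LINT x|N. F x \<xi>) = 0" for \<xi>
  proof -
    have i: "integrable N (\<lambda>x. u x * cos ((r *\<^sub>R \<xi>) \<bullet> x))" "integrable N (\<lambda>x. u x * sin ((r *\<^sub>R \<xi>) \<bullet> x))"
      by (rule Bochner_Integration.integrable_bound[OF u], measurable, rule AE_I2, simp add: abs_mult mult_left_le)+
    \<comment> \<open>The addition formula separates \<open>x\<close> from \<open>y\<close>, so that
      the vanishing cosine and sine integrals apply at the frequency
      \<open>r *\<^sub>R \<xi>\<close>.\<close>
    have "F x \<xi> = (std_gaussian \<xi> * cos (r * (y \<bullet> \<xi>))) * (u x * cos ((r *\<^sub>R \<xi>) \<bullet> x)) +
        (std_gaussian \<xi> * sin (r * (y \<bullet> \<xi>))) * (u x * sin ((r *\<^sub>R \<xi>) \<bullet> x))" for x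
    proof -
      have "(r *\<^sub>R (y - x)) \<bullet> \<xi> = r * (y \<bullet> \<xi>) - (r *\<^sub>R \<xi>) \<bullet> x"
        by (simp add: inner_diff_left right_diff_distrib inner_commute[of \<xi>])
      then show ?thesis unfolding F_def by (simp only: cos_diff distrib_left mult_ac)
    qed
    then show ?thesis using i c[of "r *\<^sub>R \<xi>"] s[of "r *\<^sub>R \<xi>"] by simp
  qed
  have "(LINT x|N. u x * exp (- ((r *\<^sub>R (y - x)) \<bullet> (r *\<^sub>R (y - x))) / 2)) = (LINT x|N. LINT \<xi>|lborel. F x \<xi>)"
    unfolding integral_cos_std_gaussian[symmetric] F_def by (simp add: mult.assoc mult.commute[of "cos _"])
  also have "\<dots> = (LINT \<xi>|lborel. LINT x|N. F x \<xi>)" using P.Fubini_integral[OF F] by simp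
  finally have z: "(LINT x|N. u x * exp (- ((r *\<^sub>R (y - x)) \<bullet> (r *\<^sub>R (y - x))) / 2)) = 0"
    by (simp add: F_zero)
  have "(LINT x|N. u x * std_gaussian (r *\<^sub>R (y - x))) = (LINT x|N. (1 / sqrt (2 * pi)) ^ CARD('n) * (u x * exp (- ((r *\<^sub>R (y - x)) \<bullet> (r *\<^sub>R (y - x))) / 2)))"
    unfolding std_gaussian_eq_exp by (simp only: mult.left_commute)
  then show ?thesis by (simp only: integral_mult_right_zero z mult_zero_right)
qed

text \<open>\<open>J k\<close> is the convolution of \<open>g\<close> with a Gaussian of width
  \<open>1 / (k + 1)\<close>. Written as a superposition of bumps with weights \<open>g y\<close> it
  integrates to 0 against \<open>u\<close> by Fubini; written as an average of translates of
  \<open>g\<close> it is bounded by 1 and converges to \<open>g\<close>.\<close>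

lemma fourier_zero_imp_integral_zero:
  fixes N :: "(real^'n) measure"
  assumes fin: "finite_measure N" and u: "integrable N u"
    and id: "(\<lambda>x. x) \<in> borel_measurable N"
    and c: "\<And>a. (LINT x|N. u x * cos (a \<bullet> x)) = 0" and s: "\<And>a. (LINT x|N. u x * sin (a \<bullet> x)) = 0"
    and g: "continuous_on UNIV g" "integrable lborel g" "\<And>x. \<bar>g x\<bar> \<le> 1"
  shows "(LINT x|N. u x * g x) = 0"
proof -
  interpret N: finite_measure N by fact
  interpret P: pair_sigma_finite N "lborel :: (real^'n) measure" ..
  note [measurable] = id
  have [measurable]: "u \<in> borel_measurable N" using u by simp
  have [measurable]: "g \<in> borel_measurable borel" using g(1) by (rule borel_measurable_continuous_onI)
  define J where "J = (\<lambda>k x. LINT z|lborel. g (x + (1 / real (Suc k)) *\<^sub>R z) * std_gaussian z)"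
  have J_zero: "(LINT x|N. u x * J k x) = 0" for k
  proof -
    define r where "r = real (Suc k)"
    have r: "r > 0" by (simp add: r_def)
    \<comment> \<open>The constant scales the Gaussian to height 1, the bound that
      \<open>integrable_mult_bounded\<close> asks for.\<close>
    define F where "F = (\<lambda>x y. u x * g y * (sqrt (2 * pi) ^ CARD('n) * std_gaussian (r *\<^sub>R (y - x))))"
    have "integrable (N \<Otimes>\<^sub>M lborel) (\<lambda>z. u (fst z) * g (snd z) * exp (- ((r *\<^sub>R (snd z - fst z)) \<bullet> (r *\<^sub>R (snd z - fst z))) / 2))"
    proof (rule P.integrable_mult_bounded[OF u g(2)])
      have "(\<lambda>z::(real^'n) \<times> (real^'n). exp (- ((r *\<^sub>R (snd z - fst z)) \<bullet> (r *\<^sub>R (snd z - fst z))) / 2)) \<in> borel_measurable (borel \<Otimes>\<^sub>M borel)"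
        unfolding borel_prod by (intro borel_measurable_continuous_onI continuous_intros) auto
      moreover have "(\<lambda>z. (fst z, snd z)) \<in> N \<Otimes>\<^sub>M lborel \<rightarrow>\<^sub>M (borel \<Otimes>\<^sub>M borel)"
        by (intro measurable_Pair) (use measurable_compose[OF measurable_fst id] in auto)
      ultimately show "(\<lambda>z. exp (- ((r *\<^sub>R (snd z - fst z)) \<bullet> (r *\<^sub>R (snd z - fst z))) / 2)) \<in> borel_measurable (N \<Otimes>\<^sub>M lborel)"
        using measurable_compose by fastforce
    qed (simp del: inner_scaleR_left inner_scaleR_right)
    then have F: "integrable (N \<Otimes>\<^sub>M lborel) (case_prod F)"
      by (simp add: F_def split_beta' std_gaussian_eq_exp power_divide)
    \<comment> \<open>Substitution of \<open>y = x + z / r\<close>.\<close>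
    have J: "J k x = r ^ CARD('n) * (LINT y|lborel. g y * std_gaussian (r *\<^sub>R (y - x)))" for x
    proof -
      have "(LINT y|lborel. g y * std_gaussian (r *\<^sub>R (y - x))) =
        (LINT y|density (distr lborel borel (\<lambda>z. x + (1 / r) *\<^sub>R z)) (\<lambda>_. \<bar>1 / r\<bar>^DIM(real^'n)). g y * std_gaussian (r *\<^sub>R (y - x)))"
        using r by (subst lborel_affine[of "1 / r" x]) auto
      also have "\<dots> = (LINT y|distr lborel borel (\<lambda>z. x + (1 / r) *\<^sub>R z). (1 / r) ^ CARD('n) * (g y * std_gaussian (r *\<^sub>R (y - x))))"
        using r by (subst integral_density) auto
      also have "\<dots> = (LINT z|lborel. (1 / r) ^ CARD('n) * (g (x + (1 / r) *\<^sub>R z) * std_gaussian z))"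
        using r by (subst integral_distr) auto
      also have "\<dots> = (1 / r) ^ CARD('n) * J k x" by (simp add: J_def r_def)
      finally show ?thesis using r by (simp add: power_divide)
    qed
    have F_zero: "(LINT x|N. F x y) = 0" for y
    proof -
      have "(LINT x|N. F x y) = (LINT x|N. (g y * sqrt (2 * pi) ^ CARD('n)) * (u x * std_gaussian (r *\<^sub>R (y - x))))"
        unfolding F_def by (simp only: mult_ac)
      then show ?thesis
        by (simp only: integral_mult_right_zero fourier_zero_imp_gaussian_zero[OF fin u id c s] mult_zero_right)
    qed
    have "u x * J k x = (r / sqrt (2 * pi)) ^ CARD('n) * (LINT y|lborel. F x y)" for x
    proof -
      have "(LINT y|lborel. F x y) = (LINT y|lborel. (u x * sqrt (2 * pi) ^ CARD('n)) * (g y * std_gaussian (r *\<^sub>R (y - x))))"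
        unfolding F_def by (simp only: mult_ac)
      also have "\<dots> = (u x * sqrt (2 * pi) ^ CARD('n)) * (LINT y|lborel. g y * std_gaussian (r *\<^sub>R (y - x)))"
        by (rule integral_mult_right_zero)
      finally show ?thesis by (simp add: J power_divide)
    qed
    then have "(LINT x|N. u x * J k x) = (r / sqrt (2 * pi)) ^ CARD('n) * (LINT x|N. LINT y|lborel. F x y)"
      by simp
    also have "(LINT x|N. LINT y|lborel. F x y) = (LINT y|lborel. LINT x|N. F x y)"
      using P.Fubini_integral[OF F] by simp
    finally show ?thesis by (simp add: F_zero)
  qed
  have tot: "(LINT z|lborel. std_gaussian (z::real^'n)) = 1"
    using integral_cos_std_gaussian[of 0] by simp
  have gb: "\<bar>g w * std_gaussian z\<bar> \<le> std_gaussian z" for w z :: "real^'n"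
    using mult_right_mono[OF g(3)[of w] less_imp_le[OF std_gaussian_pos[of z]]] std_gaussian_pos[of z]
    by (simp add: abs_mult)
  have J_bound: "\<bar>J k x\<bar> \<le> 1" for k x
  proof -
    have "\<bar>J k x\<bar> \<le> (LINT z|lborel. \<bar>g (x + (1 / real (Suc k)) *\<^sub>R z) * std_gaussian z\<bar>)"
      unfolding J_def by (rule integral_abs_bound)
    also have "\<dots> \<le> (LINT z|lborel. std_gaussian (z::real^'n))"
      by (rule integral_mono'[OF integrable_std_gaussian])
        (use gb in \<open>auto simp: less_imp_le[OF std_gaussian_pos]\<close>)
    finally show ?thesis using tot by simp
  qed
  have J_lim: "(\<lambda>k. J k x) \<longlonglongrightarrow> g x" for x
  proof -
    have "(\<lambda>k. J k x) \<longlonglongrightarrow> (LINT z|lborel. g x * std_gaussian (z::real^'n))"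
      unfolding J_def
    proof (rule integral_dominated_convergence[where w="std_gaussian :: real^'n \<Rightarrow> real"])
      show "AE z in lborel. (\<lambda>k. g (x + (1 / real (Suc k)) *\<^sub>R z) * std_gaussian z) \<longlonglongrightarrow> g x * std_gaussian z"
      proof (rule AE_I2)
        fix z :: "real^'n"
        have "(\<lambda>k. x + (1 / real (Suc k)) *\<^sub>R z) \<longlonglongrightarrow> x + 0 *\<^sub>R z"
          by (intro tendsto_intros LIMSEQ_inverse_real_of_nat[unfolded inverse_eq_divide])
        moreover have "isCont g x" using g(1) by (simp add: continuous_on_eq_continuous_at)
        ultimately have "(\<lambda>k. g (x + (1 / real (Suc k)) *\<^sub>R z)) \<longlonglongrightarrow> g x"
          by (intro isCont_tendsto_compose[of x g]) simp_all
        then show "(\<lambda>k. g (x + (1 / real (Suc k)) *\<^sub>R z) * std_gaussian z) \<longlonglongrightarrow> g x * std_gaussian z"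
          by (intro tendsto_intros)
      qed
      show "AE z in lborel. norm (g (x + (1 / real (Suc k)) *\<^sub>R z) * std_gaussian z) \<le> std_gaussian z" for k
        using gb by (intro AE_I2) simp
    qed (use integrable_std_gaussian in auto)
    then show ?thesis using tot by simp
  qed
  have Jm: "J k \<in> borel_measurable borel" for k
    unfolding J_def by (intro lborel.borel_measurable_lebesgue_integral) measurable
  have [measurable]: "J k \<in> borel_measurable N" for k
    using measurable_compose[OF id Jm[of k]] by simp
  have [measurable]: "g \<in> borel_measurable N"
    using measurable_compose[OF id, of g borel] by simp
  have "(\<lambda>k. LINT x|N. u x * J k x) \<longlonglongrightarrow> (LINT x|N. u x * g x)"
  proof (rule integral_dominated_convergence[where w="\<lambda>x. \<bar>u x\<bar>"])
    show "AE x in N. norm (u x * J k x) \<le> \<bar>u x\<bar>" for k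
      using J_bound by (intro AE_I2) (simp add: abs_mult mult_left_le)
    show "AE x in N. (\<lambda>k. u x * J k x) \<longlonglongrightarrow> u x * g x"
      using J_lim by (intro AE_I2 tendsto_intros)
  qed (use u in auto)
  then show ?thesis unfolding J_zero by (simp add: LIMSEQ_const_iff)
qed

text \<open>Continuous functions approximate indicators of boxes, so \<open>u\<close> integrates to
  0 over every box. The finite measures whose densities are the positive and the negative part of
  \<open>u\<close> then agree on a generator stable under intersection, hence everywhere, and so do
  the densities.\<close>

lemma fourier_zero_imp_AE_zero:
  fixes N :: "(real^'n) measure"
  assumes fin: "finite_measure N" and u: "integrable N u"
    and sets: "sets N = sets (restrict_space borel M)" and M: "M \<in> sets borel"
    and c: "\<And>a. (LINT x|N. u x * cos (a \<bullet> x)) = 0" and s: "\<And>a. (LINT x|N. u x * sin (a \<bullet> x)) = 0"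
  shows "AE x in N. u x = 0"
proof -
  interpret N: finite_measure N by fact
  have id[measurable]: "(\<lambda>x. x) \<in> borel_measurable N"
    unfolding measurable_cong_sets[OF sets refl] by (rule measurable_restrict_space1) simp
  have um[measurable]: "u \<in> borel_measurable N" using u by simp
  have box_zero: "(LINT x|N. u x * indicator (box l r) x) = 0" for l r
  proof -
    define O' where "O' = box l r"
    have ne: "- O' \<noteq> {}" unfolding O'_def using bounded_box[of l r] not_bounded_UNIV[where 'a="real^'n"]
      by (metis compl_bot_eq double_compl)
    have cl: "closed (- O')" by (simp add: O'_def open_box closed_Compl)
    \<comment> \<open>Continuous functions that vanish off the open box and equal 1 wherever
      \<open>k\<close> times the distance to the complement is at least 1; they increase to the
      indicator.\<close>
    define g where "g = (\<lambda>k::nat. \<lambda>x. min 1 (real k * infdist x (- O')))"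
    have g: "continuous_on UNIV (g k)" "0 \<le> g k x" "g k x \<le> 1" "x \<notin> O' \<Longrightarrow> g k x = 0" for k x
      by (auto simp: g_def infdist_nonneg intro!: continuous_intros)
    have [measurable]: "g k \<in> borel_measurable borel" for k using g(1) by (rule borel_measurable_continuous_onI)
    have gi: "integrable lborel (g k)" for k
    proof (rule Bochner_Integration.integrable_bound)
      show "integrable lborel (indicator O' :: _ \<Rightarrow> real)"
        using emeasure_bounded_finite[OF bounded_box, of l r]
        by (intro integrable_real_indicator) (simp_all add: O'_def)
      show "AE x in lborel. norm (g k x) \<le> norm (indicator O' x :: real)"
        using g by (intro AE_I2) (auto simp: indicator_def)
    qed simp
    have lim: "(\<lambda>k. g k x) \<longlonglongrightarrow> indicator O' x" for x
    proof (cases "x \<in> O'")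
      case True
      then have pos: "infdist x (- O') > 0"
        using infdist_pos_not_in_closed[OF cl ne, of x] by simp
      obtain K :: nat where K: "1 / infdist x (- O') \<le> real K" using real_arch_simple by blast
      have "g k x = 1" if "k \<ge> K" for k
      proof -
        have "1 / infdist x (- O') \<le> real k" using K that by linarith
        then have "1 \<le> real k * infdist x (- O')" using pos by (simp add: field_simps)
        then show ?thesis by (simp add: g_def)
      qed
      then show ?thesis using True by (intro tendsto_eventually) (auto simp: eventually_sequentially)
    next
      case False then show ?thesis using g(4) by simp
    qed
    have [measurable]: "g k \<in> borel_measurable N" for k
      using measurable_compose[OF id, of "g k" borel] by simp
    have [measurable]: "indicator O' \<in> borel_measurable N"
      using measurable_compose[OF id, of "indicator O'" borel] by (simp add: O'_def)
    have "(\<lambda>k. LINT x|N. u x * g k x) \<longlonglongrightarrow> (LINT x|N. u x * indicator O' x)"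
    proof (rule integral_dominated_convergence[where w="\<lambda>x. \<bar>u x\<bar>"])
      show "AE x in N. norm (u x * g k x) \<le> \<bar>u x\<bar>" for k
        using g by (intro AE_I2) (simp add: abs_mult mult_left_le)
      show "AE x in N. (\<lambda>k. u x * g k x) \<longlonglongrightarrow> u x * indicator O' x"
        using lim by (intro AE_I2 tendsto_intros)
    qed (use u in auto)
    moreover have "(LINT x|N. u x * g k x) = 0" for k
      by (rule fourier_zero_imp_integral_zero[OF fin u id c s g(1) gi]) (use g in \<open>simp add: abs_of_nonneg\<close>)
    ultimately show ?thesis by (simp add: LIMSEQ_const_iff O'_def)
  qed
  \<comment> \<open>The measure is carried from \<open>M\<close> to the whole space, where boxes
    generate the sigma-algebra.\<close>
  define D where "D = (\<lambda>v::real^'n \<Rightarrow> real. distr (density N (\<lambda>x. ennreal (v x))) borel (\<lambda>x. x))"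
  have D: "emeasure (D v) B = ennreal (LINT x|N. v x * indicator B x)"
    if v: "integrable N v" "\<And>x. v x \<ge> 0" and B: "B \<in> sets borel" for v B
  proof -
    have [measurable]: "v \<in> borel_measurable N" using v(1) by simp
    have Bm: "indicator B \<in> borel_measurable N"
      using measurable_compose[OF id, of "indicator B :: _ \<Rightarrow> real" borel] B by simp
    have "(\<lambda>x. x) -` B \<inter> space N \<in> sets N" using measurable_sets[OF id B] .
    then have "emeasure (D v) B = (\<integral>\<^sup>+x. ennreal (v x) * indicator ((\<lambda>x. x) -` B \<inter> space N) x \<partial>N)"
      using B unfolding D_def by (subst emeasure_distr) (auto simp: emeasure_density)
    also have "\<dots> = (\<integral>\<^sup>+x. ennreal (v x * indicator B x) \<partial>N)"
      by (intro nn_integral_cong) (auto simp: indicator_def)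
    also have "\<dots> = ennreal (LINT x|N. v x * indicator B x)"
    proof (rule nn_integral_eq_integral)
      have "(\<lambda>x. v x * indicator B x) \<in> borel_measurable N" using Bm by measurable
      then show "integrable N (\<lambda>x. v x * indicator B x)"
        by (rule Bochner_Integration.integrable_bound[OF v(1)]) (auto simp: indicator_def)
    qed (use v in auto)
    finally show ?thesis .
  qed
  let ?p = "\<lambda>x. max 0 (u x)" and ?m = "\<lambda>x. max 0 (- u x)"
  have pi: "integrable N ?p" "integrable N ?m" using u by auto
  have "D ?p = D ?m"
  proof (rule measure_eqI_generator_eq)
    let ?E = "range (\<lambda>(a, b). box a b::(real^'n) set)"
    show "Int_stable ?E" by (auto simp: Int_stable_def box_Int_box)
    show "?E \<subseteq> Pow UNIV" "sets (D ?p) = sigma_sets UNIV ?E" "sets (D ?m) = sigma_sets UNIV ?E"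
      by (simp_all add: borel_eq_box D_def)
    show "range (\<lambda>k::nat. box (- (real k *\<^sub>R One)) (real k *\<^sub>R One)) \<subseteq> ?E" by auto
    show "(\<Union>k::nat. box (- (real k *\<^sub>R One)) (real k *\<^sub>R One)) = (UNIV :: (real^'n) set)"
      by (rule UN_box_eq_UNIV)
    show "emeasure (D ?p) (box (- (real k *\<^sub>R One)) (real k *\<^sub>R One)) \<noteq> \<infinity>" for k
      by (subst D[OF pi(1)]) auto
    fix X assume "X \<in> ?E"
    then obtain l r where X: "X = box l r" by auto
    have Bm[measurable]: "indicator (box l r) \<in> borel_measurable N"
      using measurable_compose[OF id, of "indicator (box l r) :: _ \<Rightarrow> real" borel] by simp
    have i: "integrable N (\<lambda>x. v x * indicator (box l r) x)" if v: "integrable N v" for v :: "real^'n \<Rightarrow> real"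
    proof -
      have "(\<lambda>x. v x * indicator (box l r) x) \<in> borel_measurable N"
        using Bm borel_measurable_integrable[OF v] by measurable
      then show ?thesis
        by (rule Bochner_Integration.integrable_bound[OF v]) (auto simp: indicator_def)
    qed
    have "(LINT x|N. ?p x * indicator (box l r) x) - (LINT x|N. ?m x * indicator (box l r) x) =
        (LINT x|N. ?p x * indicator (box l r) x - ?m x * indicator (box l r) x)"
      by (rule Bochner_Integration.integral_diff[OF i[OF pi(1)] i[OF pi(2)], symmetric])
    also have "\<dots> = (LINT x|N. u x * indicator (box l r) x)"
      by (intro Bochner_Integration.integral_cong) (auto simp: indicator_def)
    finally show "emeasure (D ?p) X = emeasure (D ?m) X"
      unfolding X using box_zero by (simp add: D pi)
  qed
  have "density N (\<lambda>x. ennreal (?p x)) = density N (\<lambda>x. ennreal (?m x))"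
  proof (rule measure_eqI)
    fix A assume "A \<in> sets (density N (\<lambda>x. ennreal (?p x)))"
    then have A: "A \<in> sets N" "A \<in> sets borel" "A \<subseteq> space N"
      using M sets sets.sets_into_space[of A N] by (auto simp: sets_restrict_space_iff)
    have "emeasure (D v) A = emeasure (density N (\<lambda>x. ennreal (v x))) A" for v
      unfolding D_def using A by (subst emeasure_distr) (auto simp: Int_absorb2)
    then show "emeasure (density N (\<lambda>x. ennreal (?p x))) A = emeasure (density N (\<lambda>x. ennreal (?m x))) A"
      using \<open>D ?p = D ?m\<close> by metis
  qed simp
  moreover have "(\<integral>\<^sup>+x. ennreal (?p x) \<partial>N) \<noteq> \<infinity>" 
    using nn_integral_eq_integral[OF pi(1)] by simp
  ultimately have "AE x in N. ennreal (?p x) = ennreal (?m x)"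
    by (intro finite_density_unique[THEN iffD1]) auto
  then show ?thesis by eventually_elim (auto simp: max_def split: if_splits)
qed

section \<open>Moments\<close>

lemma exp_partial_sum_le:
  fixes t :: real
  assumes "0 \<le> t" shows "(\<Sum>n<k. t ^ n / fact n) \<le> exp t"
proof -
  have S: "(\<lambda>n. t ^ n / fact n) sums exp t"
    using exp_converges[of t] by (simp add: divide_inverse mult.commute)
  show ?thesis
    unfolding sums_unique[OF S] by (rule sum_le_suminf[OF sums_summable[OF S]]) (use assms in auto)
qed

lemma power_le_exp: "0 \<le> t \<Longrightarrow> t ^ k / fact k \<le> exp t" for t :: real
  using exp_partial_sum_le[of t "Suc k"] sum_nonneg[of "{..<k}" "\<lambda>n. t ^ n / fact n"] by simp

text \<open>The bound is independent of \<open>k\<close> and supplies the dominating function when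
  the sine and cosine series are integrated termwise.\<close>

lemma trig_partial_sum_bound:
  fixes c :: "nat \<Rightarrow> real"
  assumes "\<And>n. \<bar>c n\<bar> \<le> 1 / fact n"
  shows "\<bar>\<Sum>n<k. c n * t ^ n\<bar> \<le> exp \<bar>t\<bar>"
proof -
  have "\<bar>\<Sum>n<k. c n * t ^ n\<bar> \<le> (\<Sum>n<k. \<bar>t\<bar> ^ n / fact n)"
  proof (rule order_trans[OF sum_abs], rule sum_mono)
    fix n
    show "\<bar>c n * t ^ n\<bar> \<le> \<bar>t\<bar> ^ n / fact n"
      using mult_right_mono[OF assms[of n], of "\<bar>t\<bar> ^ n"] by (simp add: abs_mult power_abs)
  qed
  also have "\<dots> \<le> exp \<bar>t\<bar>"
    by (rule exp_partial_sum_le) simp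
  finally show ?thesis .
qed

lemma integrable_square_prod:
  fixes f g :: "'a \<Rightarrow> real"
  assumes [measurable]: "f \<in> borel_measurable N" "g \<in> borel_measurable N"
    and "integrable N (\<lambda>x. (f x)\<^sup>2)" "integrable N (\<lambda>x. (g x)\<^sup>2)"
  shows "integrable N (\<lambda>x. f x * g x)"
proof (rule Bochner_Integration.integrable_bound)
  show "integrable N (\<lambda>x. (f x)\<^sup>2 + (g x)\<^sup>2)" using assms by simp
  have "\<bar>f x * g x\<bar> \<le> (f x)\<^sup>2 + (g x)\<^sup>2" for x
    using sum_squares_bound[of "\<bar>f x\<bar>" "\<bar>g x\<bar>"] mult_nonneg_nonneg[OF abs_ge_zero[of "f x"] abs_ge_zero[of "g x"]]
    unfolding abs_mult power2_abs by linarith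
  then show "AE x in N. norm (f x * g x) \<le> norm ((f x)\<^sup>2 + (g x)\<^sup>2)"
    by (intro AE_I2) simp
qed measurable

lemma abs_cos_coeff_le: "\<bar>cos_coeff n\<bar> \<le> 1 / fact n" and abs_sin_coeff_le: "\<bar>sin_coeff n\<bar> \<le> 1 / fact n"
  by (auto simp: cos_coeff_def sin_coeff_def)

text \<open>Exponential moments of every order make polynomials square integrable and let the
  moments of a square integrable \<open>u\<close> determine its Fourier transform. The Gaussian has
  them by decay, a finite measure on a sphere by boundedness.\<close>

locale exp_integrable_measure =
  fixes N :: "(real^'n) measure" and M :: "(real^'n) set"
  assumes M: "M \<in> sets borel" and sets_N: "sets N = sets (restrict_space borel M)"
    and exp_int: "\<And>c. integrable N (\<lambda>x. exp (c * norm x))"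
begin

lemma id_measurable [measurable]: "(\<lambda>x. x) \<in> borel_measurable N"
  unfolding measurable_cong_sets[OF sets_N refl] by (rule measurable_restrict_space1) simp

lemma borel_measurable_N: "f \<in> borel_measurable borel \<Longrightarrow> f \<in> borel_measurable N"
  using measurable_compose[OF id_measurable] by simp

lemma finite_measure_N: "finite_measure N"
  using integrable_iff_bounded[of N "\<lambda>x. 1::real"] exp_int[of 0]
  by (intro finite_measureI) auto

lemma integrable_exp_bounded:
  assumes "f \<in> borel_measurable N" "\<And>x. \<bar>f x\<bar> \<le> C * exp (c * norm x)"
  shows "integrable N f"
proof (rule Bochner_Integration.integrable_bound)
  show "integrable N (\<lambda>x. C * exp (c * norm x))" using exp_int by simp
  show "AE x in N. norm (f x) \<le> norm (C * exp (c * norm x))"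
    using assms(2) by (intro AE_I2) (metis abs_ge_self order_trans real_norm_def)
qed (rule assms(1))

lemma integrable_square_exp_bounded:
  assumes "f \<in> borel_measurable N" "\<And>x. \<bar>f x\<bar> \<le> C * exp (c * norm x)"
  shows "integrable N (\<lambda>x. (f x)\<^sup>2)"
proof (rule integrable_exp_bounded)
  show "(\<lambda>x. (f x)\<^sup>2) \<in> borel_measurable N" using assms(1) by measurable
  show "\<bar>(f x)\<^sup>2\<bar> \<le> C\<^sup>2 * exp (2 * c * norm x)" for x
  proof -
    have "(f x)\<^sup>2 \<le> (C * exp (c * norm x))\<^sup>2"
      using assms(2)[of x] by (metis abs_ge_zero power2_abs power_mono)
    also have "\<dots> = C\<^sup>2 * exp (2 * c * norm x)"
      by (simp add: power_mult_distrib exp_double[symmetric] mult_ac power2_eq_square exp_add[symmetric])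
    finally show ?thesis by simp
  qed
qed

lemma linear_power_bound: "\<bar>(a \<bullet> x) ^ k\<bar> \<le> fact k * exp (norm a * norm x)"
proof -
  have "\<bar>(a \<bullet> x) ^ k\<bar> \<le> (norm a * norm x) ^ k"
    unfolding power_abs by (intro power_mono Cauchy_Schwarz_ineq2) simp
  also have "\<dots> \<le> fact k * exp (norm a * norm x)"
    using power_le_exp[of "norm a * norm x" k] by (simp add: field_simps)
  finally show ?thesis .
qed

lemma linear_power_measurable [measurable]: "(\<lambda>x. (a \<bullet> x) ^ k) \<in> borel_measurable N"
  by (rule borel_measurable_N) measurable

lemma integrable_linear_power:
  assumes u: "u \<in> borel_measurable N" "integrable N (\<lambda>x. (u x)\<^sup>2)"
  shows "integrable N (\<lambda>x. u x * (a \<bullet> x) ^ k)"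
  by (rule integrable_square_prod[OF u(1) _ u(2)])
    (auto intro!: integrable_square_exp_bounded linear_power_bound)

text \<open>A power series in \<open>a \<bullet> x\<close> with coefficients no larger than those of
  the exponential is integrated termwise. All partial sums are dominated by
  \<open>\<bar>u x\<bar> * exp \<bar>a \<bullet> x\<bar>\<close>, a product of square integrable
  functions.\<close>

lemma integral_trig_zero:
  assumes u: "u \<in> borel_measurable N" "integrable N (\<lambda>x. (u x)\<^sup>2)"
    and mom: "\<And>k. (LINT x|N. u x * (a \<bullet> x) ^ k) = 0"
    and c: "\<And>n. \<bar>c n\<bar> \<le> 1 / fact n" "\<And>t. (\<lambda>n. c n * t ^ n) sums f t" and f: "f \<in> borel_measurable borel"
  shows "(LINT x|N. u x * f (a \<bullet> x)) = 0"
proof -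
  note [measurable] = u(1)
  have [measurable]: "(\<lambda>x. f (a \<bullet> x)) \<in> borel_measurable N"
    by (intro borel_measurable_N measurable_compose[OF _ f]) measurable
  have e[measurable]: "(\<lambda>x. exp \<bar>a \<bullet> x\<bar>) \<in> borel_measurable N"
    by (rule borel_measurable_N) measurable
  have "(\<lambda>k. LINT x|N. u x * (\<Sum>n<k. c n * (a \<bullet> x) ^ n)) \<longlonglongrightarrow> (LINT x|N. u x * f (a \<bullet> x))"
  proof (rule integral_dominated_convergence[where w="\<lambda>x. \<bar>u x\<bar> * exp \<bar>a \<bullet> x\<bar>"])
    show "integrable N (\<lambda>x. \<bar>u x\<bar> * exp \<bar>a \<bullet> x\<bar>)"
    proof (rule integrable_square_prod)
      show "integrable N (\<lambda>x. (exp \<bar>a \<bullet> x\<bar>)\<^sup>2)"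
        by (rule integrable_square_exp_bounded[where C=1 and c="norm a"]) (auto intro: Cauchy_Schwarz_ineq2)
    qed (use u e in auto)
    show "AE x in N. norm (u x * (\<Sum>n<k. c n * (a \<bullet> x) ^ n)) \<le> \<bar>u x\<bar> * exp \<bar>a \<bullet> x\<bar>" for k
      using trig_partial_sum_bound[OF c(1)] by (intro AE_I2) (simp add: abs_mult mult_left_mono)
    show "AE x in N. (\<lambda>k. u x * (\<Sum>n<k. c n * (a \<bullet> x) ^ n)) \<longlonglongrightarrow> u x * f (a \<bullet> x)"
      using c(2) by (intro AE_I2 tendsto_intros) (simp add: sums_def)
  qed measurable
  moreover have "(LINT x|N. u x * (\<Sum>n<k. c n * (a \<bullet> x) ^ n)) = 0" for k
  proof -
    have "(LINT x|N. u x * (\<Sum>n<k. c n * (a \<bullet> x) ^ n)) = (LINT x|N. (\<Sum>n<k. c n * (u x * (a \<bullet> x) ^ n)))"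
      by (simp add: sum_distrib_left mult_ac)
    also have "\<dots> = (\<Sum>n<k. (LINT x|N. c n * (u x * (a \<bullet> x) ^ n)))"
      using integrable_linear_power[OF u] by (intro Bochner_Integration.integral_sum) simp
    also have "\<dots> = 0" using mom by simp
    finally show ?thesis .
  qed
  ultimately show ?thesis by (simp add: LIMSEQ_const_iff)
qed

lemma moments_zero_imp_AE_zero:
  assumes u: "u \<in> borel_measurable N" "integrable N (\<lambda>x. (u x)\<^sup>2)"
    and mom: "\<And>a k. (LINT x|N. u x * (a \<bullet> x) ^ k) = 0"
  shows "AE x in N. u x = 0"
proof (rule fourier_zero_imp_AE_zero[OF finite_measure_N _ sets_N M])
  show "integrable N u" using integrable_linear_power[OF u, of 0 0] by simp
  show "(LINT x|N. u x * cos (a \<bullet> x)) = 0" for a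
    by (rule integral_trig_zero[OF u mom, of cos_coeff cos])
      (use cos_converges[where 'a=real, unfolded real_scaleR_def] in \<open>simp_all add: abs_cos_coeff_le\<close>)
  show "(LINT x|N. u x * sin (a \<bullet> x)) = 0" for a
    by (rule integral_trig_zero[OF u mom, of sin_coeff sin])
      (use sin_converges[where 'a=real, unfolded real_scaleR_def] in \<open>simp_all add: abs_sin_coeff_le\<close>)
qed

text \<open>Strong induction on the degree: where \<open>lam k\<close> differs from
  \<open>l\<close>, the recursion reduces a moment to one of degree two less. \<open>res\<close>
  supplies the resonant degrees, where the recursion does not determine the moment.\<close>

lemma moment_recursion_imp_AE_zero:
  assumes u: "u \<in> borel_measurable N" "integrable N (\<lambda>x. (u x)\<^sup>2)"
    and rec: "\<And>a k. (lam k - l) * (LINT x|N. u x * (a \<bullet> x) ^ k) =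
      real (k * (k - 1)) * (a \<bullet> a) * (LINT x|N. u x * (a \<bullet> x) ^ (k - 2))"
    and res: "\<And>a k. lam k = l \<Longrightarrow> (LINT x|N. u x * (a \<bullet> x) ^ k) = 0"
  shows "AE x in N. u x = 0"
proof (rule moments_zero_imp_AE_zero[OF u])
  show "(LINT x|N. u x * (a \<bullet> x) ^ k) = 0" for a k
  proof (induction k rule: less_induct)
    case (less k)
    show ?case
    proof (cases "k < 2")
      case True
      \<comment> \<open>Below degree two the truncated exponent \<open>k - 2\<close> is harmless,
        since its coefficient vanishes.\<close>
      then have "k * (k - 1) = 0" by (auto simp: less_2_cases_iff)
      then show ?thesis using rec[of k a] res[of k a] by auto
    next
      case False
      then have "(LINT x|N. u x * (a \<bullet> x) ^ (k - 2)) = 0" by (intro less) auto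
      then show ?thesis using rec[of k a] res[of k a] by auto
    qed
  qed
qed

text \<open>\<open>B\<close> is the Gram operator of the linear forms. By \<open>pos\<close> it is
  injective, hence surjective in finite dimension, and \<open>a\<close> solves the normal equations
  of the orthogonal projection.\<close>

lemma linear_projection_exists:
  assumes u: "u \<in> borel_measurable N" "integrable N (\<lambda>x. (u x)\<^sup>2)"
    and pos: "\<And>a. AE x in N. a \<bullet> x = 0 \<Longrightarrow> a = 0"
  shows "\<exists>a. \<forall>b. (LINT x|N. (u x - a \<bullet> x) * (b \<bullet> x)) = 0"
proof -
  have m[measurable]: "(\<lambda>x. a \<bullet> x) \<in> borel_measurable N" for a
    using linear_power_measurable[of a 1] by simp
  have sq: "integrable N (\<lambda>x. (a \<bullet> x)\<^sup>2)" for a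
    using integrable_square_exp_bounded[OF linear_power_measurable linear_power_bound, of a 1] by simp
  have iu: "integrable N (\<lambda>x. u x * (b \<bullet> x))" for b
    using integrable_linear_power[OF u, of b 1] by simp
  have ia: "integrable N (\<lambda>x. (a \<bullet> x) * (b \<bullet> x))" for a b
    using integrable_linear_power[OF m sq, of a b 1] by simp
  define B where "B = (\<lambda>a. \<Sum>i\<in>Basis. (LINT x|N. (a \<bullet> x) * (i \<bullet> x)) *\<^sub>R i)"
  have expand: "b \<bullet> x = (\<Sum>i\<in>Basis. (b \<bullet> i) * (i \<bullet> x))" for b x :: "real^'n"
    by (subst euclidean_inner) (simp only: inner_commute)
  have B: "B a \<bullet> b = (LINT x|N. (a \<bullet> x) * (b \<bullet> x))" for a b
  proof -
    have "(LINT x|N. (a \<bullet> x) * (b \<bullet> x)) = (LINT x|N. (\<Sum>i\<in>Basis. (b \<bullet> i) * ((a \<bullet> x) * (i \<bullet> x))))"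
      by (subst expand[of b]) (simp only: sum_distrib_left mult.left_commute)
    also have "\<dots> = (\<Sum>i\<in>Basis. (b \<bullet> i) * (LINT x|N. (a \<bullet> x) * (i \<bullet> x)))"
      using ia by (subst Bochner_Integration.integral_sum) auto
    finally show ?thesis by (simp add: B_def inner_sum_right mult.commute inner_commute[of _ b])
  qed
  have linB: "linear B"
  proof (rule linearI)
    show "B (a + b) = B a + B b" for a b
      using ia by (simp add: B_def inner_add_left distrib_right scaleR_left_distrib sum.distrib)
    show "B (c *\<^sub>R a) = c *\<^sub>R B a" for c a
      by (simp add: B_def mult.assoc scaleR_sum_right)
  qed
  have "a = 0" if "B a = 0" for a
  proof -
    have "(LINT x|N. (a \<bullet> x)\<^sup>2) = 0" using B[of a a] that by (simp add: power2_eq_square)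
    then have "AE x in N. (a \<bullet> x)\<^sup>2 = 0"
      using integral_nonneg_eq_0_iff_AE[OF sq] by simp
    then show ?thesis by (intro pos) simp
  qed
  then have "inj B" using linB by (simp add: linear_injective_0)
  then have "surj B" using linB linear_injective_imp_surjective by blast
  then obtain a where "(\<Sum>i\<in>Basis. (LINT x|N. u x * (i \<bullet> x)) *\<^sub>R i) = B a" by (rule surjE)
  note a = this[symmetric]
  have "(LINT x|N. (u x - a \<bullet> x) * (b \<bullet> x)) = 0" for b
  proof -
    have "(LINT x|N. u x * (b \<bullet> x)) = (LINT x|N. (\<Sum>i\<in>Basis. (b \<bullet> i) * (u x * (i \<bullet> x))))"
      by (subst expand[of b]) (simp only: sum_distrib_left mult.left_commute)
    also have "\<dots> = (\<Sum>i\<in>Basis. (b \<bullet> i) * (LINT x|N. u x * (i \<bullet> x)))"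
      using iu by (subst Bochner_Integration.integral_sum) auto
    also have "\<dots> = B a \<bullet> b" by (simp add: a inner_sum_right mult.commute inner_commute[of _ b])
    also have "\<dots> = (LINT x|N. (a \<bullet> x) * (b \<bullet> x))" by (rule B)
    finally show ?thesis using iu ia by (simp add: left_diff_distrib)
  qed
  then show ?thesis by blast
qed

end

section \<open>Spectrum from moment recursions\<close>

text \<open>Young's inequality with a weight \<open>e\<close> splits the error into two terms: the
  first tends to 0 for fixed \<open>e\<close>, the second is small with \<open>e\<close>.\<close>

lemma L2_tendsto_integral:
  fixes f :: "nat \<Rightarrow> 'a \<Rightarrow> real"
  assumes f: "\<And>k. square_integrable N (f k)" and u: "square_integrable N u" and v: "square_integrable N v"
    and lim: "L2_tendsto N f u"
  shows "(\<lambda>k. LINT x|N. f k x * v x) \<longlonglongrightarrow> (LINT x|N. u x * v x)"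
proof -
  have [measurable]: "f k \<in> borel_measurable N" "u \<in> borel_measurable N" "v \<in> borel_measurable N" for k
    using f u v by (auto simp: square_integrable_def)
  have sq: "integrable N (\<lambda>x. (f k x - u x)\<^sup>2)" for k
  proof -
    have "integrable N (\<lambda>x. f k x * u x)"
      using f u by (intro integrable_square_prod) (auto simp: square_integrable_def)
    then have "integrable N (\<lambda>x. (f k x)\<^sup>2 + (u x)\<^sup>2 - 2 * (f k x * u x))"
      using f u by (intro Bochner_Integration.integrable_diff Bochner_Integration.integrable_add integrable_mult_right)
        (auto simp: square_integrable_def)
    then show ?thesis by (simp add: power2_diff mult.assoc)
  qed
  have prod: "integrable N (\<lambda>x. f k x * v x)" "integrable N (\<lambda>x. u x * v x)" "integrable N (\<lambda>x. (v x)\<^sup>2)" for k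
    using f u v by (auto intro!: integrable_square_prod simp: square_integrable_def)
  define d where "d = (\<lambda>k. LINT x|N. (f k x - u x)\<^sup>2)"
  have d: "d \<longlonglongrightarrow> 0"
  proof -
    have "(\<lambda>k. ennreal (d k)) \<longlonglongrightarrow> ennreal 0"
      using lim sq unfolding L2_tendsto_def d_def by (simp add: nn_integral_eq_integral)
    then show ?thesis by (subst (asm) tendsto_ennreal_iff) (auto simp: d_def)
  qed
  define V where "V = (LINT x|N. (v x)\<^sup>2)"
  have bound: "\<bar>(LINT x|N. f k x * v x) - (LINT x|N. u x * v x)\<bar> \<le> d k / (2 * e) + e * V / 2"
    if e: "e > 0" for e k
  proof -
    have "(LINT x|N. f k x * v x) - (LINT x|N. u x * v x) = (LINT x|N. (f k x - u x) * v x)"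
      using prod by (simp add: left_diff_distrib)
    also have "\<bar>\<dots>\<bar> \<le> (LINT x|N. (f k x - u x)\<^sup>2 / (2 * e) + e * (v x)\<^sup>2 / 2)"
    proof (rule order_trans[OF integral_abs_bound], rule integral_mono')
      show "integrable N (\<lambda>x. (f k x - u x)\<^sup>2 / (2 * e) + e * (v x)\<^sup>2 / 2)" using sq prod by simp
      show "\<bar>(f k x - u x) * v x\<bar> \<le> (f k x - u x)\<^sup>2 / (2 * e) + e * (v x)\<^sup>2 / 2" for x
      proof -
        have "0 \<le> (\<bar>f k x - u x\<bar> - e * \<bar>v x\<bar>)\<^sup>2" by simp
        then have "2 * e * \<bar>(f k x - u x) * v x\<bar> \<le> (f k x - u x)\<^sup>2 + e\<^sup>2 * (v x)\<^sup>2"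
          by (simp add: power2_diff power_mult_distrib abs_mult mult_ac)
        then show ?thesis using e by (simp add: field_simps power2_eq_square)
      qed
      show "0 \<le> (f k x - u x)\<^sup>2 / (2 * e) + e * (v x)\<^sup>2 / 2" for x using e by simp
    qed
    also have "\<dots> = d k / (2 * e) + e * V / 2" using sq prod by (simp add: d_def V_def)
    finally show ?thesis .
  qed
  have V: "V \<ge> 0" by (simp add: V_def)
  show ?thesis
  proof (rule LIMSEQ_I)
    fix r :: real assume r: "r > 0"
    \<comment> \<open>Chosen so that \<open>e * V / 2\<close> is at most \<open>r / 2\<close>;
      adding 1 to \<open>V\<close> avoids a division by zero.\<close>
    define e where "e = r / (V + 1)"
    have e: "e > 0" "e * V / 2 \<le> r / 2" using r V by (auto simp: e_def field_simps)
    have "r * e > 0" using r e by simp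
    then obtain K where K: "\<And>k. k \<ge> K \<Longrightarrow> \<bar>d k\<bar> < r * e" using LIMSEQ_D[OF d, of "r * e"] by auto
    have "\<bar>(LINT x|N. f k x * v x) - (LINT x|N. u x * v x)\<bar> < r" if "k \<ge> K" for k
    proof -
      have "d k / (2 * e) < r / 2" using K[OF that] e by (simp add: field_simps)
      then show ?thesis using bound[OF e(1), of k] e(2) by linarith
    qed
    then show "\<exists>K. \<forall>k\<ge>K. norm ((LINT x|N. f k x * v x) - (LINT x|N. u x * v x)) < r" by auto
  qed
qed

text \<open>The common skeleton of the two worlds. \<open>green\<close> is symmetry against powers
  of linear forms, with the image of the power already inserted, and applies to test functions. The
  last three assumptions make the linear forms independent eigenfunctions for \<open>lam 1\<close>
  and show that \<open>lam 2\<close> is attained.\<close>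

locale linear_world = exp_integrable_measure "weighted_measure T M p" M
  for T :: "'m::finite itself" and M :: "(real^'n) set" and p :: "real^'n \<Rightarrow> real" +
  fixes lam :: "nat \<Rightarrow> real"
  assumes lam_0: "lam 0 = 0" and lam_mono: "strict_mono lam"
    and test_sq: "\<And>\<phi>. test_function M \<phi> \<Longrightarrow> square_integrable (weighted_measure T M p) \<phi>"
    and laplacian_sq: "\<And>\<phi>. test_function M \<phi> \<Longrightarrow>
        square_integrable (weighted_measure T M p) (\<lambda>x. - weighted_laplacian M p \<phi> x)"
    and green: "\<And>\<phi> a k. test_function M \<phi> \<Longrightarrow>
        (LINT x|weighted_measure T M p. - weighted_laplacian M p \<phi> x * (a \<bullet> x) ^ k) =
        (LINT x|weighted_measure T M p. \<phi> x * (lam k * (a \<bullet> x) ^ k - real (k * (k - 1)) * (a \<bullet> a) * (a \<bullet> x) ^ (k - 2)))"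
    and pos_def: "\<And>a. AE x in weighted_measure T M p. a \<bullet> x = 0 \<Longrightarrow> a = 0"
    and linear_eigen: "\<And>a. (\<lambda>x. a \<bullet> x) \<in> eigenspace T M p (lam 1)"
    and second_eigenvalue: "lam 2 \<in> eigenvalues T M p"
begin

abbreviation "\<mu> \<equiv> weighted_measure T M p"

lemma square_integrable_linear_power: "square_integrable \<mu> (\<lambda>x. (a \<bullet> x) ^ k)"
  unfolding square_integrable_def
  by (auto intro!: integrable_square_exp_bounded linear_power_bound)

lemma eigenspace_square_integrable:
  "u \<in> eigenspace T M p l \<Longrightarrow> square_integrable \<mu> u"
  by (simp add: eigenspace_def neg_weighted_laplacian_graph_def)

text \<open>\<open>green\<close> holds for the approximating test functions, and both sides pass to
  the limit: one by convergence of the images under the operator, the other by convergence of the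
  functions themselves.\<close>

lemma eigenspace_recursion:
  assumes u: "u \<in> eigenspace T M p l"
  shows "(lam k - l) * (LINT x|\<mu>. u x * (a \<bullet> x) ^ k) =
    real (k * (k - 1)) * (a \<bullet> a) * (LINT x|\<mu>. u x * (a \<bullet> x) ^ (k - 2))"
proof -
  obtain \<phi> where sq: "square_integrable \<mu> u" "square_integrable \<mu> (\<lambda>x. l * u x)"
    and \<phi>: "\<And>k. test_function M (\<phi> k)" "L2_tendsto \<mu> \<phi> u"
      "L2_tendsto \<mu> (\<lambda>k x. - weighted_laplacian M p (\<phi> k) x) (\<lambda>x. l * u x)"
    using u by (auto simp: eigenspace_def neg_weighted_laplacian_graph_def)
  define w where "w = (\<lambda>x. lam k * (a \<bullet> x) ^ k - real (k * (k - 1)) * (a \<bullet> a) * (a \<bullet> x) ^ (k - 2))"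
  have int: "integrable \<mu> (\<lambda>x. u x * (a \<bullet> x) ^ j)" for j
    using sq by (intro integrable_linear_power) (auto simp: square_integrable_def)
  have w: "square_integrable \<mu> w"
  proof -
    have lin: "integrable \<mu> (\<lambda>x. (a \<bullet> x) ^ i * (a \<bullet> x) ^ j)" for i j
      using square_integrable_linear_power[of a] by (intro integrable_linear_power) (auto simp: square_integrable_def)
    have "(\<lambda>x. (w x)\<^sup>2) = (\<lambda>x. (lam k)\<^sup>2 * ((a \<bullet> x) ^ k * (a \<bullet> x) ^ k) +
        (real (k * (k - 1)) * (a \<bullet> a))\<^sup>2 * ((a \<bullet> x) ^ (k - 2) * (a \<bullet> x) ^ (k - 2)) -
        (2 * lam k * (real (k * (k - 1)) * (a \<bullet> a))) * ((a \<bullet> x) ^ k * (a \<bullet> x) ^ (k - 2)))"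
      unfolding w_def power2_diff power_mult_distrib by (simp add: fun_eq_iff power2_eq_square mult_ac)
    moreover have "integrable \<mu> \<dots>"
      by (intro Bochner_Integration.integrable_diff Bochner_Integration.integrable_add integrable_mult_right lin)
    moreover have "w \<in> borel_measurable \<mu>" unfolding w_def by measurable
    ultimately show ?thesis by (simp add: square_integrable_def)
  qed
  have "(\<lambda>j. LINT x|\<mu>. - weighted_laplacian M p (\<phi> j) x * (a \<bullet> x) ^ k) \<longlonglongrightarrow> (LINT x|\<mu>. l * u x * (a \<bullet> x) ^ k)"
    by (rule L2_tendsto_integral[OF laplacian_sq[OF \<phi>(1)] sq(2) square_integrable_linear_power \<phi>(3)])
  moreover have "(\<lambda>j. LINT x|\<mu>. \<phi> j x * w x) \<longlonglongrightarrow> (LINT x|\<mu>. u x * w x)"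
    by (rule L2_tendsto_integral[OF test_sq[OF \<phi>(1)] sq(1) w \<phi>(2)])
  ultimately have "(LINT x|\<mu>. l * u x * (a \<bullet> x) ^ k) = (LINT x|\<mu>. u x * w x)"
    unfolding green[OF \<phi>(1)] w_def by (rule LIMSEQ_unique)
  also have "\<dots> = (LINT x|\<mu>. lam k * (u x * (a \<bullet> x) ^ k) - (real (k * (k - 1)) * (a \<bullet> a)) * (u x * (a \<bullet> x) ^ (k - 2)))"
    unfolding w_def by (simp only: right_diff_distrib mult_ac)
  also have "\<dots> = lam k * (LINT x|\<mu>. u x * (a \<bullet> x) ^ k) - (real (k * (k - 1)) * (a \<bullet> a)) * (LINT x|\<mu>. u x * (a \<bullet> x) ^ (k - 2))"
    using int by (subst Bochner_Integration.integral_diff) (auto simp only: integral_mult_right_zero intro: integrable_mult_right)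
  finally show ?thesis by (simp add: mult.assoc left_diff_distrib)
qed

lemma eigenvalue_in_range:
  assumes "l \<in> eigenvalues T M p" shows "\<exists>k. l = lam k"
proof (rule ccontr)
  assume neg: "\<not> ?thesis"
  obtain u where u: "u \<in> eigenspace T M p l" "\<not> (AE x in \<mu>. u x = 0)"
    using assms by (auto simp: eigenvalues_def)
  have "AE x in \<mu>. u x = 0"
    by (rule moment_recursion_imp_AE_zero[OF _ _ eigenspace_recursion[OF u(1)]])
      (use eigenspace_square_integrable[OF u(1)] neg in \<open>auto simp: square_integrable_def\<close>)
  with u show False by simp
qed

text \<open>Membership in the graph is expressed by integrals, which do not see null sets. This
  extends the eigenfunction property from linear forms to all their measurable
  representatives.\<close>

lemma eigenspace_cong_AE:
  assumes v: "v \<in> eigenspace T M p l" and u: "u \<in> borel_measurable \<mu>" and eq: "AE x in \<mu>. u x = v x"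
  shows "u \<in> eigenspace T M p l"
proof -
  note [measurable] = u
  have [measurable]: "v \<in> borel_measurable \<mu>"
    using eigenspace_square_integrable[OF v] by (simp add: square_integrable_def)
  have sq: "integrable \<mu> (\<lambda>x. (u x)\<^sup>2) = integrable \<mu> (\<lambda>x. (v x)\<^sup>2)"
    "integrable \<mu> (\<lambda>x. (l * u x)\<^sup>2) = integrable \<mu> (\<lambda>x. (l * v x)\<^sup>2)"
    using eq by (intro integrable_cong_AE; measurable; auto)+
  have L2: "L2_tendsto \<mu> f u = L2_tendsto \<mu> f v"
    "L2_tendsto \<mu> f (\<lambda>x. l * u x) = L2_tendsto \<mu> f (\<lambda>x. l * v x)" for f
  proof -
    have "(\<integral>\<^sup>+x. ennreal ((f k x - u x)\<^sup>2) \<partial>\<mu>) = (\<integral>\<^sup>+x. ennreal ((f k x - v x)\<^sup>2) \<partial>\<mu>)"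
      "(\<integral>\<^sup>+x. ennreal ((f k x - l * u x)\<^sup>2) \<partial>\<mu>) = (\<integral>\<^sup>+x. ennreal ((f k x - l * v x)\<^sup>2) \<partial>\<mu>)" for k
      using eq by (intro nn_integral_cong_AE; auto)+
    then show "L2_tendsto \<mu> f u = L2_tendsto \<mu> f v"
      "L2_tendsto \<mu> f (\<lambda>x. l * u x) = L2_tendsto \<mu> f (\<lambda>x. l * v x)" by (simp_all add: L2_tendsto_def)
  qed
  show ?thesis using v u by (simp add: eigenspace_def neg_weighted_laplacian_graph_def square_integrable_def sq L2)
qed

lemma linear_eigenspace:
  "eigenspace T M p (lam 1) = {u \<in> borel_measurable \<mu>. \<exists>a. AE x in \<mu>. u x = a \<bullet> x}"
proof (intro equalityI subsetI)
  fix u assume "u \<in> {u \<in> borel_measurable \<mu>. \<exists>a. AE x in \<mu>. u x = a \<bullet> x}"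
  then show "u \<in> eigenspace T M p (lam 1)" using eigenspace_cong_AE linear_eigen by auto
next
  fix u assume u: "u \<in> eigenspace T M p (lam 1)"
  then have sq: "u \<in> borel_measurable \<mu>" "integrable \<mu> (\<lambda>x. (u x)\<^sup>2)"
    using eigenspace_square_integrable by (auto simp: square_integrable_def)
  obtain a where a: "\<And>b. (LINT x|\<mu>. (u x - a \<bullet> x) * (b \<bullet> x)) = 0"
    using linear_projection_exists[OF sq pos_def] by blast
  have sql: "(\<lambda>x. a \<bullet> x) \<in> borel_measurable \<mu>" "integrable \<mu> (\<lambda>x. (a \<bullet> x)\<^sup>2)"
    using square_integrable_linear_power[of a 1] by (auto simp: square_integrable_def)
  have diff: "(LINT x|\<mu>. (u x - a \<bullet> x) * (b \<bullet> x) ^ k) =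
      (LINT x|\<mu>. u x * (b \<bullet> x) ^ k) - (LINT x|\<mu>. (a \<bullet> x) * (b \<bullet> x) ^ k)" for b k
    using integrable_linear_power[OF sq, of b k] integrable_linear_power[OF sql, of b k]
    by (simp add: left_diff_distrib)
  have "AE x in \<mu>. u x - a \<bullet> x = 0"
  proof (rule moment_recursion_imp_AE_zero)
    show "(\<lambda>x. u x - a \<bullet> x) \<in> borel_measurable \<mu>" using sq sql by measurable
    have "integrable \<mu> (\<lambda>x. (u x)\<^sup>2 + (a \<bullet> x)\<^sup>2 - 2 * (u x * (a \<bullet> x)))"
      using sq sql integrable_square_prod[OF sq(1) sql(1) sq(2) sql(2)] by simp
    then show "integrable \<mu> (\<lambda>x. (u x - a \<bullet> x)\<^sup>2)" by (simp add: power2_diff mult.assoc)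
    show "(lam k - lam 1) * (LINT x|\<mu>. (u x - a \<bullet> x) * (b \<bullet> x) ^ k) =
      real (k * (k - 1)) * (b \<bullet> b) * (LINT x|\<mu>. (u x - a \<bullet> x) * (b \<bullet> x) ^ (k - 2))" for b k
      unfolding diff right_diff_distrib eigenspace_recursion[OF u] eigenspace_recursion[OF linear_eigen] ..
    show "(LINT x|\<mu>. (u x - a \<bullet> x) * (b \<bullet> x) ^ k) = 0" if "lam k = lam 1" for b k
    proof -
      \<comment> \<open>\<open>lam\<close> is injective, so degree one is the only resonance, and
        there the moments vanish by the choice of the projection.\<close>
      have "k = 1" using that lam_mono by (metis strict_mono_eq)
      then show ?thesis using a by simp
    qed
  qed
  then show "u \<in> {u \<in> borel_measurable \<mu>. \<exists>a. AE x in \<mu>. u x = a \<bullet> x}"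
    using sq by auto
qed

theorem linear_eigenvalue: "linear_eigenvalue T M p (lam 1)"
  unfolding linear_eigenvalue_def is_least_def
proof (intro conjI linear_eigenspace)
  have "axis (undefined::'n) (1::real) \<noteq> 0" by (simp add: axis_eq_0_iff)
  then have "\<not> (AE x in \<mu>. axis undefined 1 \<bullet> x = 0)" using pos_def by blast
  then have "lam 1 \<in> eigenvalues T M p" unfolding eigenvalues_def using linear_eigen by blast
  moreover have "lam 0 < lam 1" using lam_mono by (simp add: strict_mono_def)
  ultimately show "lam 1 \<in> {k \<in> eigenvalues T M p. k \<noteq> 0}" by (simp add: lam_0)
  show "\<forall>k\<in>{k \<in> eigenvalues T M p. k \<noteq> 0}. lam 1 \<le> k"
  proof
    fix l assume "l \<in> {k \<in> eigenvalues T M p. k \<noteq> 0}"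
    then obtain k where k: "l = lam k" "lam k \<noteq> 0" using eigenvalue_in_range by auto
    then have "1 \<le> k" using lam_0 by (cases k) auto
    then show "lam 1 \<le> l" using lam_mono k by (simp add: strict_mono_less_eq)
  qed
qed

theorem nonlinear_eigenvalue: "nonlinear_eigenvalue T M p (lam 2)"
  unfolding nonlinear_eigenvalue_def is_least_def
proof (intro exI conjI)
  show "linear_eigenvalue T M p (lam 1)" by (rule linear_eigenvalue)
  have "lam 1 < lam 2" using lam_mono by (simp add: strict_mono_def)
  then show "lam 2 \<in> {k \<in> eigenvalues T M p. lam 1 < k}" using second_eigenvalue by simp
  show "\<forall>k\<in>{k \<in> eigenvalues T M p. lam 1 < k}. lam 2 \<le> k"
  proof
    fix l assume "l \<in> {k \<in> eigenvalues T M p. lam 1 < k}"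
    then obtain k where k: "l = lam k" "lam 1 < lam k" using eigenvalue_in_range by auto
    then have "2 \<le> k" using lam_mono by (simp add: strict_mono_less)
    then show "lam 2 \<le> l" using lam_mono k by (simp add: strict_mono_less_eq)
  qed
qed

end

section \<open>The Gaussian world\<close>

lemma compact_support_bounded:
  fixes f :: "'a::real_normed_vector \<Rightarrow> real"
  assumes "continuous_on UNIV f" "compact K" "\<And>x. x \<notin> K \<Longrightarrow> f x = 0"
  shows "\<exists>C\<ge>0. \<forall>x. \<bar>f x\<bar> \<le> C"
proof -
  have "bounded (f ` K)"
    using assms(1,2) by (intro compact_imp_bounded compact_continuous_image) (auto intro: continuous_on_subset)
  then obtain C where "\<forall>x\<in>K. \<bar>f x\<bar> \<le> C" by (auto simp: bounded_iff)
  then have "\<bar>f x\<bar> \<le> max C 0" for x using assms(3)[of x] by (cases "x \<in> K") auto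
  then show ?thesis by (intro exI[of _ "max C 0"]) auto
qed

lemma integrable_compact_support:
  fixes f :: "'a::euclidean_space \<Rightarrow> real"
  assumes "continuous_on UNIV f" "compact K" "\<And>x. x \<notin> K \<Longrightarrow> f x = 0"
  shows "integrable lborel f"
proof -
  obtain C where "\<And>x. \<bar>f x\<bar> \<le> C" using compact_support_bounded[OF assms] by blast
  then show ?thesis
    using assms emeasure_bounded_finite[OF compact_imp_bounded[OF assms(2)]]
    by (intro integrableI_bounded_set[where A=K and B=C])
      (auto simp: borel_compact intro: borel_measurable_continuous_onI)
qed

lemma has_derivative_zero_off_support:
  assumes "compact K" "\<And>x. x \<notin> K \<Longrightarrow> f x = 0" "x \<notin> K"
  shows "(f has_derivative (\<lambda>_. 0)) (at x)"
proof -
  have "open (- K)" using assms(1) by (simp add: compact_imp_closed open_Compl)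
  then show ?thesis
    using assms(2,3) by (intro has_derivative_transform_within_open[OF has_derivative_const]) auto
qed

lemma DERIV_LIMSEQ:
  assumes "(g has_real_derivative D) (at 0)"
  shows "(\<lambda>k. real (Suc k) * (g (1 / real (Suc k)) - g 0)) \<longlonglongrightarrow> D"
proof -
  have "((\<lambda>h. (g h - g 0) / h) \<longlongrightarrow> D) (at 0)"
    using assms by (simp add: DERIV_def)
  moreover have "filterlim (\<lambda>k. 1 / real (Suc k)) (at 0) sequentially"
    unfolding filterlim_at using LIMSEQ_inverse_real_of_nat by (auto simp: inverse_eq_divide)
  ultimately have "(\<lambda>k. (g (1 / real (Suc k)) - g 0) / (1 / real (Suc k))) \<longlonglongrightarrow> D"
    by (rule filterlim_compose)
  then show ?thesis by (simp add: mult.commute)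
qed

text \<open>By translation invariance the difference quotients in direction \<open>b\<close>
  integrate to 0. The mean value theorem bounds them by a bound of the derivative on a ball that
  contains all their supports.\<close>

lemma integral_partial_derivative_zero:
  fixes f :: "'a::euclidean_space \<Rightarrow> real"
  assumes f: "\<And>x. (f has_derivative f' x) (at x)" and c: "continuous_on UNIV (\<lambda>x. f' x b)"
    and K: "compact K" "\<And>x. x \<notin> K \<Longrightarrow> f x = 0"
  shows "(LINT x|lborel. f' x b) = 0"
proof -
  have cf: "continuous_on UNIV f"
    using f by (auto intro: has_derivative_continuous_on has_derivative_at_withinI)
  have f'0: "f' x b = 0" if "x \<notin> K" for x
    using has_derivative_unique[OF f has_derivative_zero_off_support[OF K that]] by metis
  obtain C where C: "\<And>x. \<bar>f' x b\<bar> \<le> C"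
    using compact_support_bounded[OF c K(1) f'0] by blast
  obtain r where r: "K \<subseteq> cball 0 r"
    using compact_imp_bounded[OF K(1)] by (auto simp: bounded_iff subset_iff)
  \<comment> \<open>The steps have length at most \<open>norm b\<close>, so outside this ball
    neither end of a difference quotient lies in \<open>K\<close>.\<close>
  let ?B = "cball (0::'a) (r + norm b)"
  define d where "d = (\<lambda>k x. real (Suc k) * (f (x + (1 / real (Suc k)) *\<^sub>R b) - f x))"
  have f_int: "integrable lborel f" by (rule integrable_compact_support[OF cf K])
  have shift: "integrable lborel (\<lambda>x. f (x + c)) \<and> (LINT x|lborel. f (x + c)) = (LINT x|lborel. f x)" for c
  proof -
    have "integrable (distr lborel borel ((+) c)) f" using f_int by (simp add: lborel_distr_plus)
    then have "integrable lborel (\<lambda>x. f (c + x))" by (subst (asm) integrable_distr_eq) (use borel_measurable_continuous_onI[OF cf] in auto)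
    moreover have "(LINT x|distr lborel borel ((+) c). f x) = (LINT x|lborel. f (c + x))"
      by (rule integral_distr) (use borel_measurable_continuous_onI[OF cf] in auto)
    ultimately show ?thesis by (simp add: lborel_distr_plus add.commute)
  qed
  have line: "((\<lambda>t. f (x + t *\<^sub>R b)) has_real_derivative f' (x + t *\<^sub>R b) b) (at t)" for x t
  proof -
    have "((\<lambda>t. x + t *\<^sub>R b) has_derivative (\<lambda>h. h *\<^sub>R b)) (at t)" by (auto intro!: derivative_eq_intros)
    from has_derivative_compose[OF this f]
    have "((\<lambda>t. f (x + t *\<^sub>R b)) has_derivative (\<lambda>h. f' (x + t *\<^sub>R b) (h *\<^sub>R b))) (at t)" .
    moreover have "f' (x + t *\<^sub>R b) (h *\<^sub>R b) = f' (x + t *\<^sub>R b) b * h" for h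
      using linear_cmul[OF has_derivative_linear[OF f], of _ h b] by (simp add: mult.commute)
    ultimately show ?thesis unfolding has_field_derivative_def by simp
  qed
  have "(\<lambda>k. LINT x|lborel. d k x) \<longlonglongrightarrow> (LINT x|lborel. f' x b)"
  proof (rule integral_dominated_convergence[where w="\<lambda>x. C * indicator ?B x"])
    show "(\<lambda>x. f' x b) \<in> borel_measurable lborel" using borel_measurable_continuous_onI[OF c] by simp
    have "continuous_on UNIV (d k)" for k
      unfolding d_def by (intro continuous_intros continuous_on_compose2[OF cf]) auto
    then show "d k \<in> borel_measurable lborel" for k using borel_measurable_continuous_onI by auto
    show "integrable lborel (\<lambda>x. C * indicator ?B x)"
      by (intro integrable_mult_right integrable_real_indicator emeasure_bounded_finite) auto
    show "AE x in lborel. (\<lambda>k. d k x) \<longlonglongrightarrow> f' x b"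
    proof (rule AE_I2)
      fix x
      show "(\<lambda>k. d k x) \<longlonglongrightarrow> f' x b"
        using DERIV_LIMSEQ[of "\<lambda>t. f (x + t *\<^sub>R b)"] line[of x 0] by (simp add: d_def)
    qed
    show "AE x in lborel. norm (d k x) \<le> C * indicator ?B x" for k
    proof (rule AE_I2)
      fix x
      define s where "s = 1 / real (Suc k)"
      have s: "0 < s" "s \<le> 1" by (auto simp: s_def)
      obtain \<xi> where \<xi>: "f (x + s *\<^sub>R b) - f (x + 0 *\<^sub>R b) = (s - 0) * f' (x + \<xi> *\<^sub>R b) b"
        using MVT2[OF s(1), of "\<lambda>t. f (x + t *\<^sub>R b)" "\<lambda>t. f' (x + t *\<^sub>R b) b", OF line] by blast
      then have "d k x = f' (x + \<xi> *\<^sub>R b) b" by (simp add: d_def s_def)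
      then have *: "\<bar>d k x\<bar> \<le> C" using C by simp
      show "norm (d k x) \<le> C * indicator ?B x"
      proof (cases "x \<in> ?B")
        case False
        have "norm x \<le> norm (x + s *\<^sub>R b) + norm (s *\<^sub>R b)"
          using norm_triangle_ineq4[of "x + s *\<^sub>R b" "s *\<^sub>R b"] by simp
        also have "norm (s *\<^sub>R b) \<le> norm b" using s by (simp add: mult_left_le_one_le)
        finally have "\<not> norm (x + s *\<^sub>R b) \<le> r" "\<not> norm x \<le> r" using False norm_ge_zero[of b]
          unfolding mem_cball_0 by linarith+
        then have "x + s *\<^sub>R b \<notin> K" "x \<notin> K" using r by auto
        then show ?thesis using False K(2) by (simp add: d_def s_def)
      qed (use * in simp)
    qed
  qed
  moreover have "(LINT x|lborel. d k x) = 0" for k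
    using f_int shift[of "(1 / real (Suc k)) *\<^sub>R b"] by (simp add: d_def)
  ultimately show ?thesis by (simp add: LIMSEQ_const_iff)
qed

text \<open>The divergence theorem without boundary term: each diagonal entry is a partial
  derivative of a component with compact support.\<close>

lemma integral_trace_derivative_zero:
  fixes W :: "'a::euclidean_space \<Rightarrow> 'a"
  assumes W: "\<And>x. (W has_derivative DW x) (at x)" and c: "\<And>b. b \<in> Basis \<Longrightarrow> continuous_on UNIV (\<lambda>x. DW x b \<bullet> b)"
    and K: "compact K" "\<And>x. x \<notin> K \<Longrightarrow> W x = 0"
  shows "(LINT x|lborel. (\<Sum>b\<in>Basis. DW x b \<bullet> b)) = 0"
proof -
  have d: "((\<lambda>x. W x \<bullet> b) has_derivative (\<lambda>h. DW x h \<bullet> b)) (at x)" for x b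
    by (auto intro!: derivative_eq_intros W)
  have int: "integrable lborel (\<lambda>x. DW x b \<bullet> b)" if b: "b \<in> Basis" for b
  proof -
    have "DW x b \<bullet> b = 0" if "x \<notin> K" for x
      using has_derivative_unique[OF W has_derivative_zero_off_support[OF K that]] by (metis inner_zero_left)
    then show ?thesis by (rule integrable_compact_support[OF c[OF b] K(1)])
  qed
  have "(LINT x|lborel. (\<Sum>b\<in>Basis. DW x b \<bullet> b)) = (\<Sum>b\<in>Basis. (LINT x|lborel. DW x b \<bullet> b))"
    by (rule Bochner_Integration.integral_sum) (rule int)
  also have "\<dots> = 0"
    using integral_partial_derivative_zero[OF d c K(1)] K(2) by (intro sum.neutral) auto
  finally show ?thesis .
qed

section \<open>The operator of the Gaussian world\<close>

definition trace_hess :: "('a::euclidean_space \<Rightarrow> real) \<Rightarrow> 'a \<Rightarrow> real" where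
  "trace_hess g x = (\<Sum>b\<in>Basis. hess g x b \<bullet> b)"

text \<open>The Ornstein-Uhlenbeck operator, which \<open>weighted_laplacian\<close> becomes for the
  Gaussian.\<close>

definition ou_op :: "('a::euclidean_space \<Rightarrow> real) \<Rightarrow> 'a \<Rightarrow> real" where
  "ou_op g x = trace_hess g x - x \<bullet> gradient g x"

lemma weighted_laplacian_gaussian_ou_op:
  "smooth_on UNIV \<phi> \<Longrightarrow> weighted_laplacian UNIV std_gaussian \<phi> x = ou_op \<phi> x"
  for \<phi> :: "real^'n \<Rightarrow> real"
  by (simp add: weighted_laplacian_gaussian ou_op_def trace_hess_def)

lemma continuous_on_trace_hess:
  "smooth_on U g \<Longrightarrow> open U \<Longrightarrow> continuous_on U (trace_hess g)"
  unfolding trace_hess_def[abs_def] by (intro continuous_intros continuous_on_hess) auto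

lemma continuous_on_gradient:
  "smooth_on U g \<Longrightarrow> open U \<Longrightarrow> continuous_on U (gradient g)"
  using smooth_on_imp_continuous_on smooth_on_gradient by blast

lemma continuous_on_ou_op:
  "smooth_on UNIV g \<Longrightarrow> continuous_on UNIV (ou_op g)"
  unfolding ou_op_def[abs_def] by (intro continuous_intros continuous_on_trace_hess continuous_on_gradient) auto

lemma support_derivatives:
  assumes g: "smooth_on UNIV g" and K: "compact K" "\<And>x. x \<notin> K \<Longrightarrow> g x = 0" and x: "x \<notin> K"
  shows gradient_support: "gradient g x = 0" and ou_op_support: "ou_op g x = 0"
proof -
  have grad0: "gradient g y = 0" if "y \<notin> K" for y
  proof (rule gradient_unique)
    have "(g has_derivative (\<lambda>_. 0)) (at y)" by (rule has_derivative_zero_off_support[OF K that])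
    then show "(g has_derivative (\<bullet>) 0) (at y)" by (rule has_derivative_eq_rhs) (simp add: fun_eq_iff)
  qed
  then show "gradient g x = 0" using x by simp
  have "(gradient g has_derivative (\<lambda>_. 0)) (at x)"
    by (rule has_derivative_zero_off_support[OF K(1) grad0 x])
  then have "hess g x = (\<lambda>_. 0)" by (rule frechet_derivative_eq_has_derivative)
  then show "ou_op g x = 0" using grad0[OF x] by (simp add: ou_op_def trace_hess_def)
qed

lemma has_derivative_std_gaussian:
  "(std_gaussian has_derivative (\<lambda>h. - (std_gaussian x * (x \<bullet> h)))) (at x)" for x :: "real^'n"
  unfolding std_gaussian_eq_exp[abs_def]
  by (auto intro!: derivative_eq_intros simp: inner_commute field_simps)

text \<open>The divergence of \<open>W\<close> is \<open>std_gaussian x\<close> times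
  \<open>ou_op \<phi> x * v x - \<phi> x * ou_op v x\<close>: the mixed gradient products cancel,
  and the derivative of the Gaussian supplies the drift terms. The support of \<open>\<phi>\<close>
  confines \<open>W\<close>, whatever the growth of \<open>v\<close>.\<close>

lemma green_gaussian:
  fixes \<phi> v :: "real^'n \<Rightarrow> real"
  assumes \<phi>: "smooth_on UNIV \<phi>" and v: "smooth_on UNIV v" and K: "compact K" "\<And>x. x \<notin> K \<Longrightarrow> \<phi> x = 0"
  shows "(LINT x|lborel. std_gaussian x * (ou_op \<phi> x * v x)) = (LINT x|lborel. std_gaussian x * (\<phi> x * ou_op v x))"
proof -
  define W where "W = (\<lambda>x. std_gaussian x *\<^sub>R (v x *\<^sub>R gradient \<phi> x - \<phi> x *\<^sub>R gradient v x))"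
  define DW where "DW = (\<lambda>x h. std_gaussian x *\<^sub>R ((v x *\<^sub>R hess \<phi> x h + (gradient v x \<bullet> h) *\<^sub>R gradient \<phi> x) -
      (\<phi> x *\<^sub>R hess v x h + (gradient \<phi> x \<bullet> h) *\<^sub>R gradient v x)) +
      (- (std_gaussian x * (x \<bullet> h))) *\<^sub>R (v x *\<^sub>R gradient \<phi> x - \<phi> x *\<^sub>R gradient v x))"
  note d = has_derivative_gradient[OF _ open_UNIV UNIV_I] has_derivative_hess[OF _ open_UNIV UNIV_I]
  have "(W has_derivative DW x) (at x)" for x
    unfolding W_def DW_def
    by (intro has_derivative_scaleR has_derivative_diff has_derivative_std_gaussian d \<phi> v)
  note W = this
  have cont: "continuous_on UNIV \<phi>" "continuous_on UNIV v" using \<phi> v smooth_on_imp_continuous_on by auto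
  have z: "(LINT x|lborel. (\<Sum>b\<in>Basis. DW x b \<bullet> b)) = 0"
  proof (rule integral_trace_derivative_zero[OF W _ K(1)])
    show "continuous_on UNIV (\<lambda>x. DW x b \<bullet> b)" for b
      unfolding DW_def using \<phi> v cont
      by (intro continuous_intros continuous_on_std_gaussian continuous_on_hess continuous_on_gradient) auto
    show "W x = 0" if "x \<notin> K" for x
      using that K gradient_support[OF \<phi> K that] by (simp add: W_def)
  qed
  have tr: "(\<Sum>b\<in>Basis. DW x b \<bullet> b) = std_gaussian x * (ou_op \<phi> x * v x) - std_gaussian x * (\<phi> x * ou_op v x)" for x
  proof -
    have e: "(\<Sum>b\<in>Basis. (y \<bullet> b) * (w \<bullet> b)) = y \<bullet> w" for y w :: "real^'n" by (rule euclidean_inner[symmetric])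
    have "DW x b \<bullet> b = std_gaussian x * (v x * (hess \<phi> x b \<bullet> b)) + std_gaussian x * ((gradient v x \<bullet> b) * (gradient \<phi> x \<bullet> b))
        - std_gaussian x * (\<phi> x * (hess v x b \<bullet> b)) - std_gaussian x * ((gradient \<phi> x \<bullet> b) * (gradient v x \<bullet> b))
        - (std_gaussian x * v x) * ((x \<bullet> b) * (gradient \<phi> x \<bullet> b)) + (std_gaussian x * \<phi> x) * ((x \<bullet> b) * (gradient v x \<bullet> b))" for b
      unfolding DW_def by (simp add: inner_add_left inner_diff_left algebra_simps)
    then show ?thesis
      by (simp only: sum.distrib sum_subtractf sum_distrib_left[symmetric] e ou_op_def trace_hess_def)
        (simp add: algebra_simps inner_commute)
  qed
  have int: "integrable lborel (\<lambda>x. std_gaussian x * (f x * g x))"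
    if fg: "continuous_on UNIV f" "continuous_on UNIV g" "\<And>x. x \<notin> K \<Longrightarrow> f x * g x = 0" for f g :: "real^'n \<Rightarrow> real"
    using fg by (intro integrable_compact_support[OF _ K(1)] continuous_intros continuous_on_std_gaussian) auto
  have "(LINT x|lborel. std_gaussian x * (ou_op \<phi> x * v x)) - (LINT x|lborel. std_gaussian x * (\<phi> x * ou_op v x)) = 0"
    using z unfolding tr
    by (subst Bochner_Integration.integral_diff[symmetric])
      (use cont \<phi> v K ou_op_support[OF \<phi> K] continuous_on_ou_op in \<open>auto intro!: int\<close>)
  then show ?thesis by simp
qed


lemma
  fixes g h :: "'a::euclidean_space \<Rightarrow> real"
  assumes g: "smooth_on UNIV g" and h: "smooth_on UNIV h"
  shows gradient_mult: "gradient (\<lambda>x. g x * h x) x = g x *\<^sub>R gradient h x + h x *\<^sub>R gradient g x"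
    and trace_hess_mult: "trace_hess (\<lambda>x. g x * h x) x =
      g x * trace_hess h x + h x * trace_hess g x + 2 * (gradient g x \<bullet> gradient h x)"
proof -
  note d = has_derivative_gradient[OF _ open_UNIV UNIV_I] has_derivative_hess[OF _ open_UNIV UNIV_I]
  have grad: "gradient (\<lambda>x. g x * h x) = (\<lambda>x. g x *\<^sub>R gradient h x + h x *\<^sub>R gradient g x)"
  proof
    fix x
    show "gradient (\<lambda>x. g x * h x) x = g x *\<^sub>R gradient h x + h x *\<^sub>R gradient g x"
      by (rule gradient_unique) (auto intro!: derivative_eq_intros d g h simp: inner_add_left fun_eq_iff mult.commute)
  qed
  then show "gradient (\<lambda>x. g x * h x) x = g x *\<^sub>R gradient h x + h x *\<^sub>R gradient g x" by simp
  have "hess (\<lambda>x. g x * h x) x = (\<lambda>v. (g x *\<^sub>R hess h x v + (gradient g x \<bullet> v) *\<^sub>R gradient h x) +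
      (h x *\<^sub>R hess g x v + (gradient h x \<bullet> v) *\<^sub>R gradient g x))"
    unfolding grad
    by (intro frechet_derivative_eq_has_derivative has_derivative_add has_derivative_scaleR d g h)
  then have "trace_hess (\<lambda>x. g x * h x) x = (\<Sum>b\<in>Basis. g x * (hess h x b \<bullet> b) + (gradient g x \<bullet> b) * (gradient h x \<bullet> b) +
      (h x * (hess g x b \<bullet> b) + (gradient h x \<bullet> b) * (gradient g x \<bullet> b)))"
    by (simp add: trace_hess_def inner_add_left)
  also have "\<dots> = g x * trace_hess h x + gradient g x \<bullet> gradient h x + (h x * trace_hess g x + gradient h x \<bullet> gradient g x)"
    by (simp only: sum.distrib sum_distrib_left[symmetric] euclidean_inner[symmetric] trace_hess_def)
  finally show "trace_hess (\<lambda>x. g x * h x) x =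
      g x * trace_hess h x + h x * trace_hess g x + 2 * (gradient g x \<bullet> gradient h x)"
    by (simp add: inner_commute)
qed

lemma smooth_on_inner: "smooth_on UNIV (\<lambda>x. a \<bullet> x)" for a :: "'a::euclidean_space"
  by (intro smooth_on_bounded_linear bounded_linear_inner_right open_UNIV)

lemma smooth_on_linear_power: "smooth_on UNIV (\<lambda>x. (a \<bullet> x) ^ k)" for a :: "'a::euclidean_space"
  by (intro smooth_on_power smooth_on_inner open_UNIV)

lemma gradient_linear_power: "gradient (\<lambda>x. (a \<bullet> x) ^ k) x = (real k * (a \<bullet> x) ^ (k - 1)) *\<^sub>R a"
  by (rule gradient_unique) (auto intro!: derivative_eq_intros simp: fun_eq_iff)

lemma hess_linear_power:
  "hess (\<lambda>x. (a \<bullet> x) ^ k) x v = (real (k * (k - 1)) * (a \<bullet> x) ^ (k - 2) * (a \<bullet> v)) *\<^sub>R a"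
proof -
  have "gradient (\<lambda>x. (a \<bullet> x) ^ k) = (\<lambda>x. (real k * (a \<bullet> x) ^ (k - 1)) *\<^sub>R a)"
    using gradient_linear_power by blast
  moreover have "((\<lambda>x. (real k * (a \<bullet> x) ^ (k - 1)) *\<^sub>R a) has_derivative
      (\<lambda>v. (real (k * (k - 1)) * (a \<bullet> x) ^ (k - 2) * (a \<bullet> v)) *\<^sub>R a)) (at x)"
    by (auto intro!: derivative_eq_intros simp: fun_eq_iff numeral_2_eq_2)
  ultimately show ?thesis using frechet_derivative_eq_has_derivative by metis
qed

lemma trace_hess_linear_power:
  "trace_hess (\<lambda>x. (a \<bullet> x) ^ k) x = real (k * (k - 1)) * (a \<bullet> a) * (a \<bullet> x) ^ (k - 2)"
proof -
  have "trace_hess (\<lambda>x. (a \<bullet> x) ^ k) x = (\<Sum>b\<in>Basis. real (k * (k - 1)) * (a \<bullet> x) ^ (k - 2) * ((a \<bullet> b) * (a \<bullet> b)))"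
    by (simp add: trace_hess_def hess_linear_power mult.assoc)
  also have "\<dots> = real (k * (k - 1)) * (a \<bullet> x) ^ (k - 2) * (a \<bullet> a)"
    by (simp only: sum_distrib_left[symmetric] euclidean_inner[symmetric])
  finally show ?thesis by (simp add: mult_ac)
qed

lemma ou_op_linear_power:
  "- ou_op (\<lambda>x. (a \<bullet> x) ^ k) x = real k * (a \<bullet> x) ^ k - real (k * (k - 1)) * (a \<bullet> a) * (a \<bullet> x) ^ (k - 2)"
  unfolding ou_op_def trace_hess_linear_power gradient_linear_power
  by (cases k) (simp_all add: inner_commute[of x] mult.assoc)

lemma weighted_measure_gaussian:
  "weighted_measure TYPE('n::finite) (UNIV :: (real^'n) set) std_gaussian = density lborel (\<lambda>x. ennreal (std_gaussian x))"
  by (simp add: weighted_measure_def riemannian_volume_UNIV)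

interpretation gaussian: exp_integrable_measure
  "density lborel (\<lambda>x::real^'n. ennreal (std_gaussian x))" "UNIV :: (real^'n::finite) set"
proof
  show "sets (density lborel (\<lambda>x::real^'n. ennreal (std_gaussian x))) = sets (restrict_space borel UNIV)"
    by (simp add: sets_restrict_space)
  show "integrable (density lborel (\<lambda>x. ennreal (std_gaussian x))) (\<lambda>x::real^'n. exp (c * norm x))" for c
    using integrable_std_gaussian_exp[of c] less_imp_le[OF std_gaussian_pos]
    by (subst integrable_density) auto
qed simp

lemma integral_gaussian:
  "f \<in> borel_measurable borel \<Longrightarrow>
    (LINT x|density lborel (\<lambda>x::real^'n. ennreal (std_gaussian x)). f x) = (LINT x|lborel. std_gaussian x * f x)"
  for f :: "real^'n \<Rightarrow> real"
  by (subst integral_density) (auto simp: less_imp_le[OF std_gaussian_pos])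

text \<open>The set where \<open>f\<close> does not vanish is open, and a nonempty open set is not
  negligible.\<close>

lemma AE_zero_continuous:
  fixes f :: "'a::euclidean_space \<Rightarrow> real"
  assumes ae: "AE x in lborel. f x = 0" and f: "continuous_on UNIV f"
  shows "f x = 0"
proof -
  let ?S = "{x. f x \<noteq> 0}"
  have "open ?S" using f by (intro open_Collect_neq) auto
  moreover have "?S \<in> null_sets lborel"
    using ae AE_iff_null[of lborel "\<lambda>x. f x = 0"] \<open>open ?S\<close> by simp
  then have "negligible ?S" by (simp add: negligible_iff_null_sets null_sets_completionI)
  ultimately show ?thesis using open_not_negligible[of ?S] by blast
qed

lemma AE_zero_gaussian:
  fixes f :: "real^'n \<Rightarrow> real"
  assumes "AE x in density lborel (\<lambda>x. ennreal (std_gaussian x)). f x = 0" "continuous_on UNIV f"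
  shows "f x = 0"
proof (rule AE_zero_continuous[OF _ assms(2)])
  have "AE x in lborel. 0 < ennreal (std_gaussian x) \<longrightarrow> f x = 0"
    using assms(1) by (subst (asm) AE_density) auto
  then show "AE x in lborel. f x = 0"
    by eventually_elim (simp add: ennreal_less_zero_iff std_gaussian_pos)
qed

lemma gaussian_test_function:
  fixes \<phi> :: "real^'n \<Rightarrow> real"
  assumes "test_function UNIV \<phi>"
  shows gaussian_test_smooth: "smooth_on UNIV \<phi>"
    and "\<exists>K. compact K \<and> (\<forall>x. x \<notin> K \<longrightarrow> \<phi> x = 0)"
  using assms smooth_on_manifold_UNIV unfolding test_function_def by auto

lemma gaussian_square_integrable:
  fixes f :: "real^'n \<Rightarrow> real"
  assumes "continuous_on UNIV f" "\<And>x. \<bar>f x\<bar> \<le> C * exp (c * norm x)"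
  shows "square_integrable (density lborel (\<lambda>x. ennreal (std_gaussian x))) f"
  unfolding square_integrable_def using assms borel_measurable_continuous_onI[OF assms(1)]
  by (auto intro!: gaussian.integrable_square_exp_bounded)

lemma (in exp_integrable_measure) L2_tendsto_dominated:
  assumes m: "\<And>k. f k \<in> borel_measurable N" "u \<in> borel_measurable N"
    and b: "\<And>k x. \<bar>f k x - u x\<bar> \<le> C * exp (c * norm x)" and lim: "\<And>x. (\<lambda>k. f k x) \<longlonglongrightarrow> u x"
  shows "L2_tendsto N f u"
proof -
  have sq: "(f k x - u x)\<^sup>2 \<le> (C * exp (c * norm x))\<^sup>2" for k x
    using b[of k x] by (metis abs_ge_zero power2_abs power_mono)
  have e: "(\<lambda>x. C * exp (c * norm x)) \<in> borel_measurable N"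
    by (rule borel_measurable_N) measurable
  have "(\<lambda>k. \<integral>\<^sup>+x. ennreal ((f k x - u x)\<^sup>2) \<partial>N) \<longlonglongrightarrow> (\<integral>\<^sup>+x. 0 \<partial>N)"
  proof (rule nn_integral_dominated_convergence[where w="\<lambda>x. ennreal ((C * exp (c * norm x))\<^sup>2)"])
    show "AE x in N. ennreal ((f k x - u x)\<^sup>2) \<le> ennreal ((C * exp (c * norm x))\<^sup>2)" for k
      using sq by (intro AE_I2 ennreal_leI)
    have "integrable N (\<lambda>x. (C * exp (c * norm x))\<^sup>2)"
    proof (rule integrable_square_exp_bounded[OF e])
      show "\<bar>C * exp (c * norm x)\<bar> \<le> \<bar>C\<bar> * exp (c * norm x)" for x by (simp add: abs_mult)
    qed
    then show "(\<integral>\<^sup>+x. ennreal ((C * exp (c * norm x))\<^sup>2) \<partial>N) < \<infinity>"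
      by (simp add: nn_integral_eq_integral)
    show "AE x in N. (\<lambda>k. ennreal ((f k x - u x)\<^sup>2)) \<longlonglongrightarrow> 0"
    proof (rule AE_I2)
      fix x
      have "(\<lambda>k. (f k x - u x)\<^sup>2) \<longlonglongrightarrow> (u x - u x)\<^sup>2" by (intro tendsto_intros lim)
      then show "(\<lambda>k. ennreal ((f k x - u x)\<^sup>2)) \<longlonglongrightarrow> 0"
        by (intro tendsto_ennrealI[where x=0, simplified]) simp
    qed
    show "(\<lambda>x. ennreal ((f k x - u x)\<^sup>2)) \<in> borel_measurable N" for k
      by (rule measurable_compose[OF borel_measurable_power[OF borel_measurable_diff[OF m]] measurable_ennreal])
    show "(\<lambda>x. ennreal ((C * exp (c * norm x))\<^sup>2)) \<in> borel_measurable N"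
      by (rule measurable_compose[OF borel_measurable_power[OF e] measurable_ennreal])
  qed simp
  then show ?thesis by (simp add: L2_tendsto_def)
qed

section \<open>Smooth cutoff functions\<close>

text \<open>Polynomials in \<open>1 / t\<close> times the flat exponential form a family closed
  under differentiation, so one formula yields the derivatives of all orders, those at 0
  included.\<close>

definition flat_fun :: "real poly \<Rightarrow> real \<Rightarrow> real" where
  "flat_fun p t = (if t > 0 then poly p (1 / t) * exp (- (1 / t)) else 0)"

lemma flat_fun_tendsto_0: "(flat_fun p \<longlongrightarrow> 0) (at 0)"
  unfolding filterlim_at_split
proof
  show "(flat_fun p \<longlongrightarrow> 0) (at_left 0)"
    by (rule tendsto_eventually) (auto simp: eventually_at_filter flat_fun_def)
  have "((\<lambda>s. \<Sum>i\<le>degree p. coeff p i * (s ^ i / exp s)) \<longlongrightarrow> (\<Sum>i\<le>degree p. coeff p i * 0)) at_top"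
    by (intro tendsto_intros tendsto_power_div_exp_0)
  then have "((\<lambda>s. poly p s * exp (- s)) \<longlongrightarrow> 0) at_top"
    by (simp add: poly_altdef sum_distrib_right exp_minus divide_inverse mult.assoc)
  then have "((\<lambda>t. poly p (inverse t) * exp (- inverse t)) \<longlongrightarrow> 0) (at_right 0)"
    by (rule filterlim_compose) (rule filterlim_inverse_at_top_right)
  then show "(flat_fun p \<longlongrightarrow> 0) (at_right 0)"
    by (rule Lim_transform_eventually) (auto simp: eventually_at_filter flat_fun_def inverse_eq_divide)
qed

text \<open>For positive \<open>t\<close> the derivative of \<open>1 / t\<close> is minus its
  square. The square multiplies the polynomial by \<open>[:0, 0, 1:]\<close>, and the sign turns the
  product rule into \<open>p - pderiv p\<close>.\<close>

lemma flat_fun_has_derivative: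
  "(flat_fun p has_real_derivative flat_fun ([:0, 0, 1:] * (p - pderiv p)) t) (at t)"
proof (cases t "0::real" rule: linorder_cases)
  case less
  have "((\<lambda>_. 0) has_real_derivative 0) (at t)" by simp
  then have "(flat_fun p has_real_derivative 0) (at t)"
    by (rule has_field_derivative_transform_within_open[where S="{..<0}"]) (use less in \<open>auto simp: flat_fun_def\<close>)
  then show ?thesis using less by (simp add: flat_fun_def)
next
  case greater
  have "((\<lambda>t. poly p (1 / t) * exp (- (1 / t))) has_real_derivative flat_fun ([:0, 0, 1:] * (p - pderiv p)) t) (at t)"
    using greater
    by (auto intro!: derivative_eq_intros DERIV_chain2[OF poly_DERIV] simp: flat_fun_def)
       (simp add: field_simps power2_eq_square)
  then show ?thesis
    by (rule has_field_derivative_transform_within_open[where S="{0<..}"]) (use greater in \<open>auto simp: flat_fun_def\<close>)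
next
  case equal
  \<comment> \<open>At 0 the difference quotient is again a \<open>flat_fun\<close>, with the
    polynomial multiplied by its variable.\<close>
  have "((\<lambda>y. (flat_fun p y - flat_fun p 0) / (y - 0)) \<longlongrightarrow> 0) (at 0)"
    by (rule Lim_transform_eventually[OF flat_fun_tendsto_0[of "pCons 0 p"]])
       (auto simp: eventually_at_filter flat_fun_def)
  then show ?thesis using equal by (simp add: has_field_derivative_iff flat_fun_def)
qed

text \<open>The constant \<open>exp 1\<close> normalises \<open>bump 0\<close> to the value 1 at 1,
  the argument that the cutoffs approach.\<close>

primrec bump_poly :: "nat \<Rightarrow> real poly" where
  "bump_poly 0 = [:exp 1:]"
| "bump_poly (Suc i) = [:0, 0, 1:] * (bump_poly i - pderiv (bump_poly i))"

definition bump :: "nat \<Rightarrow> real \<Rightarrow> real" where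
  "bump i = flat_fun (bump_poly i)"

lemma bump_has_derivative: "(bump i has_real_derivative bump (Suc i) t) (at t)"
  unfolding bump_def bump_poly.simps by (rule flat_fun_has_derivative)

lemma isCont_bump: "isCont (bump i) t"
  using bump_has_derivative DERIV_isCont by blast

lemma bump_0_1: "bump 0 1 = 1"
  by (simp add: bump_def flat_fun_def exp_minus)

lemma bump_nonpos: "t \<le> 0 \<Longrightarrow> bump i t = 0"
  by (simp add: bump_def flat_fun_def)

text \<open>For nonnegative \<open>s\<close> the argument of \<open>bump\<close> in
  \<open>cutoff\<close> is at most 1, so a bound on this half-line is uniform in \<open>s\<close>
  and \<open>x\<close>.\<close>

lemma bump_bounded: "\<exists>B. \<forall>t\<le>1. \<bar>bump i t\<bar> \<le> B"
proof -
  have "compact (bump i ` {0..1})"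
    by (intro compact_continuous_image continuous_at_imp_continuous_on) (auto intro: isCont_bump)
  then obtain B where B: "\<And>t. t \<in> {0..1} \<Longrightarrow> \<bar>bump i t\<bar> \<le> B"
    using compact_imp_bounded by (fastforce simp: bounded_iff)
  have "\<bar>bump i t\<bar> \<le> B" if "t \<le> 1" for t
    using B[of t] B[of 0] bump_nonpos[of t i] that by (cases "0 \<le> t") auto
  then show ?thesis by blast
qed

text \<open>\<open>bump i\<close> is the \<open>i\<close>-th derivative of \<open>exp (1 - 1 / t)\<close>, continued by 0 to \<open>t \<le> 0\<close>. The cutoff has
  no plateau: it suffices that it is bounded and tends to 1 pointwise as \<open>s\<close> tends to 0.\<close>

definition cutoff :: "real \<Rightarrow> 'a::euclidean_space \<Rightarrow> real" where
  "cutoff s x = bump 0 (1 - s * (x \<bullet> x))"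

lemma smooth_on_cutoff: "smooth_on UNIV (cutoff s :: 'a::euclidean_space \<Rightarrow> real)"
proof -
  have "smooth_on UNIV (\<lambda>x::'a. 1 + (- s) * (x \<bullet> x))"
    by (intro smooth_on_add smooth_on_const smooth_on_mult smooth_on_inner_self open_UNIV)
  then have "Ck_on k UNIV (\<lambda>x::'a. bump 0 (1 + (- s) * (x \<bullet> x)))" for k
    by (intro Ck_on_compose_real[where G=bump and f="\<lambda>x::'a. 1 + (- s) * (x \<bullet> x)", OF open_UNIV bump_has_derivative])
      (simp add: smooth_on_def)
  then show ?thesis by (simp add: smooth_on_def cutoff_def[abs_def])
qed

lemma gradient_cutoff: "gradient (cutoff s) x = (- 2 * s * bump 1 (1 - s * (x \<bullet> x))) *\<^sub>R x"
proof (rule gradient_unique)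
  have "((\<lambda>x. 1 - s * (x \<bullet> x)) has_derivative (\<lambda>h. - 2 * s * (x \<bullet> h))) (at x)"
    by (auto intro!: derivative_eq_intros simp: inner_commute)
  from has_derivative_compose[OF this bump_has_derivative[of 0, unfolded has_field_derivative_def]]
  show "(cutoff s has_derivative (\<bullet>) ((- 2 * s * bump 1 (1 - s * (x \<bullet> x))) *\<^sub>R x)) (at x)"
    unfolding cutoff_def[abs_def] by (rule has_derivative_eq_rhs) (simp add: fun_eq_iff)
qed

lemma trace_hess_cutoff:
  fixes x :: "'a::euclidean_space"
  shows "trace_hess (cutoff s) x = 4 * s\<^sup>2 * bump 2 (1 - s * (x \<bullet> x)) * (x \<bullet> x) - 2 * s * real DIM('a) * bump 1 (1 - s * (x \<bullet> x))"
proof -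
  have grad: "gradient (cutoff s) = (\<lambda>x::'a. (- 2 * s * bump 1 (1 - s * (x \<bullet> x))) *\<^sub>R x)"
    using gradient_cutoff by blast
  have "((\<lambda>x. 1 - s * (x \<bullet> x)) has_derivative (\<lambda>h. - 2 * s * (x \<bullet> h))) (at x)"
    by (auto intro!: derivative_eq_intros simp: inner_commute)
  from has_derivative_compose[OF this bump_has_derivative[of 1, unfolded has_field_derivative_def]]
  have d: "((\<lambda>x. bump 1 (1 - s * (x \<bullet> x))) has_derivative (\<lambda>h. bump 2 (1 - s * (x \<bullet> x)) * (- 2 * s * (x \<bullet> h)))) (at x)"
    by (simp add: numeral_2_eq_2)
  define A where "A = bump 1 (1 - s * (x \<bullet> x))"
  define E where "E = bump 2 (1 - s * (x \<bullet> x))"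
  have "(gradient (cutoff s) has_derivative (\<lambda>h. (- 2 * s * A) *\<^sub>R h + (- 2 * s * (E * (- 2 * s * (x \<bullet> h)))) *\<^sub>R x)) (at x)"
    unfolding grad A_def E_def by (intro has_derivative_scaleR has_derivative_mult_right d has_derivative_ident)
  then have hess: "hess (cutoff s) x = (\<lambda>h. (- 2 * s * A) *\<^sub>R h + (- 2 * s * (E * (- 2 * s * (x \<bullet> h)))) *\<^sub>R x)"
    by (rule frechet_derivative_eq_has_derivative)
  have "trace_hess (cutoff s) x = (\<Sum>b\<in>Basis. (- 2 * s * A) * (b \<bullet> b) + (4 * s\<^sup>2 * E) * ((x \<bullet> b) * (x \<bullet> b)))"
    unfolding trace_hess_def hess by (intro sum.cong refl, simp only: inner_add_left inner_scaleR_left power2_eq_square) algebra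
  also have "\<dots> = (- 2 * s * A) * (\<Sum>b\<in>(Basis::'a set). b \<bullet> b) + (4 * s\<^sup>2 * E) * (x \<bullet> x)"
    by (simp only: sum.distrib sum_distrib_left[symmetric] euclidean_inner[of x x])
  also have "(\<Sum>b\<in>(Basis::'a set). b \<bullet> b) = real DIM('a)" by simp
  finally show ?thesis by (simp add: A_def E_def)
qed

lemma abs_mult_le: "\<bar>a\<bar> \<le> A \<Longrightarrow> \<bar>b\<bar> \<le> B \<Longrightarrow> \<bar>a * b\<bar> \<le> A * B" for a b A B :: real
  unfolding abs_mult by (intro mult_mono) auto

text \<open>\<open>v\<close> is brought into the closure by cutoffs. The product rule turns the
  defect \<open>- ou_op (\<phi> k) x - l * v x\<close> into terms that contain the difference of the
  cutoff from 1 or a factor \<open>s k\<close>; they tend to 0 pointwise under a common exponential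
  bound.\<close>

lemma gaussian_eigenfunction:
  fixes v :: "real^'n \<Rightarrow> real"
  assumes v: "smooth_on UNIV v" and ev: "\<And>x. ou_op v x = - l * v x"
    and bv: "\<And>x. \<bar>v x\<bar> \<le> C * exp (c * norm x)" and bg: "\<And>x. norm (gradient v x) \<le> C * exp (c * norm x)"
  shows "v \<in> eigenspace TYPE('n) UNIV std_gaussian l"
proof -
  let ?\<gamma> = "density lborel (\<lambda>x::real^'n. ennreal (std_gaussian x))"
  \<comment> \<open>With this scale the cutoff vanishes outside the ball of radius
    \<open>k + 1\<close>.\<close>
  define s where "s = (\<lambda>k. 1 / (real (Suc k))\<^sup>2)"
  have s: "0 < s k" "s k \<le> 1" for k by (auto simp: s_def divide_le_eq_1 one_le_power)
  have s_lim: "s \<longlonglongrightarrow> 0"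
  proof -
    have "(\<lambda>k. (inverse (real (Suc k)))\<^sup>2) \<longlonglongrightarrow> 0\<^sup>2" by (intro tendsto_intros LIMSEQ_inverse_real_of_nat)
    then show ?thesis by (simp add: s_def inverse_eq_divide power_one_over)
  qed
  have C: "C \<ge> 0" using bv[of 0] by simp
  have cv: "continuous_on UNIV v" using v by (rule smooth_on_imp_continuous_on)
  define \<phi> where "\<phi> = (\<lambda>k x. cutoff (s k) x * v x)"
  have \<phi>: "smooth_on UNIV (\<phi> k)" for k
    unfolding \<phi>_def by (intro smooth_on_mult smooth_on_cutoff v open_UNIV)
  have test: "test_function UNIV (\<phi> k)" for k
    unfolding test_function_def
  proof (intro conjI exI ballI)
    show "smooth_on_manifold UNIV (\<phi> k)" by (rule smooth_on_imp_smooth_on_manifold[OF _ _ \<phi>]) auto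
    show "compact (cball (0::real^'n) (real (Suc k)))" by simp
    fix x :: "real^'n" assume "x \<in> UNIV - cball 0 (real (Suc k))"
    then have "real (Suc k) \<le> norm x" by auto
    then have "(real (Suc k))\<^sup>2 \<le> x \<bullet> x" by (simp add: dot_square_norm power_mono)
    then have "1 - s k * (x \<bullet> x) \<le> 0" by (simp add: s_def field_simps del: of_nat_Suc)
    then show "\<phi> k x = 0" by (simp add: \<phi>_def cutoff_def bump_nonpos)
  qed simp
  obtain B0 B1 B2 where B: "\<And>t. t \<le> 1 \<Longrightarrow> \<bar>bump 0 t\<bar> \<le> B0" "\<And>t. t \<le> 1 \<Longrightarrow> \<bar>bump 1 t\<bar> \<le> B1" "\<And>t. t \<le> 1 \<Longrightarrow> \<bar>bump 2 t\<bar> \<le> B2"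
    using bump_bounded[of 0] bump_bounded[of 1] bump_bounded[of 2] by metis
  have Bn: "B0 \<ge> 0" "B1 \<ge> 0" "B2 \<ge> 0" using B[of 1] by (auto intro: order_trans[OF abs_ge_zero])
  define t where "t = (\<lambda>k (x::real^'n). 1 - s k * (x \<bullet> x))"
  have t: "t k x \<le> 1" for k x using s(1)[of k] by (simp add: t_def)
  have t_lim: "(\<lambda>k. bump i (t k x)) \<longlonglongrightarrow> bump i 1" for i x
  proof (rule isCont_tendsto_compose[OF isCont_bump])
    have "(\<lambda>k. t k x) \<longlonglongrightarrow> 1 - 0 * (x \<bullet> x)" unfolding t_def by (intro tendsto_intros s_lim)
    then show "(\<lambda>k. t k x) \<longlonglongrightarrow> 1" by simp
  qed
  have \<phi>_lim: "(\<lambda>k. \<phi> k x) \<longlonglongrightarrow> v x" for x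
    using tendsto_mult[OF t_lim[of 0 x] tendsto_const[of "v x"]] by (simp add: \<phi>_def cutoff_def t_def bump_0_1)
  have \<phi>_bound: "\<bar>\<phi> k x - v x\<bar> \<le> ((B0 + 1) * C) * exp (c * norm x)" for k x
  proof -
    have "\<phi> k x - v x = (bump 0 (t k x) - 1) * v x" by (simp add: \<phi>_def cutoff_def t_def algebra_simps)
    then have "\<bar>\<phi> k x - v x\<bar> = \<bar>bump 0 (t k x) - 1\<bar> * \<bar>v x\<bar>" by (simp add: abs_mult)
    also have "\<dots> \<le> (B0 + 1) * (C * exp (c * norm x))"
      using B(1)[OF t, of k x] Bn by (intro mult_mono bv) auto
    finally show ?thesis by (simp add: mult.assoc)
  qed
  \<comment> \<open>\<open>q k\<close> is \<open>ou_op\<close> of the cutoff itself.\<close>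
  define q where "q = (\<lambda>k x. 4 * (s k)\<^sup>2 * bump 2 (t k x) * (x \<bullet> x) - 2 * s k * real CARD('n) * bump 1 (t k x) + 2 * s k * bump 1 (t k x) * (x \<bullet> x))"
  have L: "- ou_op (\<phi> k) x - l * v x = (bump 0 (t k x) - 1) * l * v x - v x * q k x + 4 * s k * bump 1 (t k x) * (x \<bullet> gradient v x)" for k x
  proof -
    have tr: "trace_hess (\<phi> k) x = cutoff (s k) x * trace_hess v x + v x * trace_hess (cutoff (s k)) x + 2 * (gradient (cutoff (s k)) x \<bullet> gradient v x)"
      and gr: "gradient (\<phi> k) x = cutoff (s k) x *\<^sub>R gradient v x + v x *\<^sub>R gradient (cutoff (s k)) x"
      unfolding \<phi>_def by (rule trace_hess_mult gradient_mult smooth_on_cutoff v)+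
    have c0: "cutoff (s k) x = bump 0 (t k x)" by (simp add: cutoff_def t_def)
    have c1: "gradient (cutoff (s k)) x \<bullet> gradient v x = - 2 * s k * bump 1 (t k x) * (x \<bullet> gradient v x)"
      by (simp add: gradient_cutoff t_def)
    have c2: "trace_hess (cutoff (s k)) x - x \<bullet> gradient (cutoff (s k)) x = q k x"
      by (simp add: trace_hess_cutoff gradient_cutoff q_def t_def)
    have "ou_op (\<phi> k) x = cutoff (s k) x * ou_op v x + v x * (trace_hess (cutoff (s k)) x - x \<bullet> gradient (cutoff (s k)) x) +
        2 * (gradient (cutoff (s k)) x \<bullet> gradient v x)"
      unfolding ou_op_def tr gr inner_add_right inner_scaleR_right by algebra
    also have "\<dots> = bump 0 (t k x) * (- l * v x) + v x * q k x + 2 * (- 2 * s k * bump 1 (t k x) * (x \<bullet> gradient v x))"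
      by (simp only: c0 c1 c2 ev)
    finally have *: "ou_op (\<phi> k) x = bump 0 (t k x) * (- l * v x) + v x * q k x + 2 * (- 2 * s k * bump 1 (t k x) * (x \<bullet> gradient v x))" .
    show ?thesis unfolding * by algebra
  qed
  have L_lim: "(\<lambda>k. - ou_op (\<phi> k) x) \<longlonglongrightarrow> l * v x" for x
  proof -
    have "(\<lambda>k. (bump 0 (t k x) - 1) * l * v x - v x * q k x + 4 * s k * bump 1 (t k x) * (x \<bullet> gradient v x)) \<longlonglongrightarrow>
       (bump 0 1 - 1) * l * v x - v x * (4 * 0\<^sup>2 * bump 2 1 * (x \<bullet> x) - 2 * 0 * real CARD('n) * bump 1 1 + 2 * 0 * bump 1 1 * (x \<bullet> x))
         + 4 * 0 * bump 1 1 * (x \<bullet> gradient v x)"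
      unfolding q_def by (intro tendsto_intros t_lim s_lim)
    then have "(\<lambda>k. - ou_op (\<phi> k) x - l * v x) \<longlonglongrightarrow> 0" unfolding L by (simp add: bump_0_1)
    then show ?thesis by (simp add: LIM_zero_iff)
  qed
  \<comment> \<open>The sum of the bounds for the three terms of \<open>L\<close>. Raising the
    exponent to \<open>c + 1\<close> absorbs the factors \<open>norm x\<close> and
    \<open>x \<bullet> x\<close>.\<close>
  define D where "D = (B0 + 1) * \<bar>l\<bar> + (8 * B2 + 2 * real CARD('n) * B1 + 4 * B1) + 4 * B1"
  have L_bound: "\<bar>- ou_op (\<phi> k) x - l * v x\<bar> \<le> (D * C) * exp ((c + 1) * norm x)" for k x
  proof -
    define X where "X = exp (norm x)"
    define Y where "Y = C * exp (c * norm x)"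
    have X: "1 \<le> X" "norm x \<le> X" "x \<bullet> x \<le> 2 * X"
    proof -
      show "1 \<le> X" by (simp add: X_def)
      show "norm x \<le> X" unfolding X_def using exp_ge_add_one_self[of "norm x"] by linarith
      show "x \<bullet> x \<le> 2 * X"
        using power_le_exp[of "norm x" 2] by (simp add: X_def dot_square_norm numeral_2_eq_2)
    qed
    have Y: "Y \<ge> 0" "\<bar>v x\<bar> \<le> Y" "norm (gradient v x) \<le> Y" using C bv bg by (auto simp: Y_def)
    have xx: "0 \<le> x \<bullet> x" by simp
    note b = B(1)[OF t, of k x] B(2)[OF t, of k x] B(3)[OF t, of k x]
    have sa: "\<bar>s k\<bar> \<le> 1" "\<bar>(s k)\<^sup>2\<bar> \<le> 1" using s[of k] by (simp_all add: power_le_one)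
    have xa: "\<bar>x \<bullet> x\<bar> \<le> 2 * X" using X by simp
    have 1: "\<bar>(bump 0 (t k x) - 1) * l * v x\<bar> \<le> ((B0 + 1) * \<bar>l\<bar>) * (Y * X)"
    proof -
      have "\<bar>(bump 0 (t k x) - 1) * l * v x\<bar> \<le> (B0 + 1) * \<bar>l\<bar> * Y"
        using b(1) Y(2) by (intro abs_mult_le) auto
      also have "\<dots> \<le> ((B0 + 1) * \<bar>l\<bar>) * (Y * X)"
        using Bn Y X mult_left_mono[of 1 X Y] by (intro mult_left_mono) auto
      finally show ?thesis .
    qed
    have q1: "\<bar>4 * (s k)\<^sup>2 * bump 2 (t k x) * (x \<bullet> x)\<bar> \<le> 4 * 1 * B2 * (2 * X)"
      by (intro abs_mult_le b sa xa) simp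
    have q2: "\<bar>2 * s k * real CARD('n) * bump 1 (t k x)\<bar> \<le> 2 * 1 * real CARD('n) * B1"
      by (intro abs_mult_le b sa) simp_all
    have q3: "\<bar>2 * s k * bump 1 (t k x) * (x \<bullet> x)\<bar> \<le> 2 * 1 * B1 * (2 * X)"
      by (intro abs_mult_le b sa xa) simp
    have q4: "2 * real CARD('n) * B1 \<le> 2 * real CARD('n) * B1 * X"
      using X Bn mult_left_mono[of 1 X "2 * real CARD('n) * B1"] by simp
    have "\<bar>q k x\<bar> \<le> (8 * B2 + 2 * real CARD('n) * B1 + 4 * B1) * X"
      using q1 q2 q3 q4 unfolding q_def distrib_right by linarith
    then have "\<bar>v x * q k x\<bar> \<le> Y * ((8 * B2 + 2 * real CARD('n) * B1 + 4 * B1) * X)"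
      by (intro abs_mult_le Y)
    then have 2: "\<bar>v x * q k x\<bar> \<le> (8 * B2 + 2 * real CARD('n) * B1 + 4 * B1) * (Y * X)"
      by (simp only: mult.left_commute)
    have "\<bar>x \<bullet> gradient v x\<bar> \<le> X * Y"
      using Cauchy_Schwarz_ineq2[of x "gradient v x"] mult_mono[OF X(2) Y(3)] X(1) by simp
    then have 3: "\<bar>4 * s k * bump 1 (t k x) * (x \<bullet> gradient v x)\<bar> \<le> 4 * 1 * B1 * (X * Y)"
      by (intro abs_mult_le b sa) simp_all
    have "\<bar>- ou_op (\<phi> k) x - l * v x\<bar> \<le> D * (Y * X)"
      using 1 2 3 unfolding L D_def mult.commute[of X Y] by (simp only: distrib_right[of _ _ "Y * X"])
    also have "\<dots> = (D * C) * exp ((c + 1) * norm x)"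
      by (simp add: X_def Y_def distrib_right exp_add)
    finally show ?thesis .
  qed
  have m: "f \<in> borel_measurable ?\<gamma>" if "continuous_on UNIV f" for f :: "real^'n \<Rightarrow> real"
    using borel_measurable_continuous_onI[OF that] by simp
  have "square_integrable ?\<gamma> v" by (rule gaussian_square_integrable[OF cv bv])
  moreover have "square_integrable ?\<gamma> (\<lambda>x. l * v x)"
  proof (rule gaussian_square_integrable)
    show "\<bar>l * v x\<bar> \<le> (\<bar>l\<bar> * C) * exp (c * norm x)" for x
      unfolding abs_mult mult.assoc by (rule mult_left_mono[OF bv]) simp
  qed (intro continuous_intros cv)
  moreover have "L2_tendsto ?\<gamma> \<phi> v"
    using \<phi>_bound \<phi>_lim
    by (intro gaussian.L2_tendsto_dominated m cv smooth_on_imp_continuous_on \<phi>)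
  moreover have "L2_tendsto ?\<gamma> (\<lambda>k x. - weighted_laplacian UNIV std_gaussian (\<phi> k) x) (\<lambda>x. l * v x)"
  proof -
    have "(\<lambda>k x. - weighted_laplacian UNIV std_gaussian (\<phi> k) x) = (\<lambda>k x. - ou_op (\<phi> k) x)"
      by (simp add: weighted_laplacian_gaussian_ou_op[OF \<phi>])
    moreover have "L2_tendsto ?\<gamma> (\<lambda>k x. - ou_op (\<phi> k) x) (\<lambda>x. l * v x)"
      using L_bound L_lim
      by (intro gaussian.L2_tendsto_dominated m continuous_intros cv continuous_on_ou_op \<phi>)
    ultimately show ?thesis by (simp only:)
  qed
  ultimately show ?thesis
    unfolding eigenspace_def neg_weighted_laplacian_graph_def weighted_measure_gaussian mem_Collect_eq prod.case
    using test by blast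
qed

lemma gradient_inner: "gradient (\<lambda>x. a \<bullet> x) x = a"
  using gradient_linear_power[of a 1 x] by simp

lemma trace_hess_inner: "trace_hess (\<lambda>x. a \<bullet> x) x = 0"
  using trace_hess_linear_power[of a 1 x] by simp

lemma norm_le_exp: "norm x \<le> exp (norm x)"
  using exp_ge_add_one_self[of "norm x"] by linarith

lemma norm_square_le_exp: "(norm x)\<^sup>2 \<le> 2 * exp (norm x)"
  using power_le_exp[of "norm x" 2] by (simp add: numeral_2_eq_2)

lemma ex_distinct_indices:
  assumes "CARD('n::finite) \<ge> 2" shows "\<exists>i j :: 'n. i \<noteq> j"
proof (rule ccontr)
  assume "\<not> ?thesis"
  then have "(UNIV :: 'n set) = {undefined}" by auto
  then have "CARD('n) = 1" by (metis card_1_singleton_iff One_nat_def)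
  with assms show False by simp
qed

lemma gaussian_compact_support_square_integrable:
  fixes f :: "real^'n \<Rightarrow> real"
  assumes "continuous_on UNIV f" "compact K" "\<And>x. x \<notin> K \<Longrightarrow> f x = 0"
  shows "square_integrable (density lborel (\<lambda>x. ennreal (std_gaussian x))) f"
proof -
  obtain C where "\<And>x. \<bar>f x\<bar> \<le> C" using compact_support_bounded[OF assms] by blast
  then show ?thesis using gaussian_square_integrable[OF assms(1), of C 0] by simp
qed

theorem linear_world_gaussian:
  assumes card: "CARD('n::finite) \<ge> 2"
  shows "linear_world TYPE('n) (UNIV :: (real^'n) set) std_gaussian real"
proof -
  let ?\<gamma> = "density lborel (\<lambda>x::real^'n. ennreal (std_gaussian x))"
  have support: "\<exists>K. smooth_on UNIV \<phi> \<and> compact K \<and> (\<forall>x. x \<notin> K \<longrightarrow> \<phi> x = 0)"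
    if "test_function UNIV \<phi>" for \<phi> :: "real^'n \<Rightarrow> real"
    using gaussian_test_function[OF that] by blast
  have D: "weighted_laplacian UNIV std_gaussian \<phi> = ou_op \<phi>" if "test_function UNIV \<phi>" for \<phi> :: "real^'n \<Rightarrow> real"
    using support[OF that] weighted_laplacian_gaussian_ou_op by blast
  show ?thesis
  proof (unfold_locales, unfold weighted_measure_gaussian)
    fix \<phi> :: "real^'n \<Rightarrow> real" assume t: "test_function UNIV \<phi>"
    then obtain K where K: "smooth_on UNIV \<phi>" "compact K" "\<And>x. x \<notin> K \<Longrightarrow> \<phi> x = 0" using support by blast
    note c = smooth_on_imp_continuous_on[OF K(1)] continuous_on_ou_op[OF K(1)]
    show "square_integrable ?\<gamma> \<phi>" by (rule gaussian_compact_support_square_integrable[OF c(1) K(2,3)])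
    show "square_integrable ?\<gamma> (\<lambda>x. - weighted_laplacian UNIV std_gaussian \<phi> x)"
      unfolding D[OF t]
      by (rule gaussian_compact_support_square_integrable[OF _ K(2)])
        (use c ou_op_support[OF K] in \<open>auto intro!: continuous_intros\<close>)
    fix a :: "real^'n" and k
    define v where "v = (\<lambda>x. (a \<bullet> x) ^ k)"
    have v: "smooth_on UNIV v" unfolding v_def by (rule smooth_on_linear_power)
    note cv = smooth_on_imp_continuous_on[OF v] continuous_on_ou_op[OF v]
    have ev: "real k * (a \<bullet> x) ^ k - real (k * (k - 1)) * (a \<bullet> a) * (a \<bullet> x) ^ (k - 2) = - ou_op v x" for x
      unfolding v_def by (rule ou_op_linear_power[symmetric])
    have "(LINT x|?\<gamma>. - weighted_laplacian UNIV std_gaussian \<phi> x * (a \<bullet> x) ^ k) = (LINT x|?\<gamma>. - (ou_op \<phi> x * v x))"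
      unfolding D[OF t] v_def by simp
    also have "\<dots> = - (LINT x|?\<gamma>. ou_op \<phi> x * v x)" by simp
    also have "(LINT x|?\<gamma>. ou_op \<phi> x * v x) = (LINT x|lborel. std_gaussian x * (ou_op \<phi> x * v x))"
      by (intro integral_gaussian borel_measurable_continuous_onI continuous_intros c cv)
    also have "\<dots> = (LINT x|lborel. std_gaussian x * (\<phi> x * ou_op v x))"
      by (rule green_gaussian[OF K(1) v K(2,3)])
    also have "\<dots> = (LINT x|?\<gamma>. \<phi> x * ou_op v x)"
      by (intro integral_gaussian[symmetric] borel_measurable_continuous_onI continuous_intros c cv)
    also have "- \<dots> = (LINT x|?\<gamma>. \<phi> x * - ou_op v x)" by simp
    finally show "(LINT x|?\<gamma>. - weighted_laplacian UNIV std_gaussian \<phi> x * (a \<bullet> x) ^ k) =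
        (LINT x|?\<gamma>. \<phi> x * (real k * (a \<bullet> x) ^ k - real (k * (k - 1)) * (a \<bullet> a) * (a \<bullet> x) ^ (k - 2)))"
      unfolding ev .
  next
    fix a :: "real^'n" assume "AE x in ?\<gamma>. a \<bullet> x = 0"
    then have "a \<bullet> a = 0" by (rule AE_zero_gaussian) (intro continuous_intros)
    then show "a = 0" by simp
  next
    fix a :: "real^'n"
    show "(\<lambda>x. a \<bullet> x) \<in> eigenspace TYPE('n) UNIV std_gaussian (real 1)"
    proof (rule gaussian_eigenfunction[OF smooth_on_inner])
      show "ou_op (\<lambda>x. a \<bullet> x) x = - real 1 * (a \<bullet> x)" for x
        by (simp add: ou_op_def trace_hess_inner gradient_inner inner_commute[of x a])
      show "\<bar>a \<bullet> x\<bar> \<le> norm a * exp (1 * norm x)" for x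
        using order_trans[OF Cauchy_Schwarz_ineq2 mult_left_mono[OF norm_le_exp]] by simp
      show "norm (gradient (\<lambda>x. a \<bullet> x) x) \<le> norm a * exp (1 * norm x)" for x
        using mult_left_mono[of 1 "exp (norm x)" "norm a"] by (simp add: gradient_inner)
    qed
  next
    \<comment> \<open>The product of two different coordinates is harmonic and homogeneous of degree
      two: the trace contributes nothing and the drift multiplies by 2. This is where dimension at
      least two enters.\<close>
    obtain i j :: 'n where ij: "i \<noteq> j" using ex_distinct_indices[OF card] by blast
    define a :: "real^'n" where "a = axis i 1"
    define b :: "real^'n" where "b = axis j 1"
    have ab: "norm a = 1" "norm b = 1" "a \<bullet> b = 0" "b \<bullet> a = 0" "a \<bullet> a = 1" "b \<bullet> b = 1"
      using ij by (simp_all add: a_def b_def inner_axis_axis)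
    define v where "v = (\<lambda>x. (a \<bullet> x) * (b \<bullet> x))"
    have sv: "smooth_on UNIV v" unfolding v_def by (intro smooth_on_mult smooth_on_inner open_UNIV)
    have g: "gradient v x = (a \<bullet> x) *\<^sub>R b + (b \<bullet> x) *\<^sub>R a" for x
      unfolding v_def by (simp add: gradient_mult[OF smooth_on_inner smooth_on_inner] gradient_inner)
    have "v \<in> eigenspace TYPE('n) UNIV std_gaussian (real 2)"
    proof (rule gaussian_eigenfunction[OF sv])
      fix x
      have "trace_hess v x = 0"
        unfolding v_def by (simp add: trace_hess_mult[OF smooth_on_inner smooth_on_inner] trace_hess_inner gradient_inner ab)
      moreover have "x \<bullet> gradient v x = 2 * v x"
        unfolding g by (simp add: v_def inner_add_right inner_commute[of x])
      ultimately show "ou_op v x = - real 2 * v x" by (simp add: ou_op_def)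
      have n: "\<bar>a \<bullet> x\<bar> \<le> norm x" "\<bar>b \<bullet> x\<bar> \<le> norm x"
        using Cauchy_Schwarz_ineq2[of a x] Cauchy_Schwarz_ineq2[of b x] ab by auto
      have "\<bar>v x\<bar> \<le> (norm x)\<^sup>2" unfolding v_def power2_eq_square by (intro abs_mult_le n)
      also have "\<dots> \<le> 2 * exp (1 * norm x)" using norm_square_le_exp by simp
      finally show "\<bar>v x\<bar> \<le> 2 * exp (1 * norm x)" .
      have "norm (gradient v x) \<le> \<bar>a \<bullet> x\<bar> + \<bar>b \<bullet> x\<bar>"
        unfolding g using norm_triangle_ineq[of "(a \<bullet> x) *\<^sub>R b" "(b \<bullet> x) *\<^sub>R a"] ab by simp
      also have "\<dots> \<le> 2 * exp (1 * norm x)" using n norm_le_exp[of x] by simp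
      finally show "norm (gradient v x) \<le> 2 * exp (1 * norm x)" .
    qed
    moreover have "\<not> (AE x in weighted_measure TYPE('n) UNIV std_gaussian. v x = 0)"
      unfolding weighted_measure_gaussian
    proof
      assume "AE x in ?\<gamma>. v x = 0"
      \<comment> \<open>At \<open>a + b\<close> both coordinates are 1.\<close>
      then have "v (a + b) = 0"
        by (rule AE_zero_gaussian[OF _ smooth_on_imp_continuous_on[OF sv]])
      then show False by (simp add: v_def inner_add_right ab)
    qed
    ultimately show "real 2 \<in> eigenvalues TYPE('n) (UNIV :: (real^'n) set) std_gaussian"
      unfolding eigenvalues_def by blast
  qed (use gaussian.exp_int gaussian.sets_N in \<open>auto simp: strict_mono_def\<close>)
qed

section \<open>The spherical world\<close>

lemma emeasure_lborel_orthogonal: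
  fixes f :: "real^'n \<Rightarrow> real^'n"
  assumes f: "orthogonal_transformation f" and A: "A \<in> sets borel"
  shows "emeasure lborel (f -` A) = emeasure lborel A"
proof -
  have lin: "bounded_linear f"
    using f orthogonal_transformation_linear linear_conv_bounded_linear by blast
  have m: "f \<in> borel_measurable borel"
    using lin by (intro borel_measurable_continuous_onI linear_continuous_on)
  have B: "f -` A \<in> sets borel" using measurable_sets[OF m A] by simp
  have img: "f ` (f -` A) = A"
    using orthogonal_transformation_surj[OF f] by (simp add: image_vimage_eq)
  have det: "\<bar>det (matrix f)\<bar> = 1" using f by (rule orthogonal_transformation_det)
  have "emeasure lborel (f ` (f -` A)) = (\<integral>\<^sup>+x\<in>f -` A. ennreal \<bar>det (matrix f)\<bar> \<partial>lborel)"
    by (rule emeasure_differentiable_image[OF B])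
      (use lin A B img orthogonal_transformation_inj[OF f] in
        \<open>auto simp: det intro: bounded_linear_imp_has_derivative inj_on_subset\<close>)
  then show ?thesis using B unfolding img det by simp
qed

text \<open>A linear map that preserves norms commutes with radial projection, so the cone over a
  preimage is the preimage of the cone, and Lebesgue measure is invariant.\<close>

lemma sphere_measure_distr_orthogonal:
  fixes f :: "real^'n \<Rightarrow> real^'n"
  assumes R: "R > 0" and f: "orthogonal_transformation f"
  shows "distr (sphere_measure R) (restrict_space borel (sphere 0 R)) f = sphere_measure R"
proof -
  let ?S = "sphere (0::real^'n) R" and ?c = "ennreal (real CARD('n) / R)"
  have lin: "linear f" using f by (rule orthogonal_transformation_linear)
  have nf: "norm (f x) = norm x" for x using f by (rule orthogonal_transformation_norm)
  have m: "f \<in> restrict_space borel ?S \<rightarrow>\<^sub>M restrict_space borel ?S"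
  proof (rule measurable_restrict_space2)
    have "f \<in> borel_measurable borel"
      using lin by (intro borel_measurable_continuous_onI linear_continuous_on) (simp add: linear_conv_bounded_linear)
    then show "f \<in> borel_measurable (restrict_space borel ?S)" by (rule measurable_restrict_space1)
  qed (auto simp: space_restrict_space nf)
  then have m': "f \<in> sphere_measure R \<rightarrow>\<^sub>M restrict_space borel ?S"
    by (simp add: measurable_cong_sets[OF sets_sphere_measure refl])
  show ?thesis
  proof (rule measure_eqI)
    fix A assume "A \<in> sets (distr (sphere_measure R) (restrict_space borel ?S) f)"
    then have A: "A \<in> sets (restrict_space borel ?S)" by simp
    then have Ab: "A \<in> sets borel" "A \<subseteq> ?S" by (auto simp: sets_restrict_space_iff)
    have pre: "f -` A \<inter> ?S \<in> sets (restrict_space borel ?S)"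
      using measurable_sets[OF m A] by (simp add: space_restrict_space)
    define Q where "Q = {x \<in> cball (0::real^'n) R - {0}. (R / norm x) *\<^sub>R x \<in> A}"
    have Q: "Q \<in> sets borel" unfolding Q_def by (rule sphere_cone_measurable[OF Ab(1)])
    have "{x \<in> cball 0 R - {0}. (R / norm x) *\<^sub>R x \<in> f -` A \<inter> ?S} = f -` Q"
    proof (intro set_eqI)
      fix x
      have "f x = 0 \<longleftrightarrow> x = 0" using nf[of x] by (metis norm_eq_zero)
      moreover have "x \<noteq> 0 \<Longrightarrow> (R / norm x) *\<^sub>R x \<in> ?S" using R by simp
      ultimately show "x \<in> {x \<in> cball 0 R - {0}. (R / norm x) *\<^sub>R x \<in> f -` A \<inter> ?S} \<longleftrightarrow> x \<in> f -` Q"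
        by (auto simp: Q_def nf linear_cmul[OF lin])
    qed
    then have "emeasure (sphere_measure R) (f -` A \<inter> ?S) = ?c * emeasure lborel (f -` Q)"
      by (subst emeasure_sphere_measure[OF R pre]) simp
    also have "\<dots> = emeasure (sphere_measure R) A"
      using emeasure_lborel_orthogonal[OF f Q] emeasure_sphere_measure[OF R A] by (simp only: Q_def)
    finally show "emeasure (distr (sphere_measure R) (restrict_space borel ?S) f) A = emeasure (sphere_measure R) A"
      using A m' by (simp add: emeasure_distr)
  qed (simp add: sets_sphere_measure)
qed

lemma emeasure_sphere_measure_space:
  assumes R: "R > 0"
  shows "0 < emeasure (sphere_measure R) (sphere (0::real^'n) R)"
    and "emeasure (sphere_measure R) (sphere (0::real^'n) R) < \<infinity>"
proof -
  have eq: "{x \<in> cball 0 R - {0}. (R / norm x) *\<^sub>R x \<in> sphere (0::real^'n) R} = cball 0 R - {0}"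
    using R by auto
  have S: "sphere (0::real^'n) R \<in> sets (restrict_space borel (sphere 0 R))" by (simp add: sets_restrict_space_iff)
  have "emeasure lborel (cball (0::real^'n) R - {0}) < \<infinity>"
    by (rule emeasure_bounded_finite) (rule bounded_diff, simp)
  then show "emeasure (sphere_measure R) (sphere (0::real^'n) R) < \<infinity>"
    unfolding emeasure_sphere_measure[OF R S] eq by (simp add: ennreal_mult_less_top)
  have "0 < emeasure lborel (ball (0::real^'n) R - {0})"
  proof (rule ccontr)
    assume "\<not> ?thesis"
    then have "ball (0::real^'n) R - {0} \<in> null_sets lborel" by (auto simp: null_sets_def)
    then have "negligible (ball (0::real^'n) R - {0})" by (simp add: negligible_iff_null_sets null_sets_completionI)
    then have "ball (0::real^'n) R - {0} = {}" using open_not_negligible[of "ball (0::real^'n) R - {0}"] by (metis open_ball open_delete)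
    moreover have "(R / 2) *\<^sub>R axis undefined 1 \<in> ball (0::real^'n) R - {0}" using R by (simp add: axis_eq_0_iff)
    ultimately show False by blast
  qed
  also have "\<dots> \<le> emeasure lborel (cball (0::real^'n) R - {0})" by (rule emeasure_mono) auto
  finally show "0 < emeasure (sphere_measure R) (sphere (0::real^'n) R)"
    unfolding emeasure_sphere_measure[OF R S] eq using R by (simp add: ennreal_zero_less_mult_iff)
qed

lemma finite_sphere_measure: "R > 0 \<Longrightarrow> finite_measure (sphere_measure R :: (real^'n) measure)"
  using emeasure_sphere_measure_space(2)[of R] by (intro finite_measureI) (simp add: less_top)

lemma measurable_sphere_measure:
  "continuous_on (sphere 0 R) f \<Longrightarrow> f \<in> borel_measurable (sphere_measure R :: (real^'n) measure)"
  for f :: "real^'n \<Rightarrow> real"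
  unfolding measurable_cong_sets[OF sets_sphere_measure refl] by (rule borel_measurable_continuous_on_restrict)

lemma continuous_sphere_bounded:
  fixes f :: "real^'n \<Rightarrow> real"
  assumes "continuous_on (sphere 0 R) f" shows "\<exists>C. \<forall>x\<in>sphere 0 R. \<bar>f x\<bar> \<le> C"
proof -
  have "bounded (f ` sphere 0 R)"
    using assms by (intro compact_imp_bounded compact_continuous_image) auto
  then show ?thesis by (auto simp: bounded_iff)
qed

lemma integrable_sphere_measure:
  fixes f :: "real^'n \<Rightarrow> real"
  assumes "R > 0" "continuous_on (sphere 0 R) f"
  shows "integrable (sphere_measure R) f"
proof -
  interpret finite_measure "sphere_measure R :: (real^'n) measure" using finite_sphere_measure assms(1) .
  obtain C where "\<forall>x\<in>sphere 0 R. \<bar>f x\<bar> \<le> C" using continuous_sphere_bounded[OF assms(2)] by blast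
  then show ?thesis
    by (intro integrable_const_bound[where B=C] measurable_sphere_measure assms(2) AE_I2) auto
qed

text \<open>If \<open>f\<close> were nonzero at \<open>x\<close>, the cone over its nonvanishing set
  would contain a nonempty open set, which has positive volume.\<close>

lemma AE_zero_sphere:
  fixes f :: "real^'n \<Rightarrow> real"
  assumes R: "R > 0" and ae: "AE x in sphere_measure R. f x = 0" and f: "continuous_on (sphere 0 R) f"
    and x: "x \<in> sphere 0 R"
  shows "f x = 0"
proof (rule ccontr)
  assume fx: "f x \<noteq> 0"
  let ?S = "sphere (0::real^'n) R"
  define A where "A = {x \<in> ?S. f x \<noteq> 0}"
  have fm: "f \<in> borel_measurable (sphere_measure R)" by (rule measurable_sphere_measure[OF f])
  have A: "A \<in> sets (restrict_space borel ?S)"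
  proof -
    have "f -` (- {0}) \<inter> space (sphere_measure R) \<in> sets (sphere_measure R)" by (rule measurable_sets[OF fm]) simp
    moreover have "f -` (- {0}) \<inter> space (sphere_measure R) = A" by (auto simp: A_def)
    ultimately show ?thesis by (simp add: sets_sphere_measure)
  qed
  have "emeasure (sphere_measure R) A = 0"
    using ae A unfolding A_def by (subst (asm) AE_iff_measurable[OF _ refl]) (auto simp: sets_sphere_measure)
  then have z: "emeasure lborel {y \<in> cball 0 R - {0}. (R / norm y) *\<^sub>R y \<in> A} = 0"
    unfolding emeasure_sphere_measure[OF R A] using R by (auto simp: ennreal_eq_0_iff divide_le_0_iff)
  define O' where "O' = {y \<in> ball 0 R - {0::real^'n}. f ((R / norm y) *\<^sub>R y) \<noteq> 0}"
  have "continuous_on (ball 0 R - {0}) (\<lambda>y. f ((R / norm y) *\<^sub>R y))"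
    by (rule continuous_on_compose2[OF f]) (use R in \<open>auto intro!: continuous_intros split: if_splits\<close>)
  then have "open ((ball 0 R - {0}) \<inter> (\<lambda>y. f ((R / norm y) *\<^sub>R y)) -` (- {0}))"
    by (rule continuous_open_preimage) auto
  moreover have "(ball 0 R - {0}) \<inter> (\<lambda>y. f ((R / norm y) *\<^sub>R y)) -` (- {0}) = O'" by (auto simp: O'_def)
  ultimately have op: "open O'" by simp
  have sub: "O' \<subseteq> {y \<in> cball 0 R - {0}. (R / norm y) *\<^sub>R y \<in> A}"
    using R by (auto simp: O'_def A_def)
  define Q where "Q = {y \<in> cball 0 R - {0}. (R / norm y) *\<^sub>R y \<in> A}"
  have Ab: "A \<in> sets borel" using A by (auto simp: sets_restrict_space_iff)
  have Q: "Q \<in> sets lborel"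
    unfolding Q_def sets_lborel by (rule sphere_cone_measurable[OF Ab])
  have "emeasure lborel O' \<le> emeasure lborel Q"
    using sub Q unfolding Q_def[symmetric] by (rule emeasure_mono)
  then have "emeasure lborel O' = 0" unfolding z[folded Q_def] by simp
  then have "O' \<in> null_sets lborel" using op by (auto simp: null_sets_def)
  then have "negligible O'" by (simp add: negligible_iff_null_sets null_sets_completionI)
  then have "O' = {}" using open_not_negligible[OF op] by blast
  moreover have "(1/2) *\<^sub>R x \<in> O'"
  proof -
    have "norm x = R" using x by simp
    then have "(R / norm ((1/2) *\<^sub>R x)) *\<^sub>R ((1/2) *\<^sub>R x) = x" using R by simp
    then show ?thesis using fx R \<open>norm x = R\<close> unfolding O'_def by auto
  qed
  ultimately show False by blast
qed

section \<open>Flows of plane rotations\<close>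

text \<open>For orthonormal \<open>e\<close> and \<open>f\<close> this is rotation by the angle
  \<open>t\<close> in their plane and the identity on the orthogonal complement.\<close>

definition rot :: "'a::real_inner \<Rightarrow> 'a \<Rightarrow> real \<Rightarrow> 'a \<Rightarrow> 'a" where
  "rot e f t x = x + ((cos t - 1) * (x \<bullet> e) - sin t * (x \<bullet> f)) *\<^sub>R e +
     ((cos t - 1) * (x \<bullet> f) + sin t * (x \<bullet> e)) *\<^sub>R f"

text \<open>The velocity field of \<open>rot\<close> at time 0; for coordinate vectors it is the
  field of the differential operator \<open>x_i d_j - x_j d_i\<close>.\<close>

definition rot_gen :: "'a::real_inner \<Rightarrow> 'a \<Rightarrow> 'a \<Rightarrow> 'a" where
  "rot_gen e f x = (x \<bullet> e) *\<^sub>R f - (x \<bullet> f) *\<^sub>R e"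

text \<open>The Lie derivative along the rotation flow. Orbits stay on the sphere, so only the
  values of \<open>F\<close> there enter and no extension has to be chosen.\<close>

definition flow_deriv :: "'a::real_inner \<Rightarrow> 'a \<Rightarrow> ('a \<Rightarrow> real) \<Rightarrow> 'a \<Rightarrow> real" where
  "flow_deriv e f F x = deriv (\<lambda>t. F (rot e f t x)) 0"

lemma rot_0 [simp]: "rot e f 0 x = x"
  by (simp add: rot_def)

lemma rot_has_vector_derivative: "((\<lambda>t. rot e f t x) has_vector_derivative rot_gen e f x) (at 0)"
  unfolding rot_def rot_gen_def by (auto intro!: derivative_eq_intros simp: algebra_simps)

context
  fixes e f :: "'a::real_inner"
  assumes e: "e \<bullet> e = 1" and f: "f \<bullet> f = 1" and ef: "e \<bullet> f = 0"
begin

lemma rot_inner: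
  "rot e f t x \<bullet> e = cos t * (x \<bullet> e) - sin t * (x \<bullet> f)"
  "rot e f t x \<bullet> f = cos t * (x \<bullet> f) + sin t * (x \<bullet> e)"
  using e f ef by (simp_all add: rot_def inner_add_left inner_commute[of f e] algebra_simps)

text \<open>The group law serves to move derivatives at time 0 to arbitrary times.\<close>

lemma rot_rot: "rot e f s (rot e f t x) = rot e f (s + t) x"
proof -
  have 1: "(cos s - 1) * (cos t * (x \<bullet> e) - sin t * (x \<bullet> f)) - sin s * (cos t * (x \<bullet> f) + sin t * (x \<bullet> e)) +
      ((cos t - 1) * (x \<bullet> e) - sin t * (x \<bullet> f)) = (cos (s + t) - 1) * (x \<bullet> e) - sin (s + t) * (x \<bullet> f)"
    by (simp add: cos_add sin_add algebra_simps)
  have 2: "(cos s - 1) * (cos t * (x \<bullet> f) + sin t * (x \<bullet> e)) + sin s * (cos t * (x \<bullet> e) - sin t * (x \<bullet> f)) +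
      ((cos t - 1) * (x \<bullet> f) + sin t * (x \<bullet> e)) = (cos (s + t) - 1) * (x \<bullet> f) + sin (s + t) * (x \<bullet> e)"
    by (simp add: cos_add sin_add algebra_simps)
  have "rot e f s (rot e f t x) = rot e f t x + ((cos s - 1) * (cos t * (x \<bullet> e) - sin t * (x \<bullet> f)) - sin s * (cos t * (x \<bullet> f) + sin t * (x \<bullet> e))) *\<^sub>R e
      + ((cos s - 1) * (cos t * (x \<bullet> f) + sin t * (x \<bullet> e)) + sin s * (cos t * (x \<bullet> e) - sin t * (x \<bullet> f))) *\<^sub>R f"
    by (simp only: rot_def[of e f s "rot e f t x"] rot_inner)
  also have "\<dots> = rot e f (s + t) x"
    unfolding rot_def[of e f "s + t"] 1[symmetric] 2[symmetric] rot_def[of e f t x]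
    by (simp only: scaleR_left_distrib add_ac)
  finally show ?thesis .
qed

lemma orthogonal_transformation_rot: "orthogonal_transformation (rot e f t)"
  unfolding orthogonal_transformation
proof (intro conjI allI)
  show "linear (rot e f t)"
    by (intro linearI) (simp_all add: rot_def inner_add_left algebra_simps)
  fix x
  define a b where "a = x \<bullet> e" and "b = x \<bullet> f"
  define u w where "u = (cos t - 1) * a - sin t * b" and "w = (cos t - 1) * b + sin t * a"
  have r: "rot e f t x = x + u *\<^sub>R e + w *\<^sub>R f" by (simp add: rot_def u_def w_def a_def b_def)
  have "rot e f t x \<bullet> rot e f t x = x \<bullet> x + 2 * (u * a + w * b) + u * u + w * w"
    unfolding r using e f ef
    by (simp add: inner_add_left inner_add_right inner_commute[of f e] inner_commute[of e x] inner_commute[of f x] a_def b_def algebra_simps)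
  also have "\<dots> = x \<bullet> x + ((sin t)\<^sup>2 + (cos t)\<^sup>2 - 1) * (a * a + b * b)"
    unfolding u_def w_def by algebra
  finally show "norm (rot e f t x) = norm x" by (simp add: norm_eq_sqrt_inner)
qed

end

lemma continuous_on_locally:
  fixes F :: "'a::t2_space \<Rightarrow> 'b::topological_space"
  assumes "\<And>x. x \<in> S \<Longrightarrow> \<exists>U h. open U \<and> x \<in> U \<and> continuous_on U h \<and> (\<forall>y\<in>U \<inter> S. h y = F y)"
  shows "continuous_on S F"
  unfolding continuous_on_def
proof
  fix x assume x: "x \<in> S"
  from assms[OF x] obtain U h where
    "open U \<and> x \<in> U \<and> continuous_on U h \<and> (\<forall>y\<in>U \<inter> S. h y = F y)"
    by (elim exE)
  then have U: "open U" "x \<in> U" "continuous_on U h" "\<And>y. y \<in> U \<Longrightarrow> y \<in> S \<Longrightarrow> h y = F y"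
    by auto
  have "isCont h x" using U(1-3) by (simp add: continuous_on_eq_continuous_at)
  then have "(h \<longlongrightarrow> h x) (at x within S)"
    using continuous_at_imp_continuous_at_within continuous_within by blast
  moreover have "\<forall>\<^sub>F y in at x within S. h y = F y"
    unfolding eventually_at_topological using U by blast
  ultimately have "(F \<longlongrightarrow> h x) (at x within S)" by (rule Lim_transform_eventually)
  then show "(F \<longlongrightarrow> F x) (at x within S)" using U(2,4) x by simp
qed

lemma smooth_on_manifoldE:
  assumes "smooth_on_manifold M \<phi>" "x \<in> M"
  obtains U g where "open U" "x \<in> U" "smooth_on U g" "\<And>y. y \<in> U \<Longrightarrow> y \<in> M \<Longrightarrow> g y = \<phi> y"
proof -
  from assms have "\<exists>U g. open U \<and> x \<in> U \<and> smooth_on U g \<and> (\<forall>y\<in>U \<inter> M. g y = \<phi> y)"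
    by (simp add: smooth_on_manifold_def)
  then obtain U g where "open U \<and> x \<in> U \<and> smooth_on U g \<and> (\<forall>y\<in>U \<inter> M. g y = \<phi> y)"
    by (elim exE)
  then show thesis by (intro that[of U g]) auto
qed

text \<open>Differentiability is required at time 0 only; the group law spreads it along orbits.
  Continuity on the compact sphere gives bounds and integrability.\<close>

definition flow_smooth :: "real \<Rightarrow> real^'n \<Rightarrow> real^'n \<Rightarrow> (real^'n \<Rightarrow> real) \<Rightarrow> (real^'n \<Rightarrow> real) \<Rightarrow> bool" where
  "flow_smooth R e f F F' \<longleftrightarrow> continuous_on (sphere 0 R) F \<and> continuous_on (sphere 0 R) F' \<and>
    (\<forall>x\<in>sphere 0 R. ((\<lambda>t. F (rot e f t x)) has_real_derivative F' x) (at 0))"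

lemma linear_rot_gen: "linear (rot_gen e f)"
  by (intro linearI) (simp_all add: rot_gen_def inner_add_left algebra_simps)

context
  fixes e f :: "real^'n" and R :: real
  assumes e: "e \<bullet> e = 1" and f: "f \<bullet> f = 1" and ef: "e \<bullet> f = 0" and R: "R > 0"
begin

lemma rot_in_sphere: "x \<in> sphere 0 R \<Longrightarrow> rot e f t x \<in> sphere 0 R"
  by (simp add: orthogonal_transformation_norm[OF orthogonal_transformation_rot[OF e f ef]])

text \<open>Rotation invariance of the surface measure makes every difference quotient along the
  flow integrate to 0, and the mean value theorem provides a constant dominating function.\<close>

lemma flow_integral_zero:
  assumes F: "flow_smooth R e f F F'"
  shows "(LINT x|sphere_measure R. F' x) = 0"
proof -
  let ?\<nu> = "sphere_measure R :: (real^'n) measure"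
  interpret finite_measure ?\<nu> using finite_sphere_measure[OF R] .
  have c: "continuous_on (sphere 0 R) F" "continuous_on (sphere 0 R) F'"
    and d0: "\<And>x. x \<in> sphere 0 R \<Longrightarrow> ((\<lambda>t. F (rot e f t x)) has_real_derivative F' x) (at 0)"
    using F by (auto simp: flow_smooth_def)
  \<comment> \<open>The derivative at time \<open>t\<close> is the derivative at time 0 with the
    rotated point as origin.\<close>
  have d: "((\<lambda>t. F (rot e f t x)) has_real_derivative F' (rot e f t x)) (at t)" if x: "x \<in> sphere 0 R" for x t
  proof -
    have "((\<lambda>s. F (rot e f (s + t) x)) has_real_derivative F' (rot e f t x)) (at 0)"
      using d0[OF rot_in_sphere[OF x], of t] unfolding rot_rot[OF e f ef] .
    then show ?thesis using DERIV_shift[of "\<lambda>t. F (rot e f t x)" _ 0 t] by simp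
  qed
  obtain C where C: "\<And>x. x \<in> sphere 0 R \<Longrightarrow> \<bar>F' x\<bar> \<le> C" using continuous_sphere_bounded[OF c(2)] by blast
  define q where "q = (\<lambda>k x. real (Suc k) * (F (rot e f (1 / real (Suc k)) x) - F x))"
  have cr: "continuous_on (sphere 0 R) (\<lambda>x. F (rot e f t x))" for t
  proof (rule continuous_on_compose2[OF c(1)])
    show "continuous_on (sphere 0 R) (rot e f t)" unfolding rot_def by (intro continuous_intros)
    show "rot e f t ` sphere 0 R \<subseteq> sphere 0 R" using rot_in_sphere by blast
  qed
  have inv: "(LINT x|?\<nu>. F (rot e f t x)) = (LINT x|?\<nu>. F x)" for t
  proof -
    have o: "orthogonal_transformation (rot e f t)" by (rule orthogonal_transformation_rot[OF e f ef])
    have m: "rot e f t \<in> ?\<nu> \<rightarrow>\<^sub>M restrict_space borel (sphere 0 R)"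
    proof (rule measurable_restrict_space2)
      have "rot e f t \<in> borel_measurable borel"
        unfolding rot_def by (intro borel_measurable_continuous_onI continuous_intros)
      then show "rot e f t \<in> borel_measurable ?\<nu>"
        unfolding measurable_cong_sets[OF sets_sphere_measure refl] by (rule measurable_restrict_space1)
    qed (use rot_in_sphere in auto)
    have "(LINT x|?\<nu>. F (rot e f t x)) = (LINT x|distr ?\<nu> (restrict_space borel (sphere 0 R)) (rot e f t). F x)"
      by (rule integral_distr[symmetric, OF m]) (rule borel_measurable_continuous_on_restrict[OF c(1)])
    then show ?thesis unfolding sphere_measure_distr_orthogonal[OF R o] .
  qed
  have "(\<lambda>k. LINT x|?\<nu>. q k x) \<longlonglongrightarrow> (LINT x|?\<nu>. F' x)"
  proof (rule integral_dominated_convergence[where w="\<lambda>_. C"])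
    show "F' \<in> borel_measurable ?\<nu>" by (rule measurable_sphere_measure[OF c(2)])
    show "q k \<in> borel_measurable ?\<nu>" for k
      unfolding q_def by (intro measurable_sphere_measure continuous_intros cr c)
    show "AE x in ?\<nu>. (\<lambda>k. q k x) \<longlonglongrightarrow> F' x"
    proof (rule AE_I2)
      fix x assume "x \<in> space ?\<nu>"
      then show "(\<lambda>k. q k x) \<longlonglongrightarrow> F' x"
        using DERIV_LIMSEQ[OF d0[of x]] by (simp add: q_def)
    qed
    show "AE x in ?\<nu>. norm (q k x) \<le> C" for k
    proof (rule AE_I2)
      fix x assume "x \<in> space ?\<nu>"
      then have x: "x \<in> sphere 0 R" by simp
      define s where "s = 1 / real (Suc k)"
      have s: "0 < s" by (simp add: s_def)
      obtain \<xi> where \<xi>: "F (rot e f s x) - F (rot e f 0 x) = (s - 0) * F' (rot e f \<xi> x)"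
        using MVT2[OF s, of "\<lambda>t. F (rot e f t x)" "\<lambda>t. F' (rot e f t x)", OF d[OF x]] by blast
      then have "q k x = F' (rot e f \<xi> x)" by (simp add: q_def s_def)
      then show "norm (q k x) \<le> C" using C[OF rot_in_sphere[OF x]] by simp
    qed
  qed simp
  moreover have "(LINT x|?\<nu>. q k x) = 0" for k
    unfolding q_def using inv[of "1 / real (Suc k)"]
    by (simp add: integrable_sphere_measure[OF R] cr c)
  ultimately show ?thesis by (simp add: LIMSEQ_const_iff)
qed

lemma flow_integral_by_parts:
  assumes F: "flow_smooth R e f F F'" and G: "flow_smooth R e f G G'"
  shows "(LINT x|sphere_measure R. F' x * G x) = - (LINT x|sphere_measure R. F x * G' x)"
proof -
  have c: "continuous_on (sphere 0 R) F" "continuous_on (sphere 0 R) F'" "continuous_on (sphere 0 R) G" "continuous_on (sphere 0 R) G'"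
    using F G by (auto simp: flow_smooth_def)
  have "flow_smooth R e f (\<lambda>x. F x * G x) (\<lambda>x. F' x * G x + F x * G' x)"
    unfolding flow_smooth_def
  proof (intro conjI ballI)
    fix x :: "real^'n" assume x: "x \<in> sphere 0 R"
    have "((\<lambda>t. F (rot e f t x)) has_real_derivative F' x) (at 0)" "((\<lambda>t. G (rot e f t x)) has_real_derivative G' x) (at 0)"
      using F G x by (auto simp: flow_smooth_def)
    from DERIV_mult[OF this]
    show "((\<lambda>t. F (rot e f t x) * G (rot e f t x)) has_real_derivative F' x * G x + F x * G' x) (at 0)"
      by (simp add: mult.commute)
  qed (intro continuous_intros c)+
  from flow_integral_zero[OF this] show ?thesis
    by (simp add: integrable_sphere_measure[OF R] continuous_on_mult c)
qed

text \<open>The orbit of \<open>x\<close> stays on the sphere and for small times in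
  \<open>U\<close>, where \<open>F\<close> coincides with the differentiable
  \<open>h\<close>.\<close>

lemma flow_derivative_extension:
  assumes x: "x \<in> sphere 0 R" "x \<in> U" and U: "open U" and h: "(h has_derivative h') (at x)"
    and eq: "\<And>y. y \<in> U \<Longrightarrow> y \<in> sphere 0 R \<Longrightarrow> h y = F y"
  shows "((\<lambda>t. F (rot e f t x)) has_real_derivative h' (rot_gen e f x)) (at 0)"
proof -
  have r: "((\<lambda>t. rot e f t x) has_derivative (\<lambda>t. t *\<^sub>R rot_gen e f x)) (at 0)"
    using rot_has_vector_derivative by (simp add: has_vector_derivative_def)
  have "(h has_derivative h') (at (rot e f 0 x))" using h by simp
  from has_derivative_compose[OF r this]
  have "((\<lambda>t. h (rot e f t x)) has_derivative (\<lambda>t. h' (t *\<^sub>R rot_gen e f x))) (at 0)" .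
  moreover have "h' (t *\<^sub>R rot_gen e f x) = h' (rot_gen e f x) * t" for t
    using linear_cmul[OF has_derivative_linear[OF h], of t] by (simp add: mult.commute)
  ultimately have d: "((\<lambda>t. h (rot e f t x)) has_real_derivative h' (rot_gen e f x)) (at 0)"
    by (simp add: has_field_derivative_def)
  have "continuous_on UNIV (\<lambda>t. rot e f t x)" unfolding rot_def by (intro continuous_intros)
  then have op: "open {t. rot e f t x \<in> U}" using open_vimage[OF U, of "\<lambda>t. rot e f t x"] by (simp add: vimage_def)
  show ?thesis
    by (rule has_field_derivative_transform_within_open[OF d op]) (use x eq rot_in_sphere in auto)
qed

text \<open>The linear map \<open>rot_gen\<close> is its own derivative, so the product rule for
  \<open>gradient g y \<bullet> rot_gen e f y\<close> produces a Hessian term and a term with the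
  generator applied twice.\<close>

lemma flow_deriv_extension:
  assumes x: "x \<in> sphere 0 R" "x \<in> U" and U: "open U" "smooth_on U g"
    and eq: "\<And>y. y \<in> U \<Longrightarrow> y \<in> sphere 0 R \<Longrightarrow> g y = \<phi> y"
  shows "((\<lambda>t. \<phi> (rot e f t x)) has_real_derivative gradient g x \<bullet> rot_gen e f x) (at 0)"
    and "flow_deriv e f \<phi> x = gradient g x \<bullet> rot_gen e f x"
    and "((\<lambda>t. flow_deriv e f \<phi> (rot e f t x)) has_real_derivative
      hess g x (rot_gen e f x) \<bullet> rot_gen e f x + gradient g x \<bullet> rot_gen e f (rot_gen e f x)) (at 0)"
    and "flow_deriv e f (flow_deriv e f \<phi>) x =
      hess g x (rot_gen e f x) \<bullet> rot_gen e f x + gradient g x \<bullet> rot_gen e f (rot_gen e f x)"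
proof -
  have d: "((\<lambda>t. \<phi> (rot e f t y)) has_real_derivative gradient g y \<bullet> rot_gen e f y) (at 0)"
    if "y \<in> U" "y \<in> sphere 0 R" for y
    using flow_derivative_extension[OF that(2,1) U(1) has_derivative_gradient[OF U(2,1) that(1)]] eq by blast
  show "((\<lambda>t. \<phi> (rot e f t x)) has_real_derivative gradient g x \<bullet> rot_gen e f x) (at 0)"
    by (rule d) (use x in auto)
  have fd: "flow_deriv e f \<phi> y = gradient g y \<bullet> rot_gen e f y" if "y \<in> U" "y \<in> sphere 0 R" for y
    unfolding flow_deriv_def by (rule DERIV_imp_deriv[OF d[OF that]])
  then show "flow_deriv e f \<phi> x = gradient g x \<bullet> rot_gen e f x" using x by blast
  have rg: "(rot_gen e f has_derivative rot_gen e f) (at x)"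
    using linear_rot_gen linear_conv_bounded_linear bounded_linear_imp_has_derivative by blast
  have "((\<lambda>y. gradient g y \<bullet> rot_gen e f y) has_derivative
      (\<lambda>h. gradient g x \<bullet> rot_gen e f h + hess g x h \<bullet> rot_gen e f x)) (at x)"
    by (rule has_derivative_inner[OF has_derivative_hess[OF U(2,1) x(2)] rg])
  from flow_derivative_extension[OF x U(1) this]
  show d2: "((\<lambda>t. flow_deriv e f \<phi> (rot e f t x)) has_real_derivative
      hess g x (rot_gen e f x) \<bullet> rot_gen e f x + gradient g x \<bullet> rot_gen e f (rot_gen e f x)) (at 0)"
    using fd by (simp add: add.commute)
  show "flow_deriv e f (flow_deriv e f \<phi>) x =
      hess g x (rot_gen e f x) \<bullet> rot_gen e f x + gradient g x \<bullet> rot_gen e f (rot_gen e f x)"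
    unfolding flow_deriv_def[of e f "flow_deriv e f \<phi>"] by (rule DERIV_imp_deriv[OF d2])
qed

lemma flow_smooth_manifold:
  assumes \<phi>: "smooth_on_manifold (sphere 0 R) \<phi>"
  shows "flow_smooth R e f \<phi> (flow_deriv e f \<phi>)"
    and "flow_smooth R e f (flow_deriv e f \<phi>) (flow_deriv e f (flow_deriv e f \<phi>))"
proof -
  have crg: "continuous_on U (rot_gen e f)" for U
    using linear_rot_gen linear_conv_bounded_linear linear_continuous_on by blast
  have c: "continuous_on (sphere 0 R) \<phi>" "continuous_on (sphere 0 R) (flow_deriv e f \<phi>)"
    "continuous_on (sphere 0 R) (flow_deriv e f (flow_deriv e f \<phi>))"
  proof -
    have loc1: "\<exists>U h. open U \<and> x \<in> U \<and> continuous_on U h \<and> (\<forall>y\<in>U \<inter> sphere 0 R. h y = \<phi> y)"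
      and loc2: "\<exists>U h. open U \<and> x \<in> U \<and> continuous_on U h \<and> (\<forall>y\<in>U \<inter> sphere 0 R. h y = flow_deriv e f \<phi> y)"
      and loc3: "\<exists>U h. open U \<and> x \<in> U \<and> continuous_on U h \<and> (\<forall>y\<in>U \<inter> sphere 0 R. h y = flow_deriv e f (flow_deriv e f \<phi>) y)"
      if x: "x \<in> sphere 0 R" for x
    proof -
      obtain U g where U: "open U" "x \<in> U" "smooth_on U g" "\<And>y. y \<in> U \<Longrightarrow> y \<in> sphere 0 R \<Longrightarrow> g y = \<phi> y"
        by (rule smooth_on_manifoldE[OF \<phi> x], rule that)
      note ext = flow_deriv_extension[OF _ _ U(1,3,4)]
      have crr: "continuous_on U (\<lambda>y. rot_gen e f (rot_gen e f y))"
        by (rule continuous_on_compose2[OF crg crg]) auto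
      have 1: "continuous_on U g" using U by (simp add: smooth_on_imp_continuous_on)
      have 2: "continuous_on U (\<lambda>y. gradient g y \<bullet> rot_gen e f y)"
        by (intro continuous_intros continuous_on_gradient U crg)
      have 3: "continuous_on U (\<lambda>y. hess g y (rot_gen e f y) \<bullet> rot_gen e f y + gradient g y \<bullet> rot_gen e f (rot_gen e f y))"
        by (intro continuous_intros continuous_on_gradient continuous_on_hess U crg crr)
      show "\<exists>U h. open U \<and> x \<in> U \<and> continuous_on U h \<and> (\<forall>y\<in>U \<inter> sphere 0 R. h y = \<phi> y)"
        by (intro exI[of _ U] exI[of _ g]) (use U 1 in auto)
      show "\<exists>U h. open U \<and> x \<in> U \<and> continuous_on U h \<and> (\<forall>y\<in>U \<inter> sphere 0 R. h y = flow_deriv e f \<phi> y)"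
        by (intro exI[of _ U] exI[of _ "\<lambda>y. gradient g y \<bullet> rot_gen e f y"] conjI ballI U 2) (use ext(2) in auto)
      show "\<exists>U h. open U \<and> x \<in> U \<and> continuous_on U h \<and> (\<forall>y\<in>U \<inter> sphere 0 R. h y = flow_deriv e f (flow_deriv e f \<phi>) y)"
        by (intro exI[of _ U] conjI ballI U exI[of _ "\<lambda>y. hess g y (rot_gen e f y) \<bullet> rot_gen e f y + gradient g y \<bullet> rot_gen e f (rot_gen e f y)"] 3)
          (use ext(4) in auto)
    qed
    show "continuous_on (sphere 0 R) \<phi>" by (rule continuous_on_locally) (rule loc1)
    show "continuous_on (sphere 0 R) (flow_deriv e f \<phi>)" by (rule continuous_on_locally) (rule loc2)
    show "continuous_on (sphere 0 R) (flow_deriv e f (flow_deriv e f \<phi>))" by (rule continuous_on_locally) (rule loc3)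
  qed
  have d: "((\<lambda>t. \<phi> (rot e f t x)) has_real_derivative flow_deriv e f \<phi> x) (at 0)"
    "((\<lambda>t. flow_deriv e f \<phi> (rot e f t x)) has_real_derivative flow_deriv e f (flow_deriv e f \<phi>) x) (at 0)"
    if x: "x \<in> sphere 0 R" for x
  proof -
    obtain U g where U: "open U" "x \<in> U" "smooth_on U g" "\<And>y. y \<in> U \<Longrightarrow> y \<in> sphere 0 R \<Longrightarrow> g y = \<phi> y"
      by (rule smooth_on_manifoldE[OF \<phi> x], rule that)
    have ext: "flow_deriv e f \<phi> x = gradient g x \<bullet> rot_gen e f x"
      "flow_deriv e f (flow_deriv e f \<phi>) x =
        hess g x (rot_gen e f x) \<bullet> rot_gen e f x + gradient g x \<bullet> rot_gen e f (rot_gen e f x)"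
      by (rule flow_deriv_extension[OF x U(2,1,3)], rule U(4), assumption, assumption)+
    show "((\<lambda>t. \<phi> (rot e f t x)) has_real_derivative flow_deriv e f \<phi> x) (at 0)"
      unfolding ext(1) by (rule flow_deriv_extension(1)[OF x U(2,1,3)]) (rule U(4))
    show "((\<lambda>t. flow_deriv e f \<phi> (rot e f t x)) has_real_derivative flow_deriv e f (flow_deriv e f \<phi>) x) (at 0)"
      unfolding ext(2) by (rule flow_deriv_extension(3)[OF x U(2,1,3)]) (rule U(4))
  qed
  show "flow_smooth R e f \<phi> (flow_deriv e f \<phi>)"
    unfolding flow_smooth_def by (intro conjI ballI c d(1))
  show "flow_smooth R e f (flow_deriv e f \<phi>) (flow_deriv e f (flow_deriv e f \<phi>))"
    unfolding flow_smooth_def by (intro conjI ballI c d(2))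
qed

text \<open>Two integrations by parts, whose signs cancel.\<close>

lemma flow_deriv_symmetric:
  assumes \<phi>: "smooth_on_manifold (sphere 0 R) \<phi>" and \<psi>: "smooth_on_manifold (sphere 0 R) \<psi>"
  shows "(LINT x|sphere_measure R. flow_deriv e f (flow_deriv e f \<phi>) x * \<psi> x) =
    (LINT x|sphere_measure R. \<phi> x * flow_deriv e f (flow_deriv e f \<psi>) x)"
  using flow_integral_by_parts[OF flow_smooth_manifold(2)[OF \<phi>] flow_smooth_manifold(1)[OF \<psi>]]
    flow_integral_by_parts[OF flow_smooth_manifold(1)[OF \<phi>] flow_smooth_manifold(2)[OF \<psi>]]
  by linarith

end

section \<open>The spherical Laplacian as a sum of squares\<close>

text \<open>The formula of \<open>laplacian_sphere\<close> for an ambient extension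
  \<open>g\<close>, named so that it can be evaluated on functions of the whole space.\<close>

definition sphere_laplacian :: "real \<Rightarrow> (real^'n \<Rightarrow> real) \<Rightarrow> real^'n \<Rightarrow> real" where
  "sphere_laplacian R g x =
    trace_hess g x - (hess g x x \<bullet> x) / R\<^sup>2 - (real CARD('n) - 1) * (gradient g x \<bullet> x) / R\<^sup>2"

lemma laplacian_sphere_extension:
  fixes \<phi> :: "real^'n \<Rightarrow> real"
  assumes "R > 0" "x \<in> sphere 0 R" "x \<in> U" "open U" "smooth_on U g"
    and "\<And>y. y \<in> U \<Longrightarrow> y \<in> sphere 0 R \<Longrightarrow> g y = \<phi> y"
  shows "laplacian (sphere 0 R) \<phi> x = sphere_laplacian R g x"
  using laplacian_sphere[OF assms] by (simp add: sphere_laplacian_def trace_hess_def)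

text \<open>A Casimir identity at a point. Each coordinate plane is counted as \<open>(i, j)\<close>
  and as \<open>(j, i)\<close>, hence the factor 2. Applying a generator twice gives minus the
  projection to its plane, and each coordinate lies in dimension minus one planes, hence the
  first-order term.\<close>

lemma sum_rot_gen:
  fixes H :: "real^'n \<Rightarrow> real^'n" and G x :: "real^'n"
  assumes H: "linear H"
  shows "(\<Sum>i\<in>UNIV. \<Sum>j\<in>UNIV - {i}. H (rot_gen (axis i 1) (axis j 1) x) \<bullet> rot_gen (axis i 1) (axis j 1) x +
      G \<bullet> rot_gen (axis i 1) (axis j 1) (rot_gen (axis i 1) (axis j 1) x)) =
    2 * ((x \<bullet> x) * (\<Sum>i\<in>UNIV. H (axis i 1) \<bullet> axis i 1) - H x \<bullet> x - (real CARD('n) - 1) * (G \<bullet> x))"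
proof -
  define h where "h = (\<lambda>i j. H (axis i 1) \<bullet> axis j (1::real))"
  \<comment> \<open>\<open>T\<close> is the quadratic form of \<open>H\<close> at the generator and
    \<open>S\<close> the negated first-order part. On the diagonal \<open>T\<close> vanishes and
    \<open>S\<close> does not, so completing the sums to all pairs costs the diagonal of
    \<open>S\<close>.\<close>
  define T where "T = (\<lambda>i j. (x $ i)\<^sup>2 * h j j - x $ i * x $ j * (h i j + h j i) + (x $ j)\<^sup>2 * h i i)"
  define S where "S = (\<lambda>i j. x $ i * G $ i + x $ j * G $ j)"
  have tm: "H (rot_gen (axis i 1) (axis j 1) x) \<bullet> rot_gen (axis i 1) (axis j 1) x +
      G \<bullet> rot_gen (axis i 1) (axis j 1) (rot_gen (axis i 1) (axis j 1) x) = T i j - S i j" if "j \<noteq> i" for i j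
  proof -
    have r: "rot_gen (axis i 1) (axis j 1) y = (y $ i) *\<^sub>R axis j 1 - (y $ j) *\<^sub>R axis i 1" for y
      by (simp add: rot_gen_def inner_axis)
    have He: "H ((x $ i) *\<^sub>R axis j 1 - (x $ j) *\<^sub>R axis i 1) = (x $ i) *\<^sub>R H (axis j 1) - (x $ j) *\<^sub>R H (axis i 1)"
      using H by (simp add: linear_diff linear_cmul)
    have 1: "H (rot_gen (axis i 1) (axis j 1) x) \<bullet> rot_gen (axis i 1) (axis j 1) x = T i j"
      unfolding r He inner_diff_left inner_diff_right inner_scaleR_left inner_scaleR_right T_def h_def power2_eq_square
      by algebra
    have "rot_gen (axis i 1) (axis j 1) (rot_gen (axis i 1) (axis j 1) x) = - ((x $ j) *\<^sub>R axis j 1) - (x $ i) *\<^sub>R axis i 1"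
      unfolding r using that by (simp add: axis_def)
    then have 2: "G \<bullet> rot_gen (axis i 1) (axis j 1) (rot_gen (axis i 1) (axis j 1) x) = - S i j"
      by (simp add: inner_diff_right inner_axis S_def)
    show ?thesis unfolding 1 2 by simp
  qed
  have T0: "T i i = 0" for i by (simp add: T_def power2_eq_square algebra_simps)
  have x_exp: "x = (\<Sum>i\<in>UNIV. (x $ i) *\<^sub>R axis i 1)"
    by (simp add: vec_eq_iff axis_def if_distrib cong: if_cong)
  have Hx: "H x \<bullet> x = (\<Sum>i\<in>UNIV. \<Sum>j\<in>UNIV. x $ i * x $ j * h i j)"
  proof -
    have "H x = (\<Sum>i\<in>UNIV. (x $ i) *\<^sub>R H (axis i 1))"
      by (subst x_exp) (simp only: linear_sum[OF H] linear_cmul[OF H])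
    then have "H x \<bullet> x = (\<Sum>i\<in>UNIV. x $ i * (H (axis i 1) \<bullet> x))" by (simp add: inner_sum_left)
    also have "\<dots> = (\<Sum>i\<in>UNIV. \<Sum>j\<in>UNIV. x $ i * x $ j * h i j)"
    proof (rule sum.cong[OF refl])
      fix i
      have "H (axis i 1) \<bullet> x = (\<Sum>j\<in>UNIV. x $ j * h i j)"
        by (subst x_exp) (simp only: inner_sum_right inner_scaleR_right h_def)
      then show "x $ i * (H (axis i 1) \<bullet> x) = (\<Sum>j\<in>UNIV. x $ i * x $ j * h i j)"
        by (simp add: sum_distrib_left mult.assoc)
    qed
    finally show ?thesis .
  qed
  have xx: "x \<bullet> x = (\<Sum>i\<in>UNIV. (x $ i)\<^sup>2)" by (simp add: inner_vec_def power2_eq_square)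
  have Gx: "G \<bullet> x = (\<Sum>i\<in>UNIV. x $ i * G $ i)" by (simp add: inner_vec_def mult.commute)
  have split: "(\<Sum>j\<in>UNIV - {i}. f j) = (\<Sum>j\<in>UNIV. f j) - f i" for i and f :: "'n \<Rightarrow> real"
    by (simp add: sum_diff1)
  have sumT: "(\<Sum>i\<in>UNIV. \<Sum>j\<in>UNIV. T i j) = 2 * ((x \<bullet> x) * (\<Sum>i\<in>UNIV. h i i) - H x \<bullet> x)"
  proof -
    have 1: "(\<Sum>i\<in>UNIV. \<Sum>j\<in>UNIV. (x $ i)\<^sup>2 * h j j) = (x \<bullet> x) * (\<Sum>i\<in>UNIV. h i i)"
      unfolding xx sum_product ..
    have 2: "(\<Sum>i\<in>UNIV. \<Sum>j\<in>UNIV. (x $ j)\<^sup>2 * h i i) = (x \<bullet> x) * (\<Sum>i\<in>UNIV. h i i)"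
      by (subst sum.swap) (rule 1)
    have 3: "(\<Sum>i\<in>UNIV. \<Sum>j\<in>UNIV. x $ i * x $ j * h j i) = H x \<bullet> x"
      unfolding Hx by (subst sum.swap) (simp only: mult.commute[of "x $ _" "x $ _"])
    have "(\<Sum>i\<in>UNIV. \<Sum>j\<in>UNIV. T i j) = (\<Sum>i\<in>UNIV. \<Sum>j\<in>UNIV. (x $ i)\<^sup>2 * h j j) -
        ((\<Sum>i\<in>UNIV. \<Sum>j\<in>UNIV. x $ i * x $ j * h i j) + (\<Sum>i\<in>UNIV. \<Sum>j\<in>UNIV. x $ i * x $ j * h j i)) +
        (\<Sum>i\<in>UNIV. \<Sum>j\<in>UNIV. (x $ j)\<^sup>2 * h i i)"
      unfolding T_def by (simp only: sum.distrib sum_subtractf distrib_left)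
    then show ?thesis unfolding 1 2 3 Hx[symmetric] by simp
  qed
  have sumS: "(\<Sum>i\<in>UNIV. \<Sum>j\<in>UNIV. S i j) = 2 * real CARD('n) * (G \<bullet> x)"
    unfolding S_def Gx by (simp add: sum.distrib sum_distrib_left mult.assoc)
  have diagS: "(\<Sum>i\<in>UNIV. S i i) = 2 * (G \<bullet> x)"
  proof -
    have "S i i = 2 * (x $ i * G $ i)" for i by (simp add: S_def)
    then show ?thesis by (simp only: Gx sum_distrib_left)
  qed
  have "(\<Sum>i\<in>UNIV. \<Sum>j\<in>UNIV - {i}. H (rot_gen (axis i 1) (axis j 1) x) \<bullet> rot_gen (axis i 1) (axis j 1) x +
      G \<bullet> rot_gen (axis i 1) (axis j 1) (rot_gen (axis i 1) (axis j 1) x)) = (\<Sum>i\<in>UNIV. \<Sum>j\<in>UNIV - {i}. T i j - S i j)"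
    by (intro sum.cong refl) (simp add: tm)
  also have "\<dots> = (\<Sum>i\<in>UNIV. (\<Sum>j\<in>UNIV. T i j) - (\<Sum>j\<in>UNIV. S i j) + S i i)"
    by (simp add: split T0 sum_subtractf sum.distrib algebra_simps)
  also have "\<dots> = 2 * ((x \<bullet> x) * (\<Sum>i\<in>UNIV. h i i) - H x \<bullet> x) - 2 * real CARD('n) * (G \<bullet> x) + 2 * (G \<bullet> x)"
    by (simp only: sum.distrib sum_subtractf sumT sumS diagS)
  finally show ?thesis by (simp add: h_def algebra_simps)
qed

lemma sum_Basis_vec: "(\<Sum>b\<in>Basis. h b) = (\<Sum>i\<in>UNIV. h (axis i (1::real)))"
  for h :: "real^'n \<Rightarrow> 'b::comm_monoid_add"
  by (rule sum.reindex_bij_betw[OF bij_betw_axis_Basis, symmetric])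

text \<open>On the sphere \<open>x \<bullet> x\<close> is \<open>R\<^sup>2\<close>, so
  \<open>sum_rot_gen\<close> becomes \<open>2 * R\<^sup>2\<close> times
  \<open>sphere_laplacian\<close> of a local extension.\<close>

lemma laplacian_sphere_flows:
  fixes \<phi> :: "real^'n \<Rightarrow> real"
  assumes R: "R > 0" and \<phi>: "smooth_on_manifold (sphere 0 R) \<phi>" and x: "x \<in> sphere 0 R"
  shows "laplacian (sphere 0 R) \<phi> x = (1 / (2 * R\<^sup>2)) *
    (\<Sum>i\<in>UNIV. \<Sum>j\<in>UNIV - {i}. flow_deriv (axis i 1) (axis j 1) (flow_deriv (axis i 1) (axis j 1) \<phi>) x)"
proof -
  obtain U g where U: "open U" "x \<in> U" "smooth_on U g" "\<And>y. y \<in> U \<Longrightarrow> y \<in> sphere 0 R \<Longrightarrow> g y = \<phi> y"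
    by (rule smooth_on_manifoldE[OF \<phi> x], rule that)
  have lin: "linear (hess g x)" using has_derivative_hess[OF U(3,1,2)] by (rule has_derivative_linear)
  have xx: "x \<bullet> x = R\<^sup>2" using x by (simp add: dot_square_norm)
  have "(\<Sum>i\<in>UNIV. \<Sum>j\<in>UNIV - {i}. flow_deriv (axis i 1) (axis j 1) (flow_deriv (axis i 1) (axis j 1) \<phi>) x) =
    (\<Sum>i\<in>UNIV. \<Sum>j\<in>UNIV - {i}. hess g x (rot_gen (axis i 1) (axis j 1) x) \<bullet> rot_gen (axis i 1) (axis j 1) x +
      gradient g x \<bullet> rot_gen (axis i 1) (axis j 1) (rot_gen (axis i 1) (axis j 1) x))"
  proof (intro sum.cong refl)
    fix i j :: 'n assume "j \<in> UNIV - {i}"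
    then have "axis i (1::real) \<bullet> axis i 1 = 1" "axis j (1::real) \<bullet> axis j 1 = 1" "axis i (1::real) \<bullet> axis j 1 = 0"
      by (auto simp: inner_axis_axis)
    from flow_deriv_extension(4)[OF this R x U(2,1,3)] U(4)
    show "flow_deriv (axis i 1) (axis j 1) (flow_deriv (axis i 1) (axis j 1) \<phi>) x =
      hess g x (rot_gen (axis i 1) (axis j 1) x) \<bullet> rot_gen (axis i 1) (axis j 1) x +
      gradient g x \<bullet> rot_gen (axis i 1) (axis j 1) (rot_gen (axis i 1) (axis j 1) x)" by blast
  qed
  also have "\<dots> = 2 * (R\<^sup>2 * trace_hess g x - hess g x x \<bullet> x - (real CARD('n) - 1) * (gradient g x \<bullet> x))"
    by (simp only: sum_rot_gen[OF lin] trace_hess_def sum_Basis_vec xx)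
  also have "\<dots> = 2 * R\<^sup>2 * sphere_laplacian R g x"
    using R by (simp add: sphere_laplacian_def field_simps)
  also have "sphere_laplacian R g x = laplacian (sphere 0 R) \<phi> x"
    by (rule laplacian_sphere_extension[symmetric, OF R x U(2,1,3,4)])
  finally show ?thesis using R by simp
qed

lemma continuous_on_laplacian_sphere:
  fixes \<phi> :: "real^'n \<Rightarrow> real"
  assumes R: "R > 0" and \<phi>: "smooth_on_manifold (sphere 0 R) \<phi>"
  shows "continuous_on (sphere 0 R) (laplacian (sphere 0 R) \<phi>)"
proof (rule continuous_on_locally)
  fix x :: "real^'n" assume x: "x \<in> sphere 0 R"
  obtain U g where U: "open U" "x \<in> U" "smooth_on U g" "\<And>y. y \<in> U \<Longrightarrow> y \<in> sphere 0 R \<Longrightarrow> g y = \<phi> y"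
    by (rule smooth_on_manifoldE[OF \<phi> x], rule that)
  have c: "continuous_on U (sphere_laplacian R g)"
    unfolding sphere_laplacian_def[abs_def] using R
    by (intro continuous_intros continuous_on_trace_hess continuous_on_hess continuous_on_gradient U) auto
  have eq: "sphere_laplacian R g y = laplacian (sphere 0 R) \<phi> y" if "y \<in> U \<inter> sphere 0 R" for y
    using laplacian_sphere_extension[OF R _ _ U(1,3), of y \<phi>] that U(4) by auto
  show "\<exists>U h. open U \<and> x \<in> U \<and> continuous_on U h \<and> (\<forall>y\<in>U \<inter> sphere 0 R. h y = laplacian (sphere 0 R) \<phi> y)"
    by (intro exI[of _ U] exI[of _ "sphere_laplacian R g"] conjI ballI U(1,2) c eq)
qed

lemma continuous_on_smooth_manifold:
  fixes \<phi> :: "real^'n \<Rightarrow> real"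
  assumes "smooth_on_manifold M \<phi>" shows "continuous_on M \<phi>"
proof (rule continuous_on_locally)
  fix x assume x: "x \<in> M"
  obtain U g where U: "open U" "x \<in> U" "smooth_on U g" "\<And>y. y \<in> U \<Longrightarrow> y \<in> M \<Longrightarrow> g y = \<phi> y"
    by (rule smooth_on_manifoldE[OF assms x], rule that)
  show "\<exists>U h. open U \<and> x \<in> U \<and> continuous_on U h \<and> (\<forall>y\<in>U \<inter> M. h y = \<phi> y)"
    by (intro exI[of _ U] exI[of _ g] conjI ballI U(1,2) smooth_on_imp_continuous_on U(3) U(4)) auto
qed

text \<open>Each square of a flow derivative is symmetric by \<open>flow_deriv_symmetric\<close>,
  and the Laplacian is a constant times a finite sum of them.\<close>

lemma green_sphere:
  fixes \<phi> \<psi> :: "real^'n \<Rightarrow> real"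
  assumes R: "R > 0" and \<phi>: "smooth_on_manifold (sphere 0 R) \<phi>" and \<psi>: "smooth_on_manifold (sphere 0 R) \<psi>"
  shows "(LINT x|sphere_measure R. laplacian (sphere 0 R) \<phi> x * \<psi> x) =
    (LINT x|sphere_measure R. \<phi> x * laplacian (sphere 0 R) \<psi> x)"
proof -
  let ?\<nu> = "sphere_measure R :: (real^'n) measure"
  define F where "F = (\<lambda>u i j. flow_deriv (axis i 1 :: real^'n) (axis j 1) (flow_deriv (axis i 1) (axis j 1) u))"
  have on: "axis i (1::real) \<bullet> axis i 1 = 1" "axis j (1::real) \<bullet> axis j 1 = 1" "axis i (1::real) \<bullet> axis j 1 = 0"
    if "j \<in> UNIV - {i}" for i j :: 'n
    using that by (auto simp: inner_axis_axis)
  have F_cont: "continuous_on (sphere 0 R) (F u i j)" if "smooth_on_manifold (sphere 0 R) u" "j \<in> UNIV - {i}" for u i j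
    unfolding F_def using flow_smooth_manifold(2)[OF on[OF that(2)] R that(1)] by (simp add: flow_smooth_def)
  have c: "continuous_on (sphere 0 R) \<phi>" "continuous_on (sphere 0 R) \<psi>"
    using \<phi> \<psi> by (auto intro: continuous_on_smooth_manifold)
  have swap: "(LINT x|?\<nu>. (\<Sum>i\<in>UNIV. \<Sum>j\<in>UNIV - {i}. f i j x)) = (\<Sum>i\<in>UNIV. \<Sum>j\<in>UNIV - {i}. (LINT x|?\<nu>. f i j x))"
    if f: "\<And>i j. j \<in> UNIV - {i} \<Longrightarrow> continuous_on (sphere 0 R) (f i j)" for f :: "'n \<Rightarrow> 'n \<Rightarrow> real^'n \<Rightarrow> real"
  proof -
    have int: "integrable ?\<nu> (f i j)" if "j \<in> UNIV - {i}" for i j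
      by (rule integrable_sphere_measure[OF R f[OF that]])
    have "(LINT x|?\<nu>. (\<Sum>i\<in>UNIV. \<Sum>j\<in>UNIV - {i}. f i j x)) = (\<Sum>i\<in>UNIV. (LINT x|?\<nu>. (\<Sum>j\<in>UNIV - {i}. f i j x)))"
      by (intro Bochner_Integration.integral_sum Bochner_Integration.integrable_sum int)
    also have "\<dots> = (\<Sum>i\<in>UNIV. \<Sum>j\<in>UNIV - {i}. (LINT x|?\<nu>. f i j x))"
      by (intro sum.cong refl Bochner_Integration.integral_sum int)
    finally show ?thesis .
  qed
  have "(LINT x|?\<nu>. laplacian (sphere 0 R) \<phi> x * \<psi> x) =
      (LINT x|?\<nu>. (1 / (2 * R\<^sup>2)) * (\<Sum>i\<in>UNIV. \<Sum>j\<in>UNIV - {i}. F \<phi> i j x * \<psi> x))"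
    by (rule Bochner_Integration.integral_cong)
      (auto simp: laplacian_sphere_flows[OF R \<phi>] F_def sum_distrib_right sum_divide_distrib)
  also have "\<dots> = (1 / (2 * R\<^sup>2)) * (\<Sum>i\<in>UNIV. \<Sum>j\<in>UNIV - {i}. (LINT x|?\<nu>. F \<phi> i j x * \<psi> x))"
    by (subst swap[symmetric]) (auto intro!: continuous_intros F_cont \<phi> c)
  also have "\<dots> = (1 / (2 * R\<^sup>2)) * (\<Sum>i\<in>UNIV. \<Sum>j\<in>UNIV - {i}. (LINT x|?\<nu>. \<phi> x * F \<psi> i j x))"
    unfolding F_def using flow_deriv_symmetric[OF on R \<phi> \<psi>] by simp
  also have "\<dots> = (LINT x|?\<nu>. (1 / (2 * R\<^sup>2)) * (\<Sum>i\<in>UNIV. \<Sum>j\<in>UNIV - {i}. \<phi> x * F \<psi> i j x))"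
    by (subst swap[symmetric]) (auto intro!: continuous_intros F_cont \<psi> c)
  also have "\<dots> = (LINT x|?\<nu>. \<phi> x * laplacian (sphere 0 R) \<psi> x)"
    by (rule Bochner_Integration.integral_cong)
      (auto simp: laplacian_sphere_flows[OF R \<psi>] F_def sum_distrib_left sum_divide_distrib)
  finally show ?thesis .
qed


text \<open>By homogeneity the radial terms reproduce the power: with \<open>d\<close> the ambient
  dimension, the second derivative contributes \<open>k * (k - 1)\<close> and the first
  \<open>(d - 1) * k\<close>, in total \<open>k * (k + d - 2)\<close>. The ambient trace gives the
  term of lower degree.\<close>

lemma sphere_laplacian_linear_power:
  fixes a x :: "real^'n"
  shows "- sphere_laplacian R (\<lambda>x. (a \<bullet> x) ^ k) x = real k * (real k + real CARD('n) - 2) / R\<^sup>2 * (a \<bullet> x) ^ k -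
    real (k * (k - 1)) * (a \<bullet> a) * (a \<bullet> x) ^ (k - 2)"
proof -
  define t where "t = a \<bullet> x"
  have 1: "real k * t ^ (k - 1) * t = real k * t ^ k" by (cases k) auto
  have 2: "real (k * (k - 1)) * t ^ (k - 2) * t * t = real k * (real k - 1) * t ^ k"
  proof (cases "k < 2")
    case True then show ?thesis by (auto simp: less_2_cases_iff)
  next
    case False
    then obtain j where "k = Suc (Suc j)" by (metis add_2_eq_Suc le_Suc_ex not_less)
    then show ?thesis by (simp add: algebra_simps)
  qed
  have "- sphere_laplacian R (\<lambda>x. (a \<bullet> x) ^ k) x =
      (real (k * (k - 1)) * t ^ (k - 2) * t * t) / R\<^sup>2 + (real CARD('n) - 1) * (real k * t ^ (k - 1) * t) / R\<^sup>2 -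
      real (k * (k - 1)) * (a \<bullet> a) * t ^ (k - 2)"
    unfolding sphere_laplacian_def trace_hess_linear_power hess_linear_power gradient_linear_power inner_scaleR_left t_def by simp
  also have "\<dots> = real k * (real k + real CARD('n) - 2) / R\<^sup>2 * t ^ k - real (k * (k - 1)) * (a \<bullet> a) * t ^ (k - 2)"
    unfolding 1 2 by (simp add: algebra_simps add_divide_distrib diff_divide_distrib)
  finally show ?thesis by (simp only: t_def)
qed

section \<open>The uniform density on the sphere\<close>

context
  fixes T :: "'m::finite itself" and R :: real and S :: "(real^'n) set" and p :: "real^'n \<Rightarrow> real"
    and \<mu> :: "(real^'n) measure"
  assumes card_m: "CARD('m) = CARD('n) - 1" and R: "R > 0"
  defines "T \<equiv> TYPE('m)" and "S \<equiv> sphere 0 R" and "p \<equiv> unif_density T S" and "\<mu> \<equiv> weighted_measure T S p"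
begin

definition sphere_density :: real where
  "sphere_density = 1 / measure (sphere_measure R) S"

lemma sphere_density_pos: "sphere_density > 0"
  using emeasure_sphere_measure_space[OF R, where 'n='n]
  by (auto simp: sphere_density_def S_def measure_def enn2real_positive_iff)

lemma sphere_world_measure: "\<mu> = density (sphere_measure R) (\<lambda>_. ennreal sphere_density)"
  unfolding \<mu>_def p_def T_def S_def sphere_density_def
  by (simp add: weighted_measure_def unif_density_def[abs_def] riemannian_volume_sphere[OF R card_m])

lemma sets_sphere_world: "sets \<mu> = sets (restrict_space borel S)"
  by (simp add: sphere_world_measure sets_sphere_measure S_def)

lemma space_sphere_world: "space \<mu> = S"
  by (simp add: sphere_world_measure S_def)

lemma measurable_sphere_world: "continuous_on S f \<Longrightarrow> f \<in> borel_measurable \<mu>" for f :: "real^'n \<Rightarrow> real"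
  unfolding measurable_cong_sets[OF sets_sphere_world refl] by (rule borel_measurable_continuous_on_restrict)

lemma integrable_sphere_world: "continuous_on S f \<Longrightarrow> integrable \<mu> f" for f :: "real^'n \<Rightarrow> real"
  using integrable_sphere_measure[OF R, of f] measurable_sphere_measure[of R f] sphere_density_pos
  unfolding sphere_world_measure S_def by (subst integrable_density) auto

lemma integral_sphere_world:
  "continuous_on S f \<Longrightarrow> (LINT x|\<mu>. f x) = sphere_density * (LINT x|sphere_measure R. f x)" for f :: "real^'n \<Rightarrow> real"
  using measurable_sphere_measure[of R f] sphere_density_pos
  unfolding sphere_world_measure S_def by (subst integral_density) auto

lemma square_integrable_sphere_world: "continuous_on S f \<Longrightarrow> square_integrable \<mu> f" for f :: "real^'n \<Rightarrow> real"
  unfolding square_integrable_def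
  by (intro conjI measurable_sphere_world integrable_sphere_world continuous_intros)

lemma AE_zero_sphere_world:
  fixes f :: "real^'n \<Rightarrow> real"
  assumes "AE x in \<mu>. f x = 0" "continuous_on S f" "x \<in> S"
  shows "f x = 0"
proof (rule AE_zero_sphere[OF R _ assms(2,3)[unfolded S_def]])
  show "AE x in sphere_measure R. f x = 0"
    using assms(1) sphere_density_pos unfolding sphere_world_measure by (subst (asm) AE_density) auto
qed

lemma weighted_laplacian_sphere_world:
  "x \<in> S \<Longrightarrow> weighted_laplacian S p \<phi> x = laplacian S \<phi> x"
  unfolding S_def p_def by (rule weighted_laplacian_sphere[OF R])

text \<open>On the compact sphere \<open>v\<close> is itself a test function, so a constant sequence
  witnesses membership in the closure.\<close>

lemma sphere_eigenfunction:
  assumes v: "smooth_on UNIV v" and ev: "\<And>x. x \<in> S \<Longrightarrow> sphere_laplacian R v x = - l * v x"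
  shows "v \<in> eigenspace T S p l"
proof -
  have c: "continuous_on S v" using smooth_on_imp_continuous_on[OF v] continuous_on_subset by blast
  have test: "test_function S v"
    unfolding test_function_def
  proof (intro conjI exI)
    show "smooth_on_manifold S v" by (rule smooth_on_imp_smooth_on_manifold[OF _ _ v]) auto
    show "compact S" by (simp add: S_def)
  qed auto
  have L: "- weighted_laplacian S p v x = l * v x" if x: "x \<in> S" for x
    using laplacian_sphere_extension[OF R x[unfolded S_def] UNIV_I open_UNIV v, of v] ev[OF x]
    unfolding weighted_laplacian_sphere_world[OF x] by (simp add: S_def)
  have "(\<integral>\<^sup>+x. ennreal ((- weighted_laplacian S p v x - l * v x)\<^sup>2) \<partial>\<mu>) = (\<integral>\<^sup>+x. 0 \<partial>\<mu>)"
    by (rule nn_integral_cong) (simp add: space_sphere_world L)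
  then have "L2_tendsto \<mu> (\<lambda>k x. - weighted_laplacian S p v x) (\<lambda>x. l * v x)"
    by (simp add: L2_tendsto_def)
  moreover have "L2_tendsto \<mu> (\<lambda>k. v) v" by (simp add: L2_tendsto_def)
  moreover have "square_integrable \<mu> v" "square_integrable \<mu> (\<lambda>x. l * v x)"
    by (intro square_integrable_sphere_world continuous_intros c)+
  ultimately show ?thesis
    unfolding eigenspace_def neg_weighted_laplacian_graph_def mem_Collect_eq prod.case \<mu>_def[symmetric]
    using test by (intro conjI exI[of _ "\<lambda>_. v"]) auto
qed

theorem linear_world_sphere:
  assumes card_n: "CARD('n) \<ge> 2"
  shows "linear_world T S p (\<lambda>k. real k * (real k + real CARD('n) - 2) / R\<^sup>2)"
proof (unfold_locales, unfold \<mu>_def[symmetric])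
  show "S \<in> sets borel" by (simp add: S_def)
  show "sets \<mu> = sets (restrict_space borel S)" by (rule sets_sphere_world)
  show "integrable \<mu> (\<lambda>x. exp (c * norm x))" for c
    by (intro integrable_sphere_world continuous_intros)
  show "strict_mono (\<lambda>k. real k * (real k + real CARD('n) - 2) / R\<^sup>2)"
  proof (rule strict_monoI)
    fix j k :: nat assume jk: "j < k"
    have "real j * (real j + real CARD('n) - 2) \<le> real j * (real k + real CARD('n) - 2)"
      using jk by (intro mult_left_mono) auto
    \<comment> \<open>With \<open>d\<close> the ambient dimension, \<open>k + d - 2\<close> is
      positive because \<open>k \<ge> 1\<close> and \<open>d \<ge> 2\<close>.\<close>
    also have "\<dots> < real k * (real k + real CARD('n) - 2)"
      using jk card_n by (intro mult_strict_right_mono) auto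
    finally show "real j * (real j + real CARD('n) - 2) / R\<^sup>2 < real k * (real k + real CARD('n) - 2) / R\<^sup>2"
      using R by (simp add: divide_strict_right_mono)
  qed
next
  fix \<phi> :: "real^'n \<Rightarrow> real" assume "test_function S \<phi>"
  then have \<phi>: "smooth_on_manifold (sphere 0 R) \<phi>" by (simp add: test_function_def S_def)
  have c: "continuous_on S \<phi>" "continuous_on S (laplacian S \<phi>)"
    using continuous_on_smooth_manifold[OF \<phi>] continuous_on_laplacian_sphere[OF R \<phi>] by (simp_all add: S_def)
  have cw: "continuous_on S (weighted_laplacian S p \<phi>)"
    using c(2) by (simp add: weighted_laplacian_sphere_world cong: continuous_on_cong)
  show "square_integrable \<mu> \<phi>" by (rule square_integrable_sphere_world[OF c(1)])
  show "square_integrable \<mu> (\<lambda>x. - weighted_laplacian S p \<phi> x)"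
    by (intro square_integrable_sphere_world continuous_intros cw)
  fix a :: "real^'n" and k
  define v where "v = (\<lambda>x. (a \<bullet> x) ^ k)"
  have v: "smooth_on UNIV v" unfolding v_def by (rule smooth_on_linear_power)
  have vm: "smooth_on_manifold (sphere 0 R) v" by (rule smooth_on_imp_smooth_on_manifold[OF _ _ v]) auto
  have cv: "continuous_on S v" "continuous_on S (laplacian S v)"
    using continuous_on_smooth_manifold[OF vm] continuous_on_laplacian_sphere[OF R vm] by (simp_all add: S_def)
  have lv: "- laplacian S v x = real k * (real k + real CARD('n) - 2) / R\<^sup>2 * (a \<bullet> x) ^ k - real (k * (k - 1)) * (a \<bullet> a) * (a \<bullet> x) ^ (k - 2)"
    if x: "x \<in> S" for x
    using laplacian_sphere_extension[OF R x[unfolded S_def] UNIV_I open_UNIV v, of v] sphere_laplacian_linear_power[of R a k x]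
    by (simp add: S_def v_def)
  have "(LINT x|\<mu>. - weighted_laplacian S p \<phi> x * (a \<bullet> x) ^ k) = (LINT x|\<mu>. - (laplacian S \<phi> x * v x))"
    by (rule Bochner_Integration.integral_cong) (simp_all add: space_sphere_world weighted_laplacian_sphere_world v_def)
  also have "\<dots> = - (sphere_density * (LINT x|sphere_measure R. laplacian S \<phi> x * v x))"
    by (simp add: integral_sphere_world continuous_on_mult c cv)
  also have "(LINT x|sphere_measure R. laplacian S \<phi> x * v x) = (LINT x|sphere_measure R. \<phi> x * laplacian S v x)"
    unfolding S_def by (rule green_sphere[OF R \<phi> vm])
  also have "- (sphere_density * \<dots>) = (LINT x|\<mu>. - (\<phi> x * laplacian S v x))"
    by (simp add: integral_sphere_world continuous_on_mult c cv)
  also have "\<dots> = (LINT x|\<mu>. \<phi> x * (real k * (real k + real CARD('n) - 2) / R\<^sup>2 * (a \<bullet> x) ^ k - real (k * (k - 1)) * (a \<bullet> a) * (a \<bullet> x) ^ (k - 2)))"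
    by (rule Bochner_Integration.integral_cong) (simp_all only: space_sphere_world lv[symmetric] mult_minus_right)
  finally show "(LINT x|\<mu>. - weighted_laplacian S p \<phi> x * (a \<bullet> x) ^ k) =
      (LINT x|\<mu>. \<phi> x * (real k * (real k + real CARD('n) - 2) / R\<^sup>2 * (a \<bullet> x) ^ k - real (k * (k - 1)) * (a \<bullet> a) * (a \<bullet> x) ^ (k - 2)))" .
next
  fix a :: "real^'n" assume ae: "AE x in \<mu>. a \<bullet> x = 0"
  show "a = 0"
  proof (rule ccontr)
    assume a: "a \<noteq> 0"
    then have "(R / norm a) *\<^sub>R a \<in> S" using R by (simp add: S_def)
    from AE_zero_sphere_world[OF ae _ this] have "a \<bullet> ((R / norm a) *\<^sub>R a) = 0" by (simp add: continuous_intros)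
    then show False using a R by simp
  qed
next
  fix a :: "real^'n"
  have "sphere_laplacian R (\<lambda>x. a \<bullet> x) x = - (real 1 * (real 1 + real CARD('n) - 2) / R\<^sup>2) * (a \<bullet> x)" for x
    using sphere_laplacian_linear_power[of R a 1 x] by simp
  then show "(\<lambda>x. a \<bullet> x) \<in> eigenspace T S p (real 1 * (real 1 + real CARD('n) - 2) / R\<^sup>2)"
    by (intro sphere_eigenfunction smooth_on_inner)
next
  \<comment> \<open>The product of two different coordinates is a harmonic polynomial, homogeneous
    of degree two, so it restricts to a spherical harmonic.\<close>
  obtain i j :: 'n where ij: "i \<noteq> j" using ex_distinct_indices[OF card_n] by blast
  define a :: "real^'n" where "a = axis i 1"
  define b :: "real^'n" where "b = axis j 1"
  have ab: "a \<bullet> b = 0" "b \<bullet> a = 0" "a \<bullet> a = 1" "b \<bullet> b = 1"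
    using ij by (simp_all add: a_def b_def inner_axis_axis)
  define v where "v = (\<lambda>x. (a \<bullet> x) * (b \<bullet> x))"
  have sv: "smooth_on UNIV v" unfolding v_def by (intro smooth_on_mult smooth_on_inner open_UNIV)
  have g: "gradient v = (\<lambda>x. (a \<bullet> x) *\<^sub>R b + (b \<bullet> x) *\<^sub>R a)"
    unfolding v_def by (simp add: fun_eq_iff gradient_mult[OF smooth_on_inner smooth_on_inner] gradient_inner)
  have h: "hess v x = (\<lambda>w. (a \<bullet> w) *\<^sub>R b + (b \<bullet> w) *\<^sub>R a)" for x
    unfolding g by (rule frechet_derivative_eq_has_derivative) (auto intro!: derivative_eq_intros)
  have t: "trace_hess v x = 0" for x
    unfolding v_def by (simp add: trace_hess_mult[OF smooth_on_inner smooth_on_inner] trace_hess_inner gradient_inner ab)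
  have "gradient v x \<bullet> x = 2 * v x" for x
    unfolding g by (simp add: v_def inner_add_left)
  moreover have "hess v x x \<bullet> x = 2 * v x" for x
    unfolding h by (simp add: v_def inner_add_left)
  \<comment> \<open>Both radial expressions equal \<open>2 * v x\<close>, so the coefficient is
    \<open>2 + 2 * (d - 1) = 2 * d\<close> with \<open>d\<close> the ambient dimension.\<close>
  ultimately have "sphere_laplacian R v x = - (real 2 * (real 2 + real CARD('n) - 2) / R\<^sup>2) * v x" for x
    unfolding sphere_laplacian_def t by (simp add: divide_inverse algebra_simps)
  then have "v \<in> eigenspace T S p (real 2 * (real 2 + real CARD('n) - 2) / R\<^sup>2)"
    by (intro sphere_eigenfunction sv)
  moreover have "\<not> (AE x in \<mu>. v x = 0)"
  proof
    assume ae: "AE x in \<mu>. v x = 0"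
    have "norm (a + b) = sqrt 2" using ab by (simp add: norm_eq_sqrt_inner inner_add_left inner_add_right)
    \<comment> \<open>A point of the sphere at which both coordinates are nonzero.\<close>
    then have "(R / sqrt 2) *\<^sub>R (a + b) \<in> S" using R by (simp add: S_def)
    from AE_zero_sphere_world[OF ae _ this] have "v ((R / sqrt 2) *\<^sub>R (a + b)) = 0"
      using smooth_on_imp_continuous_on[OF sv] continuous_on_subset by blast
    then show False using R by (simp add: v_def inner_add_right ab)
  qed
  ultimately show "real 2 * (real 2 + real CARD('n) - 2) / R\<^sup>2 \<in> eigenvalues T S p"
    unfolding eigenvalues_def \<mu>_def by blast
qed simp

end


section \<open>The two spectral ratios\<close>

theorem corollary4p6:
  fixes R :: real
  assumes "CARD('n::finite) \<ge> 2"
    and "CARD('m::finite) = CARD('n) - 1"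
    and "R > 0"
  shows "\<exists>lG lGnl lS lSnl.
    linear_eigenvalue TYPE('n) (UNIV :: (real ^ 'n) set) std_gaussian lG \<and>
    nonlinear_eigenvalue TYPE('n) (UNIV :: (real ^ 'n) set) std_gaussian lGnl \<and>
    linear_eigenvalue TYPE('m) (sphere (0 :: real ^ 'n) R)
      (unif_density TYPE('m) (sphere 0 R)) lS \<and>
    nonlinear_eigenvalue TYPE('m) (sphere (0 :: real ^ 'n) R)
      (unif_density TYPE('m) (sphere 0 R)) lSnl \<and>
    lGnl / lG = 2 \<and>
    lSnl / lS = 2 * real CARD('n) / (real CARD('n) - 1) \<and>
    2 * real CARD('n) / (real CARD('n) - 1) > 2 \<and>
    lSnl / lS > lGnl / lG"
proof -
  define n where "n = real CARD('n)"
  have n: "n \<ge> 2" using assms(1) by (simp add: n_def)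
  \<comment> \<open>The eigenvalues of degrees 1 and 2, in the form in which the locale theorems
    deliver them. With \<open>d\<close> the ambient dimension they are
    \<open>(d - 1) / R\<^sup>2\<close> and \<open>2 * d / R\<^sup>2\<close>, so the radius cancels
    in the ratio.\<close>
  define lS where "lS = real 1 * (real 1 + real CARD('n) - 2) / R\<^sup>2"
  define lSnl where "lSnl = real 2 * (real 2 + real CARD('n) - 2) / R\<^sup>2"
  have ratio: "lSnl / lS = 2 * n / (n - 1)"
    using assms(3) n by (simp add: lS_def lSnl_def n_def[symmetric])
  have gap: "2 * n / (n - 1) > 2" using n by (simp add: field_simps)
  note gaussian = linear_world_gaussian[OF assms(1)]
  note sphere = linear_world_sphere[OF assms(2,3,1)]
  show ?thesis
    using linear_world.linear_eigenvalue[OF gaussian] linear_world.nonlinear_eigenvalue[OF gaussian]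
      linear_world.linear_eigenvalue[OF sphere] linear_world.nonlinear_eigenvalue[OF sphere] ratio gap
    by (intro exI[of _ "real 1"] exI[of _ "real 2"] exI[of _ lS] exI[of _ lSnl])
      (use assms(3) in \<open>simp add: n_def lS_def lSnl_def\<close>)
qed

end
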